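(* Let $\mathcal{P}=\langle\Sigma\mid\mathcal{R}\rangle$ be a semigroup presentation, let $w\in\Sigma^+$, and let $G=\mathcal{D}(\mathcal{P},w)$ be the corresponding diagram group. Then the following three conditions are equivalent. 1. The group $G$ contains $\mathbf{Z}\wr\mathbf{Z}$ as a subgroup. 2. The group $G$ contains elements $a,b$ such that $[a,b]\ne1$ and $[a,a^b]=1$ (in other words, there are two distinct elements in $G$ that are conjugate and commute). 3. There are nonempty words $x,y,z$ over $\Sigma$ such that the equalities $xy=x$, $yz=z$, $xz=w$ hold modulo $\mathcal{P}$, and $\mathcal{D}(\mathcal{P},y)\ne1$.
   Context: Notation: $a^b=b^{-1}ab$, $[a,b]=a^{-1}b^{-1}ab$. $\mathbf{Z}\wr\mathbf{Z}$ is the restricted wreath product of two infinite cyclic groups. Diagram groups. A semigroup presentation $\mathcal{P}=\langle\Sigma\mid\mathcal{R}\rangle$ consists of an alphabet $\Sigma$ and a set $\mathcal{R}$ of pairs $(u,v)$ of non-empty words over $\Sigma$, written $u=v$; presentations are assumed anti-symmetric: if $(u=v)\in\mathcal{R}$ then $(v=u)\notin\mathcal{R}$. $\Sigma^+$ and $\Sigma^*$ are the free semigroup and free monoid on $\Sigma$. Two words in $\Sigma^+$ are equal modulo $\mathcal{P}$ if they represent the same element of the semigroup given by $\mathcal{P}$, i.e. the quotient of $\Sigma^+$ by the smallest congruence containing $\mathcal{R}$. The graph $\Gamma(\mathcal{P})$ has vertex set $\Sigma^+$ and an edge $(p,u\to v,q)$ from $puq$ to $pvq$ for all $p,q\in\Sigma^*$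 and all $u,v$ with $(u=v)\in\mathcal{R}$ or $(v=u)\in\mathcal{R}$; the inverse edge is $(p,v\to u,q)$. The Squier complex $\mathcal{K}(\mathcal{P})$ is the 2-complex obtained from $\Gamma(\mathcal{P})$ by attaching, for all $p,z,q\in\Sigma^*$ and $(\ell_1=r_1),(\ell_2=r_2)\in\mathcal{R}$, a 2-cell along the closed path $p_1p_2^{-1}$, where $p_1=(p,\ell_1\to r_1,z\ell_2q)(pr_1z,\ell_2\to r_2,q)$ and $p_2=(p\ell_1z,\ell_2\to r_2,q)(p,\ell_1\to r_1,zr_2q)$. For $w\in\Sigma^+$ the diagram group $\mathcal{D}(\mathcal{P},w)$ is (up to isomorphism, by Kilibarda's theorem; this may be taken as the definition) the fundamental group $\pi_1(\mathcal{K}(\mathcal{P}),w)$. *)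

theory Defs
  imports "HOL-Algebra.Product_Groups" "Graph_Theory.Arc_Walk"
begin

subsection \<open>Conjugates, commutators, restricted wreath products\<close>

definition conjugate :: "('g, 'm) monoid_scheme \<Rightarrow> 'g \<Rightarrow> 'g \<Rightarrow> 'g" where
  "conjugate G a b = inv\<^bsub>G\<^esub> b \<otimes>\<^bsub>G\<^esub> a \<otimes>\<^bsub>G\<^esub> b"

definition commutator :: "('g, 'm) monoid_scheme \<Rightarrow> 'g \<Rightarrow> 'g \<Rightarrow> 'g" where
  "commutator G a b = inv\<^bsub>G\<^esub> a \<otimes>\<^bsub>G\<^esub> inv\<^bsub>G\<^esub> b \<otimes>\<^bsub>G\<^esub> a \<otimes>\<^bsub>G\<^esub> b"

text \<open>The base group is the direct sum (finitely supported functions) of copies of \<open>G\<close>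
  indexed by \<open>H\<close>, on which \<open>H\<close> acts by left translation.\<close>

definition wreath_product ::
    "('g, 'm) monoid_scheme \<Rightarrow> ('h, 'n) monoid_scheme \<Rightarrow> (('h \<Rightarrow> 'g) \<times> 'h) monoid" where
  "wreath_product G H =
    \<lparr>carrier = carrier (sum_group (carrier H) (\<lambda>_. G)) \<times> carrier H,
     monoid.mult = (\<lambda>(f, a) (g, b).
       (\<lambda>h\<in>carrier H. f h \<otimes>\<^bsub>G\<^esub> g (inv\<^bsub>H\<^esub> a \<otimes>\<^bsub>H\<^esub> h), a \<otimes>\<^bsub>H\<^esub> b)),
     one = (\<lambda>h\<in>carrier H. \<one>\<^bsub>G\<^esub>, \<one>\<^bsub>H\<^esub>)\<rparr>"

definition contains_copy :: "('g, 'm) monoid_scheme \<Rightarrow> ('h, 'n) monoid_scheme \<Rightarrow> bool" where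
  "contains_copy G H \<longleftrightarrow> (\<exists>S. subgroup S G \<and> H \<cong> G\<lparr>carrier := S\<rparr>)"

subsection \<open>The fundamental group of a combinatorial 2-complex\<close>

text \<open>The 1-skeleton is a graph \<open>K\<close> with arcs in mutually inverse pairs \<open>e\<close>, \<open>rv e\<close>;
  the 2-cells are given by the set \<open>C\<close> of closed walks along which they are attached.\<close>

inductive homotopic ::
    "('v, 'e) pre_digraph \<Rightarrow> ('e \<Rightarrow> 'e) \<Rightarrow> 'e list set \<Rightarrow> 'v \<Rightarrow> 'v \<Rightarrow> 'e list \<Rightarrow> 'e list \<Rightarrow> bool"
  for K :: "('v, 'e) pre_digraph" and rv :: "'e \<Rightarrow> 'e" and C :: "'e list set" and u v :: 'v
where
  refl: "pre_digraph.awalk K u p v \<Longrightarrow> homotopic K rv C u v p p"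
| sym: "homotopic K rv C u v p q \<Longrightarrow> homotopic K rv C u v q p"
| trans: "homotopic K rv C u v p q \<Longrightarrow> homotopic K rv C u v q r \<Longrightarrow> homotopic K rv C u v p r"
| backtrack: "pre_digraph.awalk K u (p @ [e, rv e] @ q) v \<Longrightarrow>
    homotopic K rv C u v (p @ [e, rv e] @ q) (p @ q)"
| cell: "c \<in> C \<Longrightarrow> pre_digraph.awalk K u (p @ c @ q) v \<Longrightarrow>
    homotopic K rv C u v (p @ c @ q) (p @ q)"

definition homotopy_rel ::
    "('v, 'e) pre_digraph \<Rightarrow> ('e \<Rightarrow> 'e) \<Rightarrow> 'e list set \<Rightarrow> 'v \<Rightarrow> ('e list \<times> 'e list) set" where
  "homotopy_rel K rv C v = {(p, q). homotopic K rv C v v p q}"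

definition fundamental_group ::
    "('v, 'e) pre_digraph \<Rightarrow> ('e \<Rightarrow> 'e) \<Rightarrow> 'e list set \<Rightarrow> 'v \<Rightarrow> 'e list set monoid" where
  "fundamental_group K rv C v =
    \<lparr>carrier = {p. pre_digraph.awalk K v p v} // homotopy_rel K rv C v,
     monoid.mult = (\<lambda>P Q. \<Union>p\<in>P. \<Union>q\<in>Q. homotopy_rel K rv C v `` {p @ q}),
     one = homotopy_rel K rv C v `` {[]}\<rparr>"

subsection \<open>Semigroup presentations, Squier complexes, diagram groups\<close>

definition nonempty_words :: "'a set \<Rightarrow> 'a list set" where
  "nonempty_words \<Sigma> = lists \<Sigma> - {[]}"

definition semigroup_presentation :: "'a set \<Rightarrow> ('a list \<times> 'a list) set \<Rightarrow> bool" where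
  "semigroup_presentation \<Sigma> R \<longleftrightarrow>
    R \<subseteq> nonempty_words \<Sigma> \<times> nonempty_words \<Sigma> \<and> (\<forall>u v. (u, v) \<in> R \<longrightarrow> (v, u) \<notin> R)"

inductive equal_modulo :: "'a set \<Rightarrow> ('a list \<times> 'a list) set \<Rightarrow> 'a list \<Rightarrow> 'a list \<Rightarrow> bool"
  for \<Sigma> :: "'a set" and R :: "('a list \<times> 'a list) set"
where
  rel: "(u, v) \<in> R \<Longrightarrow> equal_modulo \<Sigma> R u v"
| refl: "u \<in> nonempty_words \<Sigma> \<Longrightarrow> equal_modulo \<Sigma> R u u"
| sym: "equal_modulo \<Sigma> R u v \<Longrightarrow> equal_modulo \<Sigma> R v u"
| trans: "equal_modulo \<Sigma> R u v \<Longrightarrow> equal_modulo \<Sigma> R v w \<Longrightarrow> equal_modulo \<Sigma> R u w"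
| mult: "equal_modulo \<Sigma> R u v \<Longrightarrow> equal_modulo \<Sigma> R u' v' \<Longrightarrow> equal_modulo \<Sigma> R (u @ u') (v @ v')"

text \<open>\<open>Edge p u v q\<close> is the edge \<open>(p, u \<rightarrow> v, q)\<close> from \<open>puq\<close> to \<open>pvq\<close>.\<close>

datatype 'a edge = Edge "'a list" "'a list" "'a list" "'a list"

primrec edge_source :: "'a edge \<Rightarrow> 'a list" where
  "edge_source (Edge p u v q) = p @ u @ q"

primrec edge_target :: "'a edge \<Rightarrow> 'a list" where
  "edge_target (Edge p u v q) = p @ v @ q"

primrec edge_inverse :: "'a edge \<Rightarrow> 'a edge" where
  "edge_inverse (Edge p u v q) = Edge p v u q"

definition squier_graph :: "'a set \<Rightarrow> ('a list \<times> 'a list) set \<Rightarrow> ('a list, 'a edge) pre_digraph" where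
  "squier_graph \<Sigma> R =
    \<lparr>verts = nonempty_words \<Sigma>,
     arcs = {Edge p u v q | p u v q.
       p \<in> lists \<Sigma> \<and> q \<in> lists \<Sigma> \<and> ((u, v) \<in> R \<or> (v, u) \<in> R)},
     tail = edge_source, head = edge_target\<rparr>"

text \<open>The list below is \<open>p\<^sub>1 p\<^sub>2\<^sup>-\<^sup>1\<close> with
  \<open>p\<^sub>1 = (p, l\<^sub>1 \<rightarrow> r\<^sub>1, z l\<^sub>2 q) (p r\<^sub>1 z, l\<^sub>2 \<rightarrow> r\<^sub>2, q)\<close> and
  \<open>p\<^sub>2 = (p l\<^sub>1 z, l\<^sub>2 \<rightarrow> r\<^sub>2, q) (p, l\<^sub>1 \<rightarrow> r\<^sub>1, z r\<^sub>2 q)\<close>.\<close>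

definition squier_cells :: "'a set \<Rightarrow> ('a list \<times> 'a list) set \<Rightarrow> 'a edge list set" where
  "squier_cells \<Sigma> R =
    {[Edge p l1 r1 (z @ l2 @ q), Edge (p @ r1 @ z) l2 r2 q,
      edge_inverse (Edge p l1 r1 (z @ r2 @ q)), edge_inverse (Edge (p @ l1 @ z) l2 r2 q)]
     | p z q l1 r1 l2 r2.
       p \<in> lists \<Sigma> \<and> z \<in> lists \<Sigma> \<and> q \<in> lists \<Sigma> \<and> (l1, r1) \<in> R \<and> (l2, r2) \<in> R}"

definition diagram_group ::
    "'a set \<Rightarrow> ('a list \<times> 'a list) set \<Rightarrow> 'a list \<Rightarrow> 'a edge list set monoid" where
  "diagram_group \<Sigma> R w =
    fundamental_group (squier_graph \<Sigma> R) edge_inverse (squier_cells \<Sigma> R) w"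

end

theory Submission
  imports Defs "HOL-Algebra.FiniteProduct"
begin

text \<open>The diagram group \<open>G = D(P, w)\<close> acts on the directed 2-tree of \<open>w\<close>, whose positive paths from the
  initial to the terminal vertex are the lifts of the words equal to \<open>w\<close>: \<open>G\<close> acts freely on these
  paths, and transitively on those with a given label. At a vertex \<open>x\<close> fixed by \<open>g\<close>, the edges leaving \<open>x\<close>
  form a tree on which \<open>g\<close> acts without inversions; \<open>x\<close> is called hyperbolic for \<open>g\<close> if no edge at \<open>x\<close>
  is fixed. Every \<open>g \<noteq> 1\<close> has finitely many hyperbolic vertices, at least one, and they are linearly
  ordered, so that they are fixed by everything that commutes with \<open>g\<close>.

  If \<open>a\<close> commutes with \<open>d = a\<^sup>b\<close> and \<open>c = [a, b] \<noteq> 1\<close>, let \<open>s\<close> be hyperbolic for \<open>c = a\<^sup>-\<^sup>1d\<close>. Then \<open>a\<close> and \<open>d\<close>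
  fix \<open>s\<close> and differ on every edge leaving \<open>s\<close>, so \<open>s\<close> is hyperbolic for one of them, as commuting isometries
  of a tree with fixed points have a common one. Moreover \<open>b\<close> moves \<open>s\<close>: otherwise \<open>a\<close> and \<open>d\<close> would be
  conjugate commuting hyperbolic isometries, and these agree somewhere unless the conjugating one has an orbit
  of length two. A path between \<open>s\<close> and its translate is labelled by a word \<open>y\<close> as in (3), the paths before
  and after it by \<open>x\<close> and \<open>z\<close>.

  Conversely, given \<open>x, y, z\<close>, there are an element \<open>a \<noteq> 1\<close> supported on a path \<open>Y\<close> labelled \<open>y\<close> and an
  element \<open>b\<close> translating the end of \<open>Y\<close> to its beginning. The translates of \<open>Y\<close> by powers of \<open>b\<close> are
  consecutive, so the conjugates of \<open>a\<close> by these powers commute and are independent.\<close>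

section \<open>Isometries of trees\<close>

text \<open>Two points shape the argument. First, the universal cover of the Squier complex has to
  be handled concretely. Its vertices are the \<open>state\<close> paths of the 2-tree. Such a path
  is determined by the finite set of cells in the history of its edges, and the number of cells in
  which two paths differ is the length of a shortest walk between them. Every cell has a starting
  vertex, and a move at one vertex does not affect the cells that start at another one. Hence, if
  \<open>x\<close> is a hyperbolic vertex of \<open>g\<close>, each walk from a path to its
  translate by \<open>g\<close> contains a move at \<open>x\<close>. This gives the finiteness and,
  applied to walks through a fixed vertex, the linear order; hyperbolic vertices exist because they
  lie on paths of least displacement. Secondly, \<open>b\<close> might reverse the axis of
  \<open>a\<close> in the tree at a fixed vertex, which would make the conjugate translate in the
  opposite direction. This cannot be excluded within that tree. It is excluded by following an edge
  from an orbit of length two to a later vertex fixed by \<open>b\<close>: an element of a diagram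
  group that fixes a vertex never interchanges two edges leaving it.\<close>

text \<open>The vertex set of a simplicial tree with its path metric, axiomatised by 0-hyperbolicity.\<close>

locale tree_metric =
  fixes V :: "'n set" and d :: "'n \<Rightarrow> 'n \<Rightarrow> nat"
  assumes zero: "\<lbrakk>x \<in> V; y \<in> V\<rbrakk> \<Longrightarrow> d x y = 0 \<longleftrightarrow> x = y"
    and sym: "\<lbrakk>x \<in> V; y \<in> V\<rbrakk> \<Longrightarrow> d x y = d y x"
    and four_point: "\<lbrakk>x \<in> V; y \<in> V; z \<in> V; t \<in> V\<rbrakk> \<Longrightarrow>
      d x y + d z t \<le> max (d x z + d y t) (d x t + d y z)"
    and parity: "\<lbrakk>x \<in> V; y \<in> V; z \<in> V\<rbrakk> \<Longrightarrow> even (d x y + d y z + d x z)"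
    and step: "\<lbrakk>x \<in> V; y \<in> V; d x y = Suc n\<rbrakk> \<Longrightarrow> \<exists>z\<in>V. d x z = n \<and> d z y = 1"
begin

lemma self [simp]: "x \<in> V \<Longrightarrow> d x x = 0"
  using zero by blast

lemma triangle:
  assumes "x \<in> V" "y \<in> V" "z \<in> V"
  shows "d x y \<le> d x z + d z y"
  using four_point[of x y z z] assms sym[of y z] by auto

lemma geodesic_point:
  assumes "x \<in> V" "y \<in> V" "d x y = m + n"
  shows "\<exists>z\<in>V. d x z = m \<and> d z y = n"
  using assms
proof (induction n arbitrary: y)
  case 0
  then show ?case by auto
next
  case (Suc n)
  then obtain y' where y': "y' \<in> V" "d x y' = m + n" "d y' y = 1"
    using step[of x y "m + n"] by auto
  obtain z where z: "z \<in> V" "d x z = m" "d z y' = n"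
    using Suc.IH[OF Suc.prems(1) y'(1,2)] by auto
  have "d z y \<le> Suc n" using triangle[of z y y'] z y' Suc.prems by auto
  moreover have "m + Suc n \<le> d x z + d z y" using triangle[of x y z] z Suc.prems by auto
  ultimately show ?case using z by (intro bexI[of _ z]) auto
qed

lemma geodesic_unique:
  assumes "x \<in> V" "y \<in> V" "z \<in> V" "z' \<in> V" "d x y = d x z + d z y"
    "d x z' = d x z" "d z' y = d z y"
  shows "z = z'"
proof -
  have "d x y + d z z' \<le> max (d x z + d y z') (d x z' + d y z)"
    using four_point assms by blast
  moreover have "d y z' = d z y" "d y z = d z y" using assms sym by metis+
  ultimately have "d z z' = 0" using assms by auto
  then show ?thesis using zero assms by blast
qed

text \<open>The triangle inequality and parity leave only \<open>d y q + 1\<close> and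
  \<open>d y q - 1\<close>. In the second case \<open>q'\<close> and \<open>p\<close> would both be
  the neighbour of \<open>q\<close> on its geodesic to \<open>y\<close>.\<close>

lemma no_return:
  assumes V: "y \<in> V" "p \<in> V" "q \<in> V" "q' \<in> V"
    and "d y q = d y p + 1" "d p q = 1" "d q q' = 1" "q' \<noteq> p"
  shows "d y q' = d y q + 1"
proof (rule ccontr)
  assume neq: "d y q' \<noteq> d y q + 1"
  have "d y q' \<le> d y q + d q q'" "d y q \<le> d y q' + d q' q"
    using triangle V by blast+
  moreover have "even (d y q + d q q' + d y q')" using parity V by blast
  moreover have "d q' q = 1" using assms sym by metis
  ultimately have "d y q' = d y p"
    using neq assms by presburger
  then have "p = q'"
    using geodesic_unique[of y q p q'] assms \<open>d q' q = 1\<close> by simp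
  then show False using assms by simp
qed

text \<open>If \<open>no_return\<close> applies at one step, it applies at the next, so that only
  the first step and the absence of backtracking have to be checked.\<close>

lemma no_return_sequence:
  assumes y: "y \<in> V" and f: "\<And>i. i \<le> n \<Longrightarrow> f i \<in> V"
    and one: "\<And>i. i < n \<Longrightarrow> d (f i) (f (Suc i)) = 1"
    and turn: "\<And>i. Suc (Suc i) \<le> n \<Longrightarrow> f (Suc (Suc i)) \<noteq> f i"
    and first: "0 < n \<Longrightarrow> d y (f 1) = d y (f 0) + 1"
  shows "i \<le> n \<Longrightarrow> d y (f i) = d y (f 0) + i"
proof (induction i rule: less_induct)
  case (less i)
  consider "i = 0" | "i = 1" | j where "i = Suc (Suc j)" by (metis One_nat_def not0_implies_Suc)
  then show ?case
  proof cases
    case 3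
    have "d y (f (Suc j)) = d y (f j) + 1" using less.IH[of j] less.IH[of "Suc j"] less.prems 3 by simp
    then have "d y (f i) = d y (f (Suc j)) + 1"
      using no_return[OF y f f f, of j "Suc j" i] one[of j] one[of "Suc j"] turn[of j] less.prems 3 by simp
    then show ?thesis using less.IH[of "Suc j"] less.prems 3 by simp
  qed (use first less.prems in auto)
qed

text \<open>The last clause excludes inversions of edges. An inversion has neither a fixed vertex
  nor an axis.\<close>

definition isometry :: "('n \<Rightarrow> 'n) \<Rightarrow> bool" where
  "isometry g \<longleftrightarrow> bij_betw g V V \<and> (\<forall>x\<in>V. \<forall>y\<in>V. d (g x) (g y) = d x y) \<and>
    (\<forall>x\<in>V. d x (g x) = 1 \<longrightarrow> g (g x) \<noteq> x)"

lemma isometryD: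
  assumes "isometry g"
  shows "x \<in> V \<Longrightarrow> g x \<in> V" "\<lbrakk>x \<in> V; y \<in> V\<rbrakk> \<Longrightarrow> d (g x) (g y) = d x y"
    "\<lbrakk>x \<in> V; y \<in> V; g x = g y\<rbrakk> \<Longrightarrow> x = y" "\<lbrakk>x \<in> V; d x (g x) = 1\<rbrakk> \<Longrightarrow> g (g x) \<noteq> x"
    "y \<in> V \<Longrightarrow> \<exists>x\<in>V. g x = y"
  using assms unfolding isometry_def bij_betw_def by (auto simp: inj_on_def, metis imageE)

text \<open>Let \<open>p\<close> be the fixed point nearest to \<open>f 0\<close>. A walk that
  avoids \<open>p\<close> stays in one branch at \<open>p\<close>, the one beginning with
  \<open>p'\<close>, whereas its end \<open>g (f 0)\<close> lies in the branch beginning with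
  \<open>g p'\<close>, and \<open>g p' \<noteq> p'\<close> by the choice of
  \<open>p\<close>.\<close>

lemma elliptic_walk:
  assumes g: "isometry g" and x: "x \<in> V" "g x = x"
    and f: "\<And>i. i \<le> n \<Longrightarrow> f i \<in> V" "\<And>i. i < n \<Longrightarrow> d (f i) (f (Suc i)) \<le> 1"
    and ends: "f n = g (f 0)"
  shows "\<exists>i\<le>n. g (f i) = f i"
proof (rule ccontr)
  assume no: "\<not> (\<exists>i\<le>n. g (f i) = f i)"
  have f0: "f 0 \<in> V" using f by simp
  define p where "p = arg_min (\<lambda>p. d p (f 0)) (\<lambda>p. p \<in> V \<and> g p = p)"
  have p: "p \<in> V" "g p = p" and min: "\<And>q. \<lbrakk>q \<in> V; g q = q\<rbrakk> \<Longrightarrow> d p (f 0) \<le> d q (f 0)"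
    using arg_min_nat_lemma[of "\<lambda>p. p \<in> V \<and> g p = p" x "\<lambda>p. d p (f 0)"] x
    by (auto simp: p_def)
  have "p \<noteq> f 0" using no p by auto
  then obtain k where k: "d p (f 0) = Suc k" using zero[OF p(1) f0] by (cases "d p (f 0)") auto
  then obtain p' where p': "p' \<in> V" "d p p' = 1" "d p' (f 0) = k"
    using geodesic_point[of p "f 0" 1 k] p f0 by auto
  have "g p' \<noteq> p'" using min[of p'] p' k by auto
  have gp': "g p' \<in> V" "d p (g p') = 1"
    using isometryD(1)[OF g] isometryD(2)[OF g, of p p'] p p' by auto
  have away: "d p (f i) = d p' (f i) + 1" if "i \<le> n" for i
    using that
  proof (induction i)
    case 0
    then show ?case using k p' by simp
  next
    case (Suc i)
    define y where "y = f i"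
    define z where "z = f (Suc i)"
    have yz: "y \<in> V" "z \<in> V" "d y z \<le> 1" "d p y = d p' y + 1" "z \<noteq> p"
      using Suc f p no by (auto simp: y_def z_def)
    have "d p y + d p' z \<le> max (d p p' + d y z) (d p z + d y p')"
      using four_point p p' yz by blast
    moreover have "d y p' = d p' y" using sym p' yz by blast
    moreover have "d p z \<noteq> 0" using zero p yz by blast
    moreover have "even (d p p' + d p' z + d p z)" using parity p p' yz by blast
    moreover have "d p z \<le> d p p' + d p' z" using triangle p p' yz by blast
    moreover have "d p' z \<le> d p' y + d y z" using triangle p p' yz by blast
    ultimately have "d p z = d p' z + 1" using p'(2) yz(3,4)
      by (cases "d p' y = 0"; cases "d p' z = 0"; simp add: max_def split: if_splits; presburger)
    then show ?case by (simp add: z_def)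
  qed
  have "d p (f n) = d p' (f n) + 1" using away by simp
  moreover have "d p (f n) = d (g p') (f n) + 1"
    using isometryD(2)[OF g, of p "f 0"] isometryD(2)[OF g, of p' "f 0"] p p' k f0 ends by simp
  ultimately have "p' = g p'"
    using geodesic_unique[of p "f n" p' "g p'"] p p' gp' f by simp
  then show False using \<open>g p' \<noteq> p'\<close> by simp
qed

lemma geodesic_sequence:
  assumes "x \<in> V" "y \<in> V"
  shows "\<exists>f. f 0 = x \<and> f (d x y) = y \<and> (\<forall>i\<le>d x y. f i \<in> V \<and> d x (f i) = i \<and> d (f i) y = d x y - i) \<and>
     (\<forall>i<d x y. d (f i) (f (Suc i)) = 1)"
  using assms
proof (induction "d x y" arbitrary: y)
  case 0
  then show ?case using zero[of x y] by (intro exI[of _ "\<lambda>_. x"]) auto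
next
  case (Suc n)
  obtain z where z: "z \<in> V" "d x z = n" "d z y = 1"
    using step[of x y n] Suc by auto
  obtain f where f: "f 0 = x" "f n = z" "\<And>i. i\<le>n \<Longrightarrow> f i \<in> V \<and> d x (f i) = i \<and> d (f i) z = n - i"
     "\<And>i. i<n \<Longrightarrow> d (f i) (f (Suc i)) = 1"
    using Suc.hyps(1)[of z] z Suc.prems by auto
  define f' where "f' = f(Suc n := y)"
  have dist: "d (f i) y = Suc n - i" if "i \<le> n" for i
    using triangle[of "f i" y z] triangle[of x y "f i"] f(3)[OF that] z Suc.prems Suc.hyps(2) that by auto
  have "f' 0 = x" "f' (Suc n) = y" using f by (auto simp: f'_def)
  moreover have "f' i \<in> V \<and> d x (f' i) = i \<and> d (f' i) y = Suc n - i" if "i \<le> Suc n" for i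
    using that f(3)[of i] dist[of i] Suc.prems Suc.hyps(2) by (auto simp: f'_def le_Suc_eq)
  moreover have "d (f' i) (f' (Suc i)) = 1" if "i < Suc n" for i
    using that f(2) f(4)[of i] z by (auto simp: f'_def less_Suc_eq)
  ultimately show ?case using Suc.hyps(2) by (intro exI[of _ f']) auto
qed

text \<open>As \<open>g\<close> fixes both \<open>x\<close> and \<open>h x\<close>, it fixes the
  geodesic between them. This geodesic is a walk from \<open>x\<close> to \<open>h x\<close>, so it
  meets a fixed point of \<open>h\<close>.\<close>

lemma commuting_elliptic:
  assumes g: "isometry g" "x \<in> V" "g x = x" and h: "isometry h" "y \<in> V" "h y = y"
    and comm: "\<And>z. z \<in> V \<Longrightarrow> g (h z) = h (g z)"
  shows "\<exists>z\<in>V. g z = z \<and> h z = z"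
proof -
  define n where "n = d x (h x)"
  have hx: "h x \<in> V" "g (h x) = h x" using isometryD(1)[OF h(1)] g comm by auto
  obtain f where f: "f 0 = x" "f n = h x" "\<And>i. i\<le>n \<Longrightarrow> f i \<in> V \<and> d x (f i) = i \<and> d (f i) (h x) = n - i"
     "\<And>i. i<n \<Longrightarrow> d (f i) (f (Suc i)) = 1"
    using geodesic_sequence[of x "h x"] hx g n_def by auto
  have "g (f i) = f i" if "i \<le> n" for i
  proof -
    have "g (f i) \<in> V" "d x (g (f i)) = d x (f i)" "d (g (f i)) (h x) = d (f i) (h x)"
      using isometryD(1)[OF g(1)] isometryD(2)[OF g(1), of x "f i"] isometryD(2)[OF g(1), of "f i" "h x"]
        f(3)[OF that] g hx by auto
    then show ?thesis
      using geodesic_unique[of x "h x" "f i" "g (f i)"] f(3)[OF that] g hx n_def that by simp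
  qed
  moreover obtain i where "i \<le> n" "h (f i) = f i"
    using elliptic_walk[OF h, of n f] f by auto
  ultimately show ?thesis using f by blast
qed

text \<open>The midpoint of \<open>x\<close> and \<open>g x\<close> is fixed if it is a vertex;
  otherwise the middle edge would be inverted.\<close>

lemma involution_fixed_point:
  assumes g: "isometry g" and x: "x \<in> V" "g (g x) = x"
  shows "\<exists>z\<in>V. g z = z"
proof -
  have gx: "g x \<in> V" using isometryD(1)[OF g] x by blast
  define k where "k = d x (g x) div 2"
  show ?thesis
  proof (cases "even (d x (g x))")
    case True
    then have "d x (g x) = k + k" by (auto simp: k_def)
    then obtain z where z: "z \<in> V" "d x z = k" "d z (g x) = k"
      using geodesic_point[of x "g x" k k] x gx by auto
    have "g z \<in> V" "d x (g z) = k" "d (g z) (g x) = k"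
      using isometryD(1)[OF g] isometryD(2)[OF g, of "z" "x"] isometryD(2)[OF g, of "g x" z] z gx x
        sym[of x z] sym[of "g x" z] by auto
    then have "z = g z"
      using geodesic_unique[of x "g x" z "g z"] x gx z \<open>d x (g x) = k + k\<close> by simp
    then show ?thesis using z(1) by metis
  next
    case False
    then have D: "d x (g x) = k + (1 + k)" by (simp add: k_def) presburger
    then obtain z where z: "z \<in> V" "d x z = k" "d z (g x) = 1 + k"
      using geodesic_point[of x "g x" k "1 + k"] x gx by auto
    then obtain z' where z': "z' \<in> V" "d z z' = 1" "d z' (g x) = k"
      using geodesic_point[of z "g x" 1 k] gx by auto
    have xz': "d x z' = k + 1"
      using triangle[of x z' z] triangle[of x "g x" z'] x gx z z' D by auto
    have "g z \<in> V" "g z' \<in> V" "d x (g z) = k + 1" "d (g z) (g x) = k"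
      "d x (g z') = k" "d (g z') (g x) = k + 1"
      using isometryD(1)[OF g] isometryD(2)[OF g, of "z" "x"] isometryD(2)[OF g, of "g x" z]
        isometryD(2)[OF g, of "z'" "x"] isometryD(2)[OF g, of "g x" z'] z z' gx x xz'
        sym[of x z] sym[of x z'] sym[of "g x" z] sym[of "g x" z'] by auto
    then have "z' = g z" "z = g z'"
      using geodesic_unique[of x "g x" z' "g z"] geodesic_unique[of x "g x" z "g z'"] x gx z z' xz' D
      by simp_all
    then have "g (g z) = z" "d z (g z) = 1" using z' by auto
    then show ?thesis using isometryD(4)[OF g z(1)] by blast
  qed
qed

section \<open>Axes of isometries without fixed vertices\<close>

definition int_power :: "('n \<Rightarrow> 'n) \<Rightarrow> int \<Rightarrow> 'n \<Rightarrow> 'n" where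
  "int_power g k x = (if 0 \<le> k then (g ^^ nat k) x else (inv_into V g ^^ nat (- k)) x)"

lemma int_power:
  assumes g: "isometry g"
  shows int_power_closed: "x \<in> V \<Longrightarrow> int_power g k x \<in> V"
    and int_power_add_1: "x \<in> V \<Longrightarrow> int_power g (k + 1) x = g (int_power g k x)"
    and int_power_dist: "\<lbrakk>x \<in> V; y \<in> V\<rbrakk> \<Longrightarrow> d (int_power g k x) (int_power g k y) = d x y"
    and int_power_swap: "x \<in> V \<Longrightarrow> int_power g k (g x) = g (int_power g k x)"
proof -
  let ?h = "inv_into V g"
  have h: "?h x \<in> V" "g (?h x) = x" if "x \<in> V" for x
    using isometryD(5)[OF g that] inv_into_into[of x g V] f_inv_into_f[of x g V] by (auto simp: image_iff eq_commute)
  have hg: "?h (g x) = x" if "x \<in> V" for x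
    using that g by (simp add: isometry_def bij_betw_def)
  have pos: "(g ^^ n) x \<in> V" if "x \<in> V" for n x
    using that isometryD(1)[OF g] by (induction n) auto
  have neg: "(?h ^^ n) x \<in> V" if "x \<in> V" for n x
    using that h(1) by (induction n) auto
  show closed: "int_power g k x \<in> V" if "x \<in> V" for k x
    using that pos neg by (auto simp: int_power_def)
  show add: "int_power g (k + 1) x = g (int_power g k x)" if x: "x \<in> V" for k x
  proof (cases "0 \<le> k")
    case True
    then have "nat (k + 1) = Suc (nat k)" by simp
    then show ?thesis using True by (simp add: int_power_def)
  next
    case False
    then obtain m where k: "k = - int (Suc m)"
      by (metis int_cases not_le of_nat_0_le_iff)
    show ?thesis
    proof (cases m)
      case 0
      then show ?thesis using k x h by (simp add: int_power_def)
    next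
      case (Suc m')
      then have "\<not> 0 \<le> k + 1" "nat (- (k + 1)) = m" "nat (- k) = Suc m" using k by auto
      then show ?thesis using False h(2)[OF neg[OF x]] by (simp add: int_power_def)
    qed
  qed
  have sub: "g (int_power g (k - 1) x) = int_power g k x" if "x \<in> V" for k x
    using add[OF that, of "k - 1"] by simp
  show "d (int_power g k x) (int_power g k y) = d x y" if "x \<in> V" "y \<in> V" for k x y
  proof (induction k rule: int_induct[of _ 0])
    case base
    then show ?case by (simp add: int_power_def)
  next
    case (step1 i)
    then show ?case using isometryD(2)[OF g] add that closed by simp
  next
    case (step2 i)
    then show ?case using isometryD(2)[OF g, of "int_power g (i - 1) x" "int_power g (i - 1) y"]
      sub that closed by simp
  qed
  show "int_power g k (g x) = g (int_power g k x)" if "x \<in> V" for k x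
  proof (induction k rule: int_induct[of _ 0])
    case base
    then show ?case by (simp add: int_power_def)
  next
    case (step1 i)
    then show ?case using add[OF that, of i] add[OF isometryD(1)[OF g that], of i] by simp
  next
    case (step2 i)
    have "g (int_power g (i - 1) (g x)) = g (g (int_power g (i - 1) x))"
      using step2 sub[OF that, of i] sub[OF isometryD(1)[OF g that], of i] by simp
    then show ?case
      using isometryD(3)[OF g] closed that isometryD(1)[OF g] by blast
  qed
qed

lemma local_geodesic:
  fixes X :: "int \<Rightarrow> 'n"
  assumes V: "\<And>k. X k \<in> V" and one: "\<And>k. d (X k) (X (k + 1)) = 1"
    and turn: "\<And>k. X (k + 2) \<noteq> X k"
  shows "d (X i) (X j) = nat \<bar>i - j\<bar>"
proof -
  have up: "d (X i) (X (i + int n)) = n" for i n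
  proof -
    have "d (X i) (X (i + int n)) = d (X i) (X (i + int 0)) + n"
    proof (rule no_return_sequence[where n = n and f = "\<lambda>n. X (i + int n)"])
      show "d (X (i + int j)) (X (i + int (Suc j))) = 1" for j
        using one[of "i + int j"] by (simp add: ac_simps)
      show "X (i + int (Suc (Suc j))) \<noteq> X (i + int j)" for j
        using turn[of "i + int j"] by (simp add: ac_simps)
      show "d (X i) (X (i + int 1)) = d (X i) (X (i + int 0)) + 1"
        using one[of i] V by simp
    qed (use V in auto)
    then show ?thesis using V by simp
  qed
  show ?thesis
  proof (cases "i \<le> j")
    case True
    then show ?thesis using up[of i "nat (j - i)"] by simp
  next
    case False
    then show ?thesis using up[of j "nat (i - j)"] sym[OF V V, of i j] by simp
  qed
qed

text \<open>The axis is the union of the translates of a geodesic from \<open>x\<close> to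
  \<open>a x\<close>, where the displacement \<open>l\<close> of \<open>x\<close> is least. A vertex
  at distance \<open>m\<close> from it is moved by \<open>l + 2 * m\<close>, hence displacement
  \<open>l\<close> occurs on the axis only.\<close>

lemma axis:
  assumes a: "isometry a" and nofix: "\<And>x. x \<in> V \<Longrightarrow> a x \<noteq> x" and "V \<noteq> {}"
  obtains X :: "int \<Rightarrow> 'n" and l :: nat where "l > 0" "\<And>k. X k \<in> V"
    "\<And>i j. d (X i) (X j) = nat \<bar>i - j\<bar>" "\<And>k. a (X k) = X (k + int l)"
    "\<And>y. y \<in> V \<Longrightarrow> l \<le> d y (a y)" "\<And>y. \<lbrakk>y \<in> V; d y (a y) = l\<rbrakk> \<Longrightarrow> y \<in> range X"
proof -
  obtain x0 where x0: "x0 \<in> V" using \<open>V \<noteq> {}\<close> by auto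
  define x where "x = arg_min (\<lambda>x. d x (a x)) (\<lambda>x. x \<in> V)"
  define l where "l = d x (a x)"
  have x: "x \<in> V" and min: "\<And>y. y \<in> V \<Longrightarrow> l \<le> d y (a y)"
    using arg_min_nat_lemma[of "\<lambda>x. x \<in> V" x0 "\<lambda>x. d x (a x)"] x0 by (auto simp: x_def l_def)
  have ax: "a x \<in> V" using isometryD(1)[OF a x] .
  have l: "l > 0" using nofix[OF x] zero[OF x ax] by (auto simp: l_def)
  obtain f where f: "f 0 = x" "f l = a x"
    "\<And>i. i\<le>l \<Longrightarrow> f i \<in> V \<and> d x (f i) = i \<and> d (f i) (a x) = l - i"
     "\<And>i. i<l \<Longrightarrow> d (f i) (f (Suc i)) = 1"
    using geodesic_sequence[OF x ax] l_def by auto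
  note P = int_power[OF a]
  define X where "X = (\<lambda>k. int_power a (k div int l) (f (nat (k mod int l))))"
  have fV: "f (nat (k mod int l)) \<in> V" for k
  proof -
    have "nat (k mod int l) \<le> l"
      using pos_mod_bound[of "int l" k] l by linarith
    then show ?thesis using f by blast
  qed
  have XV: "X k \<in> V" for k using P(1) fV by (simp add: X_def)
  have shift: "a (X k) = X (k + int l)" for k
    using P(2)[OF fV, of "k div int l" k] l by (simp add: X_def)
  have X_next: "X (int l * q + int r) = int_power a q (f r)" if "r \<le> l" for q r
  proof (cases "r = l")
    case True
    have "X (int l * q + int l) = int_power a (q + 1) (f 0)"
      using l by (simp add: X_def)
    also have "\<dots> = int_power a q (f l)"
      using P(2)[OF x, of q] P(4)[OF x, of q] f by simp
    finally show ?thesis using True by simp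
  next
    case False
    then have "(int l * q + int r) div int l = q" "(int l * q + int r) mod int l = int r"
      using that l by auto
    then show ?thesis by (simp add: X_def)
  qed
  have decomp: "\<exists>q r. k = int l * q + int r \<and> r < l" for k
    using l by (intro exI[of _ "k div int l"] exI[of _ "nat (k mod int l)"]) (simp add: nat_less_iff)
  have one: "d (X k) (X (k + 1)) = 1" for k
  proof -
    obtain q r where k: "k = int l * q + int r" "r < l" using decomp by blast
    then have "X k = int_power a q (f r)" "X (k + 1) = int_power a q (f (Suc r))"
      using X_next[of r q] X_next[of "Suc r" q] by (simp_all add: ac_simps)
    then show ?thesis using P(3) f k by simp
  qed
  have turn: "X (k + 2) \<noteq> X k" for k
  proof
    assume eq: "X (k + 2) = X k"
    obtain q r where k: "k = int l * q + int r" "r < l" using decomp by blast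
    have Xk: "X k = int_power a q (f r)" using X_next[of r q] k by simp
    \<comment> \<open>The axis could turn back inside a translate of the geodesic, at the junction
      of two translates, or when \<open>l = 1\<close>. The first contradicts the geodesic, the
      second would make the displacement of \<open>f 1\<close> less than \<open>l\<close>, and in
      the third case \<open>a\<close> would invert an edge.\<close>
    consider "r + 2 \<le> l" | "r + 1 = l" "l > 1" | "r = 0" "l = 1" using k by linarith
    then show False
    proof cases
      case 1
      then have "X (k + 2) = int_power a q (f (r + 2))"
        using X_next[of "r + 2" q] k by (simp add: ac_simps)
      then have "d (f r) (f (r + 2)) = 0" using P(3)[of "f r" "f (r+2)" q] f(3) 1 eq Xk XV[of k] by simp
      then show False using f(3)[of r] f(3)[of "r + 2"] 1 zero[of "f r" "f (r + 2)"] by simp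
    next
      case 2
      have f1: "f 1 \<in> V" "a (f 1) \<in> V" "f r \<in> V"
        using f(3)[of 1] f(3)[of r] isometryD(1)[OF a] 2 by auto
      have "int r + 1 = int l" using 2 by simp
      then have "k + 2 = int l * (q + 1) + int 1" using k(1) unfolding distrib_left by linarith
      then have "X (k + 2) = X (int l * (q + 1) + int 1)" by (rule arg_cong)
      also have "\<dots> = int_power a (q + 1) (f 1)" using X_next[of 1 "q + 1"] 2 by simp
      also have "\<dots> = int_power a q (a (f 1))" using P(2)[OF f1(1), of q] P(4)[OF f1(1), of q] by simp
      finally have "int_power a q (a (f 1)) = int_power a q (f r)" using eq Xk by simp
      then have "d (a (f 1)) (f r) = 0"
        using P(3)[OF f1(2,3), of q] P(1)[OF f1(3), of q] by simp
      then have "a (f 1) = f r" using zero[OF f1(2,3)] by simp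
      moreover have "d (f 1) (f r) < l"
      proof -
        have "d (f 1) (f (Suc j)) \<le> j" if "j < l" for j
          using that
        proof (induction j)
          case 0
          then show ?case using f1 by simp
        next
          case (Suc j)
          have V: "f (Suc j) \<in> V" "f (Suc (Suc j)) \<in> V"
            using f(3)[of "Suc j"] f(3)[of "Suc (Suc j)"] Suc.prems by auto
          have "d (f 1) (f (Suc (Suc j))) \<le> d (f 1) (f (Suc j)) + d (f (Suc j)) (f (Suc (Suc j)))"
            using triangle[OF f1(1) V(2,1)] .
          then show ?case using Suc f(4)[of "Suc j"] by simp
        qed
        from this[of "r - 1"] have "d (f 1) (f (Suc (r - 1))) \<le> r - 1" using 2 by linarith
        moreover have "Suc (r - 1) = r" using 2 by linarith
        ultimately show ?thesis using 2 by simp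
      qed
      ultimately show False using min[OF f1(1)] by simp
    next
      case 3
      have "k + 2 = int l * (q + 1) + int 1" using k 3 by simp
      then have "X (k + 2) = X (int l * (q + 1) + int 1)" by (rule arg_cong)
      also have "\<dots> = int_power a (q + 1) (f l)" using X_next[of 1 "q + 1"] 3 by simp
      also have "\<dots> = int_power a q (a (a x))"
        using P(2)[OF ax, of q] P(4)[OF ax, of q] f(2) by simp
      finally have "int_power a q (a (a x)) = int_power a q x" using eq Xk f(1) 3 by simp
      then have "d (a (a x)) x = 0"
        using P(3)[OF isometryD(1)[OF a ax] x, of q] P(1)[OF x, of q] by simp
      then have "a (a x) = x" using zero isometryD(1)[OF a] ax x by simp
      then show False using isometryD(4)[OF a x] 3 l_def by simp
    qed
  qed
  have iso: "d (X i) (X j) = nat \<bar>i - j\<bar>" for i j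
    using local_geodesic XV one turn by blast
  have "y \<in> range X" if y: "y \<in> V" and yl: "d y (a y) = l" for y
  proof (rule ccontr)
    assume notin: "y \<notin> range X"
    define k where "k = arg_min (\<lambda>k. d y (X k)) (\<lambda>_. True)"
    define m where "m = d y (X k)"
    have m_min: "m \<le> d y (X j)" for j
      using arg_min_nat_lemma[of "\<lambda>_. True" k "\<lambda>k. d y (X k)"] by (auto simp: k_def m_def)
    have "m > 0" using zero[OF y XV[of k]] notin by (auto simp: m_def)
    have nb: "d y (X j) = m + 1" if "d (X k) (X j) = 1" for j
      using triangle[OF y XV XV, of j k] m_min[of j] parity[OF y XV XV, of k j] that
      by (simp add: m_def[symmetric]) presburger
    \<comment> \<open>Beyond its vertex \<open>X k\<close> nearest to \<open>y\<close> the axis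
      leads away from \<open>y\<close>.\<close>
    have ray: "d y (X (k + int j)) = m + j" for j
    proof -
      have "d y (X (k + int j)) = d y (X (k + int 0)) + j"
      proof (rule no_return_sequence[where n = j and f = "\<lambda>n. X (k + int n)"])
        show "d (X (k + int j)) (X (k + int (Suc j))) = 1" for j
          using one[of "k + int j"] by (simp add: ac_simps)
        show "X (k + int (Suc (Suc j))) \<noteq> X (k + int j)" for j
          using turn[of "k + int j"] by (simp add: ac_simps)
        show "d y (X (k + int 1)) = d y (X (k + int 0)) + 1"
          using nb[of "k + 1"] iso m_def by simp
      qed (use y XV in auto)
      then show ?thesis using m_def by simp
    qed
    obtain h where h: "h 0 = X k" "h m = y"
      "\<And>i. i\<le>m \<Longrightarrow> h i \<in> V \<and> d (X k) (h i) = i \<and> d (h i) y = m - i"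
      "\<And>i. i<m \<Longrightarrow> d (h i) (h (Suc i)) = 1"
      using geodesic_sequence[OF XV y, of k] sym[OF XV y, of k] m_def by auto
    have h1: "h 1 \<in> V" "d (h 1) y = m - 1" using h(3)[of 1] \<open>m > 0\<close> by auto
    \<comment> \<open>Three geodesics are joined without turning back: from \<open>y\<close> to
      \<open>X k\<close>, along the axis to \<open>X (k + int l)\<close>, and along the translate of
      the first one to \<open>a y\<close>.\<close>
    have "d y (a (h m)) = d y (a (h 0)) + m"
    proof (rule no_return_sequence[where n = m and f = "\<lambda>i. a (h i)"])
      show aV: "a (h i) \<in> V" if "i \<le> m" for i using h(3) isometryD(1)[OF a] that by blast
      show step: "d (a (h i)) (a (h (Suc i))) = 1" if "i < m" for i
        using h(3)[of i] h(3)[of "Suc i"] h(4) isometryD(2)[OF a] that by simp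
      show "a (h (Suc (Suc i))) \<noteq> a (h i)" if "Suc (Suc i) \<le> m" for i
      proof
        assume "a (h (Suc (Suc i))) = a (h i)"
        then have "h (Suc (Suc i)) = h i" using isometryD(3)[OF a] h(3)[of i] h(3)[of "Suc (Suc i)"] that by simp
        then show False using h(3)[of i] h(3)[of "Suc (Suc i)"] that by simp
      qed
      have "k + int l - 1 = k + int (l - 1)" using l by simp
      then have "d y (X (k + int l - 1)) = d y (X (k + int (l - 1)))" by (rule arg_cong)
      then have p: "d y (X (k + int l - 1)) = m + l - 1" using ray[of "l - 1"] l by linarith
      have "a (h 1) \<noteq> X (k + int l - 1)"
      proof
        assume "a (h 1) = X (k + int l - 1)"
        also have "\<dots> = a (X (k - 1))" using shift[of "k - 1"] by (simp add: algebra_simps)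
        finally have "h 1 = X (k - 1)" using isometryD(3)[OF a h1(1) XV] by simp
        then have "d (X (k - 1)) y = m - 1" using h1 by simp
        moreover have "d (X (k - 1)) y = m + 1"
          using nb[of "k - 1"] iso[of k "k - 1"] sym[OF y XV, of "k - 1"] by simp
        ultimately show False by simp
      qed
      moreover have "d (X (k + int l - 1)) (a (h 0)) = 1"
        using one[of "k + int l - 1"] h shift by simp
      moreover have "d y (a (h 0)) = d y (X (k + int l - 1)) + 1" using p h(1) shift ray[of l] l by simp
      moreover have "a (h 0) \<in> V" "a (h 1) \<in> V" "d (a (h 0)) (a (h 1)) = 1"
        using aV[of 0] aV[of 1] step[of 0] \<open>m > 0\<close> by auto
      ultimately show "d y (a (h 1)) = d y (a (h 0)) + 1"
        using no_return[OF y XV, of "a (h 0)" "a (h 1)" "k + int l - 1"] by blast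
    qed (use y in auto)
    then have far: "d y (a (h m)) = m + l + m" using h(1) shift ray[of l] by simp
    from far show False using h yl \<open>m > 0\<close> by simp
  qed
  then show ?thesis using that[of l X] l XV iso shift min by blast
qed

lemma axis_isometry:
  fixes s :: "int \<Rightarrow> int"
  assumes "\<And>i j. \<bar>s i - s j\<bar> = \<bar>i - j\<bar>"
  shows "(\<forall>k. s k = s 0 + k) \<or> (\<forall>k. s k = s 0 - k)"
proof -
  have "s k = s 0 + k" if "s 1 = s 0 + 1" for k
    using assms[of k 0] assms[of k 1] that by (auto simp: abs_if split: if_splits)
  moreover have "s k = s 0 - k" if "s 1 = s 0 - 1" for k
    using assms[of k 0] assms[of k 1] that by (auto simp: abs_if split: if_splits)
  moreover have "s 1 = s 0 + 1 \<or> s 1 = s 0 - 1"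
    using assms[of 1 0] by (auto simp: abs_if split: if_splits)
  ultimately show ?thesis by blast
qed

text \<open>Since \<open>c\<close> commutes with \<open>a\<close>, it preserves the axis
  \<open>X\<close> and translates it; since it is conjugate to \<open>a\<close>, it does so by
  \<open>l\<close> in one of the two directions. Therefore \<open>b\<close> preserves the axis too.
  If \<open>b\<close> translates the axis, then \<open>a\<close> and \<open>c\<close> agree on it;
  if \<open>b\<close> reverses it, then \<open>b\<close> is an involution there.\<close>

lemma conjugate_commuting_isometries:
  assumes a: "isometry a" and b: "isometry b" and c: "isometry c"
    and nofix: "\<And>x. x \<in> V \<Longrightarrow> a x \<noteq> x" and "V \<noteq> {}"
    and conj: "\<And>x. x \<in> V \<Longrightarrow> b (c x) = a (b x)"
    and comm: "\<And>x. x \<in> V \<Longrightarrow> a (c x) = c (a x)"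
  shows "(\<exists>x\<in>V. a x = c x) \<or> (\<exists>x\<in>V. b (b x) = x \<and> b x \<noteq> x)"
proof -
  obtain X :: "int \<Rightarrow> 'n" and l where l: "l > 0" and XV: "\<And>k. X k \<in> V"
    and iso: "\<And>i j. d (X i) (X j) = nat \<bar>i - j\<bar>" and shift: "\<And>k. a (X k) = X (k + int l)"
    and min: "\<And>y. y \<in> V \<Longrightarrow> l \<le> d y (a y)"
    and on_axis: "\<And>y. \<lbrakk>y \<in> V; d y (a y) = l\<rbrakk> \<Longrightarrow> y \<in> range X"
    using axis[OF a nofix \<open>V \<noteq> {}\<close>] by metis
  have inj: "X i = X j \<longleftrightarrow> i = j" for i j
    using iso[of i j] zero[OF XV XV, of i j] by auto
  have "c (X k) \<in> range X" for k
  proof (rule on_axis)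
    show "c (X k) \<in> V" using isometryD(1)[OF c XV] .
    have "d (c (X k)) (a (c (X k))) = d (X k) (a (X k))"
      using comm[OF XV] isometryD(2)[OF c XV isometryD(1)[OF a XV], of k k] by simp
    then show "d (c (X k)) (a (c (X k))) = l" using shift iso by simp
  qed
  then have "\<forall>k. \<exists>j. c (X k) = X j" by blast
  then obtain s where s: "\<And>k. c (X k) = X (s k)" by metis
  have s_iso: "\<bar>s i - s j\<bar> = \<bar>i - j\<bar>" for i j
    using isometryD(2)[OF c XV XV, of i j] s iso[of i j] iso[of "s i" "s j"] by (simp add: eq_nat_nat_iff)
  have s_shift: "s (k + int l) = s k + int l" for k
  proof -
    have "X (s k + int l) = a (c (X k))" by (simp only: s shift)
    also have "\<dots> = c (a (X k))" by (rule comm[OF XV])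
    also have "\<dots> = X (s (k + int l))" by (simp only: s shift)
    finally show ?thesis by (simp only: inj)
  qed
  \<comment> \<open>A reversal of the axis does not commute with the translation by
    \<open>l\<close>.\<close>
  have s_eq: "s k = s 0 + k" for k
  proof -
    have "s (int l) \<noteq> s 0 - int l" using s_shift[of 0] l by simp
    then show ?thesis using axis_isometry[of s, OF s_iso] by blast
  qed
  have c_pow: "(c ^^ n) (X k) = X (k + int n * s 0)" for n k
  proof (induction n)
    case (Suc n)
    have "(c ^^ Suc n) (X k) = X (s (k + int n * s 0))" by (simp only: funpow.simps o_apply Suc s)
    also have "s (k + int n * s 0) = k + int (Suc n) * s 0"
      using s_eq[of "k + int n * s 0"] by (simp add: algebra_simps)
    finally show ?case .
  qed simp
  obtain y where y: "y \<in> V" "b y = X 0" using isometryD(5)[OF b XV] by blast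
  have c_closed: "(c ^^ n) x \<in> V" if "x \<in> V" for n x
    using that isometryD(1)[OF c] by (induction n) auto
  have c_iso: "d ((c ^^ n) x) ((c ^^ n) z) = d x z" if "x \<in> V" "z \<in> V" for n x z
    using that isometryD(2)[OF c] c_closed by (induction n) auto
  have b_pow: "b ((c ^^ n) y) = X (int n * int l)" for n
  proof (induction n)
    case (Suc n)
    then show ?case using conj[OF c_closed[OF y(1), of n]] shift by (simp add: algebra_simps)
  qed (use y in simp)
  \<comment> \<open>The power \<open>c ^^ n\<close> moves \<open>X 0\<close> by \<open>n\<close>
    times \<open>\<bar>s 0\<bar>\<close> and moves \<open>y\<close> by \<open>n * l\<close>, and
    these displacements differ by at most \<open>2 * D\<close>. For \<open>n = 2 * D + 1\<close>
    this rules out \<open>\<bar>s 0\<bar> > l\<close>.\<close>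
  define D where "D = d (X 0) y"
  have "int n * \<bar>s 0\<bar> \<le> 2 * int D + int n * int l" for n
  proof -
    have "d (X 0) ((c ^^ n) (X 0)) \<le> D + d y ((c ^^ n) y) + d ((c ^^ n) y) ((c ^^ n) (X 0))"
      using triangle[OF XV[of 0] c_closed[OF XV[of 0]] y(1), of n]
        triangle[OF y(1) c_closed[OF XV[of 0]] c_closed[OF y(1)], of n n] by (simp add: D_def)
    moreover have "d ((c ^^ n) y) ((c ^^ n) (X 0)) = D"
      using c_iso[OF y(1) XV] sym[OF y(1) XV] by (simp add: D_def)
    moreover have "d y ((c ^^ n) y) = n * l"
      using isometryD(2)[OF b y(1) c_closed[OF y(1)], of n] y b_pow[of n] iso[of 0 "int n * int l"]
      by (simp add: nat_mult_distrib flip: of_nat_mult)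
    moreover have "d (X 0) ((c ^^ n) (X 0)) = nat (int n * \<bar>s 0\<bar>)"
      using c_pow[of n 0] iso[of 0 "int n * s 0"] by (simp add: abs_mult)
    ultimately have "nat (int n * \<bar>s 0\<bar>) \<le> 2 * D + n * l" by simp
    then have "int n * \<bar>s 0\<bar> \<le> int (2 * D + n * l)" by linarith
    then show ?thesis by simp
  qed
  from this[of "2 * D + 1"] have growth: "(2 * int D + 1) * (\<bar>s 0\<bar> - int l) < 2 * int D + 1"
    by (simp add: algebra_simps)
  have "\<bar>s 0\<bar> \<le> int l"
  proof (rule ccontr)
    assume "\<not> \<bar>s 0\<bar> \<le> int l"
    then have "(2 * int D + 1) * 1 \<le> (2 * int D + 1) * (\<bar>s 0\<bar> - int l)"
      by (intro mult_left_mono) auto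
    then show False using growth unfolding mult_1_right by (meson not_le)
  qed
  moreover have c_min: "l \<le> d x (c x)" if x: "x \<in> V" for x
  proof -
    have "l \<le> d (b x) (a (b x))" using min[OF isometryD(1)[OF b x]] .
    also have "\<dots> = d (b x) (b (c x))" by (simp only: conj[OF x])
    also have "\<dots> = d x (c x)" using isometryD(2)[OF b x isometryD(1)[OF c x]] .
    finally show ?thesis .
  qed
  have "d (X 0) (c (X 0)) = nat \<bar>s 0\<bar>" using iso[of 0 "s 0"] unfolding s by simp
  then have "int l \<le> \<bar>s 0\<bar>" using c_min[OF XV[of 0]] by linarith
  ultimately have s0: "\<bar>s 0\<bar> = int l" by linarith
  have "b (X k) \<in> range X" for k
  proof (rule on_axis)
    show "b (X k) \<in> V" using isometryD(1)[OF b XV] .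
    have "d (b (X k)) (a (b (X k))) = d (X k) (c (X k))"
      using conj[OF XV] isometryD(2)[OF b XV isometryD(1)[OF c XV], of k k] by simp
    then show "d (b (X k)) (a (b (X k))) = l"
      using iso[of k "s 0 + k"] s0 unfolding s s_eq[of k] by simp
  qed
  then have "\<forall>k. \<exists>j. b (X k) = X j" by blast
  then obtain t where t: "\<And>k. b (X k) = X (t k)" by metis
  have "\<bar>t i - t j\<bar> = \<bar>i - j\<bar>" for i j
    using isometryD(2)[OF b XV XV, of i j] t iso[of i j] iso[of "t i" "t j"] by (simp add: eq_nat_nat_iff)
  then consider "\<And>k. t k = t 0 + k" | "\<And>k. t k = t 0 - k" using axis_isometry[of t] by blast
  then show ?thesis
  proof cases
    case 1
    have "t (s 0) = t 0 + int l" using conj[OF XV[of 0]] unfolding s t shift inj .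
    then have "s 0 = int l" using 1[of "s 0"] by linarith
    then have "a (X 0) = c (X 0)" by (simp only: shift s add_0)
    then show ?thesis using XV by blast
  next
    case 2
    \<comment> \<open>A reversal fixes at most one vertex of the axis, and \<open>k\<close> is
      chosen to avoid it.\<close>
    define k :: int where "k = (if t 0 = 0 then 1 else 0)"
    have "t (t k) = k" unfolding 2[of k] using 2[of "t 0 - k"] by linarith
    then have "b (b (X k)) = X k" by (simp only: t)
    moreover have "t 0 - k \<noteq> k" by (auto simp: k_def)
    then have "t k \<noteq> k" unfolding 2[of k] .
    then have "b (X k) \<noteq> X k" by (simp only: t inj not_False_eq_True)
    ultimately show ?thesis using XV by blast
  qed
qed

text \<open>Positive powers translate the axis by positive multiples of \<open>l\<close>.\<close>

lemma fixed_point_free_power: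
  assumes a: "isometry a" and nofix: "\<And>x. x \<in> V \<Longrightarrow> a x \<noteq> x" and "V \<noteq> {}"
  shows "\<exists>x\<in>V. \<forall>n>0. (a ^^ n) x \<noteq> x"
proof -
  obtain X :: "int \<Rightarrow> 'n" and l where l: "l > 0" and XV: "\<And>k. X k \<in> V"
    and iso: "\<And>i j. d (X i) (X j) = nat \<bar>i - j\<bar>" and shift: "\<And>k. a (X k) = X (k + int l)"
    using axis[OF a nofix \<open>V \<noteq> {}\<close>] by metis
  have "(a ^^ n) (X 0) = X (int n * int l)" for n
  proof (induction n)
    case (Suc n)
    have "(a ^^ Suc n) (X 0) = X (int n * int l + int l)"
      by (simp only: funpow.simps o_apply Suc shift)
    also have "int n * int l + int l = int (Suc n) * int l" by (simp add: distrib_right)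
    finally show ?case .
  qed simp
  moreover have "X (int n * int l) \<noteq> X 0" if "n > 0" for n
  proof -
    have "int n * int l > 0" using that l by simp
    then have "d (X 0) (X (int n * int l)) \<noteq> 0" unfolding iso by linarith
    then show ?thesis using self[OF XV[of 0]] by metis
  qed
  ultimately have "\<forall>n>0. (a ^^ n) (X 0) \<noteq> X 0" by simp
  then show ?thesis using XV by blast
qed

end

section \<open>The tree of finite words ordered by prefixes\<close>

fun lcp :: "'c list \<Rightarrow> 'c list \<Rightarrow> nat" where
  "lcp (x # xs) (y # ys) = (if x = y then Suc (lcp xs ys) else 0)"
| "lcp _ _ = 0"

definition prefix_dist :: "'c list \<Rightarrow> 'c list \<Rightarrow> nat" where
  "prefix_dist xs ys = length xs + length ys - 2 * lcp xs ys"

lemma lcp_le: "lcp xs ys \<le> length xs" "lcp xs ys \<le> length ys"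
  by (induction xs ys rule: lcp.induct) auto

lemma lcp_commute: "lcp xs ys = lcp ys xs"
  by (induction xs ys rule: lcp.induct) auto

lemma lcp_ultrametric: "min (lcp xs ys) (lcp ys zs) \<le> lcp xs zs"
proof (induction xs ys arbitrary: zs rule: lcp.induct)
  case (1 x xs y ys)
  show ?case using "1.IH" by (cases zs) auto
qed auto

lemma lcp_full: "lcp xs ys = length xs \<longleftrightarrow> (\<exists>zs. ys = xs @ zs)"
  by (induction xs ys rule: lcp.induct) auto

lemma lcp_snoc: "lcp xs (ys @ [c]) \<noteq> Suc (length ys) \<Longrightarrow> lcp xs (ys @ [c]) = lcp xs ys"
proof (induction xs ys rule: lcp.induct)
  case ("2_1" ys)
  then show ?case by (cases ys) auto
next
  case ("2_2" xs)
  then show ?case by (cases xs) auto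
qed auto

lemma prefix_dist_eq: "prefix_dist xs ys + 2 * lcp xs ys = length xs + length ys"
  using lcp_le[of xs ys] by (simp add: prefix_dist_def)

lemma prefix_dist_snoc: "prefix_dist xs (xs @ [x]) = 1" "prefix_dist (xs @ [x]) xs = 1"
  using prefix_dist_eq[of xs "xs @ [x]"] prefix_dist_eq[of "xs @ [x]" xs]
    lcp_full[of xs "xs @ [x]"] lcp_commute[of xs "xs @ [x]"] by auto

lemma prefix_dist_1:
  assumes "prefix_dist xs ys = 1"
  shows "(\<exists>x. ys = xs @ [x]) \<or> (\<exists>x. xs = ys @ [x])"
proof -
  have le: "lcp xs ys \<le> length xs" "lcp xs ys \<le> length ys" using lcp_le by blast+
  have "1 + 2 * lcp xs ys = length xs + length ys" using prefix_dist_eq[of xs ys] assms by simp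
  then consider "lcp xs ys = length xs" "length ys = length xs + 1"
    | "lcp ys xs = length ys" "length xs = length ys + 1"
    using le lcp_commute[of ys xs] by (cases "lcp xs ys = length xs") auto
  then show ?thesis
  proof cases
    case 1
    then obtain zs where "ys = xs @ zs" "length zs = 1" using lcp_full[of xs ys] by auto
    then show ?thesis by (cases zs) auto
  next
    case 2
    then obtain zs where "xs = ys @ zs" "length zs = 1" using lcp_full[of ys xs] by auto
    then show ?thesis by (cases zs) auto
  qed
qed

text \<open>\<open>f\<close> identifies \<open>V\<close> with a set of words closed under dropping
  the last letter, that is, with a subtree of the tree of all words. The four-point condition is the
  ultrametric inequality for common prefixes.\<close>

lemma tree_metric_prefix_dist:
  assumes inj: "inj_on f V" and closed: "\<And>x c cs. \<lbrakk>x \<in> V; f x = cs @ [c]\<rbrakk> \<Longrightarrow> \<exists>y\<in>V. f y = cs"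
  shows "tree_metric V (\<lambda>x y. prefix_dist (f x) (f y))"
proof
  fix x y z t assume V: "x \<in> V" "y \<in> V"
  show "prefix_dist (f x) (f y) = 0 \<longleftrightarrow> x = y"
  proof
    assume "prefix_dist (f x) (f y) = 0"
    then have "lcp (f x) (f y) = length (f x)" "lcp (f y) (f x) = length (f y)"
      using prefix_dist_eq[of "f x" "f y"] lcp_le[of "f x" "f y"] lcp_commute[of "f x" "f y"] by linarith+
    then have "f x = f y" by (auto simp: lcp_full)
    then show "x = y" using inj V by (auto simp: inj_on_def)
  next
    assume "x = y"
    then show "prefix_dist (f x) (f y) = 0"
      using lcp_full[of "f x" "f x"] by (simp add: prefix_dist_def)
  qed
  show "prefix_dist (f x) (f y) = prefix_dist (f y) (f x)"
    by (simp add: prefix_dist_def lcp_commute add.commute)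
next
  fix x y z t
  define L where "L = (\<lambda>x y. lcp (f x) (f y))"
  have L: "prefix_dist (f x) (f y) + 2 * L x y = length (f x) + length (f y)" for x y
    using prefix_dist_eq by (simp add: L_def)
  have u: "min (L p q) (L q r) \<le> L p r" for p q r using lcp_ultrametric by (simp add: L_def)
  have c: "L p q = L q p" for p q using lcp_commute by (simp add: L_def)
  show "even (prefix_dist (f x) (f y) + prefix_dist (f y) (f z) + prefix_dist (f x) (f z))"
    using L[of x y] L[of y z] L[of x z] by presburger
  have "min (L x z) (L y z) \<le> L x y" "min (L x t) (L y t) \<le> L x y"
    "min (L x z) (L x t) \<le> L z t" "min (L y z) (L y t) \<le> L z t"
    using u[of x z y] u[of x t y] u[of z x t] u[of z y t] c by metis+
  then have "min (L x z + L y t) (L x t + L y z) \<le> L x y + L z t"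
    unfolding min_def by (simp split: if_splits)
  then show "prefix_dist (f x) (f y) + prefix_dist (f z) (f t)
      \<le> max (prefix_dist (f x) (f z) + prefix_dist (f y) (f t)) (prefix_dist (f x) (f t) + prefix_dist (f y) (f z))"
    using L[of x y] L[of z t] L[of x z] L[of y t] L[of x t] L[of y z] by linarith
next
  fix x y n assume V: "x \<in> V" "y \<in> V" and n: "prefix_dist (f x) (f y) = Suc n"
  let ?l = "lcp (f x) (f y)"
  have x_step: "\<exists>z\<in>V. prefix_dist (f w) (f z) = n \<and> prefix_dist (f z) (f y) = 1"
    if y': "f y = cs @ [c]" and "y \<in> V" "lcp (f w) (f y) \<noteq> length (f y)"
      "prefix_dist (f w) (f y) = Suc n" for w y cs c
  proof -
    obtain z where z: "z \<in> V" "f z = cs" using closed[OF \<open>y \<in> V\<close> y'] by blast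
    have "lcp (f w) (cs @ [c]) = lcp (f w) cs" using lcp_snoc that by fastforce
    then show ?thesis
      using z prefix_dist_eq[of "f w" "f z"] prefix_dist_eq[of "f w" "f y"] that prefix_dist_snoc[of cs c]
      by (intro bexI[of _ z]) auto
  qed
  show "\<exists>z\<in>V. prefix_dist (f x) (f z) = n \<and> prefix_dist (f z) (f y) = 1"
  \<comment> \<open>From \<open>y\<close> one comes closer to \<open>x\<close> by dropping a letter,
    unless \<open>f y\<close> is a prefix of \<open>f x\<close>; in this case a letter is
    added.\<close>
  proof (cases "?l = length (f y)")
    case False
    then have "f y \<noteq> []" by auto
    then show ?thesis using x_step[of y "butlast (f y)" "last (f y)" x] V n False by simp
  next
    case True
    then have "lcp (f y) (f x) = length (f y)" by (simp add: lcp_commute)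
    then obtain zs where zs: "f x = f y @ zs" by (auto simp: lcp_full)
    have len: "length zs = Suc n" using n prefix_dist_eq[of "f x" "f y"] True zs by simp
    have "\<exists>z\<in>V. f z = f y @ take m zs" if "m \<le> length zs" for m
      using that
    proof (induction "length zs - m" arbitrary: m)
      case 0
      then show ?case using zs V by (intro bexI[of _ x]) auto
    next
      case (Suc k)
      then obtain z where "z \<in> V" "f z = f y @ take (Suc m) zs"
        using Suc.hyps(1)[of "Suc m"] by fastforce
      moreover have "take (Suc m) zs = take m zs @ [zs ! m]" using Suc by (simp add: take_Suc_conv_app_nth)
      ultimately show ?case using closed[of z "f y @ take m zs" "zs ! m"] by simp
    qed
    from this[of 1] obtain z where z: "z \<in> V" "f z = f y @ take 1 zs" using len by auto
    have tz: "take 1 zs = [hd zs]" using len by (cases zs) auto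
    have "f x = f z @ tl zs" using zs z tz len by (cases zs) auto
    then have "lcp (f z) (f x) = length (f z)" by (auto simp: lcp_full)
    then have "prefix_dist (f x) (f z) = n"
      using prefix_dist_eq[of "f x" "f z"] z tz zs len lcp_commute[of "f z" "f x"] by simp
    moreover have "prefix_dist (f z) (f y) = 1" using z tz prefix_dist_snoc by simp
    ultimately show ?thesis using z by blast
  qed
qed

section \<open>The rooted 2-tree of a word\<close>

text \<open>The 2-tree of \<open>w\<close> is the universal cover of the presentation seen as a directed
  2-complex: \<open>Root a i\<close> is the \<open>i\<close>-th edge of a path labelled \<open>w\<close>, and \<open>Child c u v k\<close> is the
  \<open>k\<close>-th edge of the new side of a cell \<open>u \<rightarrow> v\<close> glued along the path \<open>c\<close> labelled \<open>u\<close>.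
  Since the terms determine the 2-tree, no quotient of paths is needed.\<close>

datatype 'a tedge =
  Root 'a nat
| Child "'a tedge list" "'a list" "'a list" nat

text \<open>\<open>VIn c u v k\<close> is the vertex where the \<open>k\<close>-th edge of the new
  side begins. It occurs for \<open>0 < k\<close> and \<open>k < length v\<close> only, the ends of
  the new side being vertices of \<open>c\<close>.\<close>

datatype 'a vert =
  VRoot nat
| VIn "'a tedge list" "'a list" "'a list" nat

primrec lab :: "'a tedge \<Rightarrow> 'a" where
  "lab (Root a i) = a"
| "lab (Child c u v k) = v ! k"

primrec src :: "'a tedge \<Rightarrow> 'a vert" where
  "src (Root a i) = VRoot i"
| "src (Child c u v k) = (if k = 0 then hd (map src c) else VIn c u v k)"

primrec tgt :: "'a tedge \<Rightarrow> 'a vert" where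
  "tgt (Root a i) = VRoot (Suc i)"
| "tgt (Child c u v k) = (if Suc k = length v then last (map tgt c) else VIn c u v (Suc k))"

text \<open>A linear order of the vertices which increases along directed paths.\<close>

primrec extent :: "'a tedge \<Rightarrow> rat \<times> rat" where
  "extent (Root a i) = (of_nat i, of_nat (Suc i))"
| "extent (Child c u v k) = (let l = fst (hd (map extent c)); r = snd (last (map extent c)) in
     (l + (r - l) * (of_nat k / of_nat (length v)), l + (r - l) * (of_nat (Suc k) / of_nat (length v))))"

definition pos :: "'a vert \<Rightarrow> rat" where
  "pos x = (case x of VRoot i \<Rightarrow> of_nat i | VIn c u v k \<Rightarrow> fst (extent (Child c u v k)))"

text \<open>The history of an edge: the cells that have to be glued before the edge exists.\<close>

primrec cells :: "'a tedge \<Rightarrow> ('a tedge list \<times> 'a list \<times> 'a list) set" where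
  "cells (Root a i) = {}"
| "cells (Child c u v k) = insert (c, u, v) (\<Union>(set (map cells c)))"

primrec weight :: "'a tedge \<Rightarrow> nat" where
  "weight (Root a i) = 1"
| "weight (Child c u v k) = Suc (sum_list (map weight c))"

abbreviation start :: "'a tedge list \<times> 'a list \<times> 'a list \<Rightarrow> 'a vert" where
  "start h \<equiv> src (hd (fst h))"

text \<open>The weight of the edges that the cell creates, which exceeds the weight of all edges it
  is glued on.\<close>

abbreviation cellw :: "'a tedge list \<times> 'a list \<times> 'a list \<Rightarrow> nat" where
  "cellw h \<equiv> Suc (sum_list (map weight (fst h)))"

text \<open>Among the edges with a given source, one is born together with this vertex; the chain
  lists the cells crossed from that edge to the given one. An edge with \<open>k \<noteq> 0\<close>
  is born with its source, hence the empty chain.\<close>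

primrec chain :: "'a tedge \<Rightarrow> ('a tedge list \<times> 'a list \<times> 'a list) list" where
  "chain (Root a i) = []"
| "chain (Child c u v k) = (if k = 0 then hd (map chain c) @ [(c, u, v)] else [])"

definition block :: "'a tedge list \<Rightarrow> 'a list \<Rightarrow> 'a list \<Rightarrow> 'a tedge list" where
  "block c u v = map (Child c u v) [0..<length v]"

text \<open>The other side of the cell \<open>u \<rightarrow> v\<close> attached along \<open>c\<close>: if \<open>c\<close> is itself the new side of a
  cell \<open>v \<rightarrow> u\<close>, this is the path along which that cell was glued.\<close>

definition opp :: "'a tedge list \<Rightarrow> 'a list \<Rightarrow> 'a list \<Rightarrow> 'a tedge list" where
  "opp c u v = (if \<exists>c0. c = block c0 v u then (SOME c0. c = block c0 v u) else block c u v)"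

primrec path :: "'a vert \<Rightarrow> 'a tedge list \<Rightarrow> 'a vert \<Rightarrow> bool" where
  "path s [] t \<longleftrightarrow> s = t"
| "path s (e # es) t \<longleftrightarrow> src e = s \<and> path (tgt e) es t"

lemma path_append: "path s (xs @ ys) t \<longleftrightarrow> (\<exists>r. path s xs r \<and> path r ys t)"
  by (induction xs arbitrary: s) auto

lemma path_unique: "path s xs t \<Longrightarrow> path s xs t' \<Longrightarrow> t = t'"
  by (induction xs arbitrary: s) auto

lemma path_ends:
  assumes "path s xs t" "xs \<noteq> []"
  shows "src (hd xs) = s" "tgt (last xs) = t"
proof -
  show "src (hd xs) = s" using assms by (cases xs) auto
  show "tgt (last xs) = t" using assms
  proof (induction xs arbitrary: s)
    case (Cons x xs)
    then show ?case by (cases xs) auto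
  qed simp
qed

lemma block_nth: "k < length v \<Longrightarrow> block c u v ! k = Child c u v k"
  and length_block [simp]: "length (block c u v) = length v"
  and set_block: "set (block c u v) = Child c u v ` {..<length v}"
  and block_eq_Nil: "block c u v = [] \<longleftrightarrow> v = []"
  by (auto simp: block_def)

lemma hd_block: "v \<noteq> [] \<Longrightarrow> hd (block c u v) = Child c u v 0"
  using block_nth[of 0 v c u] hd_conv_nth[of "block c u v"] block_eq_Nil[of c u v] by simp

lemma map_lab_block: "map lab (block c u v) = v"
  by (rule nth_equalityI) (simp_all add: block_nth)

lemma block_inject: "block c u v = block c' u' v \<Longrightarrow> v \<noteq> [] \<Longrightarrow> c = c' \<and> u = u'"
  by (metis hd_block tedge.inject(2))

lemma opp_block: "u \<noteq> [] \<Longrightarrow> opp (block c v u) u v = c"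
  unfolding opp_def using block_inject[of c v u _ v] by (auto intro!: some_equality)

lemma opp_new: "\<nexists>c0. c = block c0 v u \<Longrightarrow> opp c u v = block c u v"
  by (simp add: opp_def)

lemma finite_cells: "finite (cells e)"
  by (induction e) auto

lemma cells_trans:
  assumes "h \<in> cells f" "f \<in> set c" "(c, u, v) \<in> cells e"
  shows "h \<in> cells e"
  using assms(3,1,2)
proof (induction e)
  case (Child c' u' v' k)
  then show ?case by (cases "(c, u, v) = (c', u', v')") auto
qed simp

lemma member_le_sum_list_weight: "f \<in> set c \<Longrightarrow> weight f \<le> sum_list (map weight c)"
  by (rule member_le_sum_list) auto

lemma cellw_le: "h \<in> cells e \<Longrightarrow> cellw h \<le> weight e"
proof (induction e)
  case (Child c u v k)
  then show ?case using member_le_sum_list_weight[of _ c] by fastforce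
qed simp

lemma cells_cases:
  "(a, b, d) \<in> cells e \<Longrightarrow>
    (\<exists>k. e = Child a b d k) \<or> (\<exists>g\<in>cells e. \<exists>k. Child a b d k \<in> set (fst g))"
proof (induction e)
  case (Child c u v k)
  show ?case
  proof (cases "(a, b, d) = (c, u, v)")
    case False
    then obtain f where f: "f \<in> set c" "(a, b, d) \<in> cells f" using Child.prems by auto
    then have sub: "g \<in> cells f \<Longrightarrow> g \<in> cells (Child c u v k)" for g by auto
    from Child.IH[OF f] show ?thesis
    proof
      assume "\<exists>k. f = Child a b d k"
      then show ?thesis using f(1) by (intro disjI2 bexI[of _ "(c, u, v)"]) auto
    next
      assume "\<exists>g\<in>cells f. \<exists>k. Child a b d k \<in> set (fst g)"
      then show ?thesis using sub by blast
    qed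
  qed simp
qed simp

lemma weight_pos: "0 < weight e"
  by (cases e) auto

definition total :: "'a tedge list \<Rightarrow> nat" where
  "total r = sum_list (map weight r)"

lemma total_simps [simp]: "total [] = 0" "total (e # r) = weight e + total r"
  "total (r @ r') = total r + total r'"
  by (simp_all add: total_def)

lemma total_block: "v \<noteq> [] \<Longrightarrow> total c < total (block c u v)"
proof -
  assume "v \<noteq> []"
  then have "Child c u v 0 \<in> set (block c u v)" by (auto simp: set_block)
  then have "weight (Child c u v 0) \<le> total (block c u v)"
    unfolding total_def by (rule member_le_sum_list_weight)
  then show ?thesis by (simp add: total_def)
qed

lemma weight_less_cellw: "e \<in> set (fst g) \<Longrightarrow> weight e < cellw g"
  using member_le_sum_list_weight[of e "fst g"] by simp

definition cellsl :: "'a tedge list \<Rightarrow> ('a tedge list \<times> 'a list \<times> 'a list) set" where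
  "cellsl r = (\<Union>e\<in>set r. cells e)"

lemma cellsl_simps [simp]: "cellsl [] = {}" "cellsl (e # r) = cells e \<union> cellsl r"
  "cellsl (r @ r') = cellsl r \<union> cellsl r'"
  by (auto simp: cellsl_def)

lemma finite_cellsl: "finite (cellsl r)"
  by (simp add: cellsl_def finite_cells)

lemma cellsl_block: "v \<noteq> [] \<Longrightarrow> cellsl (block c u v) = insert (c, u, v) (cellsl c)"
  by (auto simp: cellsl_def set_block)

locale two_tree =
  fixes \<Sigma> :: "'a set" and R :: "('a list \<times> 'a list) set" and w :: "'a list"
  assumes pres: "semigroup_presentation \<Sigma> R" and word: "w \<in> nonempty_words \<Sigma>"
begin

definition RR :: "('a list \<times> 'a list) set" where
  "RR = {(u, v). (u, v) \<in> R \<or> (v, u) \<in> R}"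

lemma RR_sym: "(u, v) \<in> RR \<Longrightarrow> (v, u) \<in> RR"
  by (auto simp: RR_def)

lemma RR_words: "(u, v) \<in> RR \<Longrightarrow> u \<in> nonempty_words \<Sigma>" "(u, v) \<in> RR \<Longrightarrow> v \<in> nonempty_words \<Sigma>"
  using pres by (auto simp: RR_def semigroup_presentation_def)

lemma RR_nonempty: "(u, v) \<in> RR \<Longrightarrow> u \<noteq> []" "(u, v) \<in> RR \<Longrightarrow> v \<noteq> []"
  using RR_words by (auto simp: nonempty_words_def)

lemma RR_neq: "(u, v) \<in> RR \<Longrightarrow> u \<noteq> v"
  using pres by (auto simp: RR_def semigroup_presentation_def)

text \<open>The last premise of \<open>child\<close> forbids gluing a cell onto the new side of its
  own inverse. Without this, an edge of the universal cover would have several names.\<close>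

inductive valid :: "'a tedge \<Rightarrow> bool" where
  root: "i < length w \<Longrightarrow> valid (Root (w ! i) i)"
| child: "\<lbrakk>\<And>e. e \<in> set c \<Longrightarrow> valid e; path s c t; map lab c = u; (u, v) \<in> RR; k < length v;
    \<nexists>c0. c = block c0 v u\<rbrakk> \<Longrightarrow> valid (Child c u v k)"

definition vpath :: "'a vert \<Rightarrow> 'a tedge list \<Rightarrow> 'a vert \<Rightarrow> bool" where
  "vpath s c t \<longleftrightarrow> path s c t \<and> (\<forall>e\<in>set c. valid e)"

lemma vpath_simps [simp]: "vpath s [] t \<longleftrightarrow> s = t"
  "vpath s (e # es) t \<longleftrightarrow> valid e \<and> src e = s \<and> vpath (tgt e) es t"
  by (auto simp: vpath_def)

lemma vpath_append: "vpath s (xs @ ys) t \<longleftrightarrow> (\<exists>r. vpath s xs r \<and> vpath r ys t)"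
  by (auto simp: vpath_def path_append)

lemma vpath_appendI: "vpath s xs r \<Longrightarrow> vpath r ys t \<Longrightarrow> vpath s (xs @ ys) t"
  by (auto simp: vpath_append)

lemma vpath_valid: "vpath s c t \<Longrightarrow> e \<in> set c \<Longrightarrow> valid e"
  by (auto simp: vpath_def)

lemma vpath_ends: "vpath s xs t \<Longrightarrow> xs \<noteq> [] \<Longrightarrow> src (hd xs) = s"
  "vpath s xs t \<Longrightarrow> xs \<noteq> [] \<Longrightarrow> tgt (last xs) = t"
  using path_ends by (auto simp: vpath_def)

lemma valid_child: "valid (Child c u v k) \<longleftrightarrow> (\<exists>s t. vpath s c t) \<and> map lab c = u \<and> (u, v) \<in> RR \<and>
    k < length v \<and> (\<nexists>c0. c = block c0 v u)"
proof
  assume "valid (Child c u v k)"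
  then show "(\<exists>s t. vpath s c t) \<and> map lab c = u \<and> (u, v) \<in> RR \<and>
    k < length v \<and> (\<nexists>c0. c = block c0 v u)"
  proof cases
    case (child s t)
    then have "vpath s c t" by (simp add: vpath_def)
    then show ?thesis using child by blast
  qed
next
  assume "(\<exists>s t. vpath s c t) \<and> map lab c = u \<and> (u, v) \<in> RR \<and>
    k < length v \<and> (\<nexists>c0. c = block c0 v u)"
  then obtain s t where "path s c t" "\<And>e. e \<in> set c \<Longrightarrow> valid e" "map lab c = u" "(u, v) \<in> RR"
    "k < length v" "\<nexists>c0. c = block c0 v u" unfolding vpath_def by blast
  then show "valid (Child c u v k)" using valid.child[of c s t u v k] by blast
qed

lemma valid_child_nonempty: "valid (Child c u v k) \<Longrightarrow> c \<noteq> [] \<and> u \<noteq> [] \<and> v \<noteq> []"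
  by (auto simp: valid_child dest: RR_nonempty)

lemma valid_root: "valid (Root a i) \<longleftrightarrow> i < length w \<and> a = w ! i"
  by (subst valid.simps) auto

lemma vpath_block:
  assumes c: "vpath s c t" "map lab c = u" "(u, v) \<in> RR" "\<nexists>c0. c = block c0 v u"
  shows "vpath s (block c u v) t"
proof -
  have ne: "c \<noteq> []" "v \<noteq> []" using c RR_nonempty by auto
  have "path (src (Child c u v k)) (map (Child c u v) [k..<length v]) (last (map tgt c))"
    if "k < length v" for k
    using that
  proof (induction "length v - k" arbitrary: k)
    case (Suc n)
    show ?case
    proof (cases "Suc k = length v")
      case True
      then show ?thesis using Suc.prems by (simp add: upt_rec)
    next
      case False
      then have "Suc k < length v" using Suc.prems by simp
      then show ?thesis using Suc.hyps(1)[of "Suc k"] Suc.hyps(2) False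
        by (simp add: upt_conv_Cons[OF Suc.prems])
    qed
  qed simp
  from this[of 0] have "path s (block c u v) t"
    using ne vpath_ends[OF c(1)] by (simp add: block_def hd_map last_map)
  moreover have "valid e" if e: "e \<in> set (block c u v)" for e
  proof -
    obtain k where "e = Child c u v k" "k < length v" using e by (auto simp: set_block)
    moreover from this have "valid (Child c u v k)" unfolding valid_child using c by blast
    ultimately show ?thesis by simp
  qed
  ultimately show ?thesis by (simp add: vpath_def)
qed

text \<open>If \<open>c\<close> is the new side of a cell glued along \<open>c0\<close>, then
  validity prevents \<open>c0\<close> from being the new side of the inverse cell. So crossing from
  \<open>c0\<close> glues this very cell, and crossing twice leads back to \<open>c\<close>.\<close>

lemma opp:
  assumes c: "vpath s c t" "map lab c = u" "(u, v) \<in> RR"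
  shows opp_vpath: "vpath s (opp c u v) t" and opp_lab: "map lab (opp c u v) = v"
    and opp_opp: "opp (opp c u v) v u = c"
proof -
  have ne: "c \<noteq> []" "u \<noteq> []" "v \<noteq> []" using c RR_nonempty by auto
  have "vpath s (opp c u v) t \<and> map lab (opp c u v) = v \<and> opp (opp c u v) v u = c"
  proof (cases "\<exists>c0. c = block c0 v u")
    case True
    then obtain c0 where c0: "c = block c0 v u" by blast
    have "valid (Child c0 v u 0)" using vpath_valid[OF c(1)] c0 ne by (auto simp: set_block)
    then obtain s' t' where v0: "vpath s' c0 t'" "map lab c0 = v" "(v, u) \<in> RR" "\<nexists>c1. c0 = block c1 u v"
      by (auto simp: valid_child)
    have "vpath s' c t'" using vpath_block[OF v0] c0 by simp
    then have "s' = s" "t' = t" using vpath_ends[of _ c] c(1) ne(1) by metis+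
    then show ?thesis using v0 c0 ne opp_block[of u c0 v] opp_new[of c0 u v] by simp
  next
    case False
    then show ?thesis
      using vpath_block[OF c] opp_new[of c v u] opp_block[of v c u] ne map_lab_block[of c u v] by simp
  qed
  then show "vpath s (opp c u v) t" "map lab (opp c u v) = v" "opp (opp c u v) v u = c" by auto
qed

subsection \<open>Positions\<close>

lemma vpath_pos':
  assumes "vpath s c t" "c \<noteq> []"
    and "\<And>e. e \<in> set c \<Longrightarrow> fst (extent e) < snd (extent e) \<and> pos (src e) = fst (extent e) \<and> pos (tgt e) = snd (extent e)"
  shows "pos s = fst (extent (hd c)) \<and> pos t = snd (extent (last c)) \<and> pos s < pos t"
  using assms
proof (induction c arbitrary: s)
  case (Cons e c)
  show ?case
  proof (cases "c = []")
    case True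
    then show ?thesis using Cons.prems by auto
  next
    case False
    then show ?thesis using Cons.IH[of "tgt e"] Cons.prems by fastforce
  qed
qed simp

text \<open>A cell divides the interval spanned by its base into equal parts. Hence positions
  increase along the new side and match those of the base at both ends.\<close>

lemma extent: "valid e \<Longrightarrow> fst (extent e) < snd (extent e) \<and> pos (src e) = fst (extent e) \<and> pos (tgt e) = snd (extent e)"
proof (induction rule: valid.induct)
  case (root i)
  then show ?case by (simp add: pos_def)
next
  case (child c s t u v k)
  have vp: "vpath s c t" using child by (auto simp: vpath_def)
  have ne: "c \<noteq> []" "v \<noteq> []" using RR_nonempty[OF \<open>(u, v) \<in> RR\<close>] \<open>map lab c = u\<close> by auto
  define l where "l = fst (extent (hd c))"
  define r where "r = snd (last (map extent c))"
  have r': "r = snd (extent (last c))" using ne by (simp add: r_def last_map)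
  have lr: "pos s = l" "pos t = r" "l < r" using vpath_pos'[OF vp ne(1)] child.IH l_def r'
    by auto
  have ext: "extent (Child c u v j) = (l + (r - l) * (of_nat j / of_nat (length v)),
      l + (r - l) * (of_nat (Suc j) / of_nat (length v)))" for j
    using ne by (simp add: l_def r_def Let_def hd_map)
  have n: "(0::rat) < of_nat (length v)" using ne by simp
  have 1: "fst (extent (Child c u v k)) < snd (extent (Child c u v k))"
    unfolding ext using lr(3) n by (simp add: divide_strict_right_mono)
  have 2: "pos (src (Child c u v k)) = fst (extent (Child c u v k))"
  proof (cases "k = 0")
    case True
    then show ?thesis unfolding ext using lr vpath_ends[OF vp ne(1)] ne by (simp add: hd_map)
  next
    case False
    then show ?thesis by (simp add: pos_def)
  qed
  have 3: "pos (tgt (Child c u v k)) = snd (extent (Child c u v k))"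
  proof (cases "Suc k = length v")
    case True
    then have "(of_nat (Suc k) :: rat) / of_nat (length v) = 1" using n by simp
    then show ?thesis unfolding ext fst_conv snd_conv
      using lr vpath_ends[OF vp ne(1)] ne True by (simp add: last_map)
  next
    case False
    then have "pos (tgt (Child c u v k)) = fst (extent (Child c u v (Suc k)))" by (simp add: pos_def)
    then show ?thesis unfolding ext by simp
  qed
  show ?case using 1 2 3 by blast
qed

lemma pos_less: "valid e \<Longrightarrow> pos (src e) < pos (tgt e)"
  using extent by fastforce

lemma vpath_pos_le: "vpath s c t \<Longrightarrow> pos s \<le> pos t"
  by (induction c arbitrary: s) (fastforce dest: pos_less)+

lemma vpath_pos_less: "vpath s c t \<Longrightarrow> c \<noteq> [] \<Longrightarrow> pos s < pos t"
  by (cases c) (use vpath_pos_le pos_less in fastforce)+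

lemma vpath_split:
  "vpath s (c1 @ e # c2) t \<longleftrightarrow> vpath s c1 (src e) \<and> valid e \<and> vpath (tgt e) c2 t"
  by (auto simp: vpath_append)

lemma vpath_src_le:
  assumes "vpath s c t" "e \<in> set c"
  shows "pos s \<le> pos (src e)" "pos (tgt e) \<le> pos t"
proof -
  obtain c1 c2 where "c = c1 @ e # c2" using assms(2) by (meson split_list)
  then have "vpath s c1 (src e)" "vpath (tgt e) c2 t" using assms(1) by (simp_all add: vpath_split)
  then show "pos s \<le> pos (src e)" "pos (tgt e) \<le> pos t" using vpath_pos_le by blast+
qed

lemma vpath_distinct: "vpath s c t \<Longrightarrow> distinct (map src c)"
proof (induction c arbitrary: s)
  case (Cons e c)
  have "src f \<noteq> src e" if "f \<in> set c" for f
    using vpath_src_le(1)[of "tgt e" c t f] that Cons.prems pos_less[of e] by auto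
  then have "src e \<notin> src ` set c" by force
  then show ?case using Cons.IH[of "tgt e"] Cons.prems by simp
qed simp

lemma vpath_src_inj: "\<lbrakk>vpath s c t; e \<in> set c; f \<in> set c; src e = src f\<rbrakk> \<Longrightarrow> e = f"
  using vpath_distinct[of s c t] by (auto simp: distinct_map inj_on_def)

subsection \<open>Connecting paths\<close>

text \<open>Descending through the first edges of the bases, one reaches the edge born with the
  vertex. If \<open>f\<close> is a different edge, then some cell in its history is glued on the one
  born there.\<close>

lemma src_inner:
  assumes "valid f" "src f = VIn c u v k"
  shows "(c, u, v) \<in> cells f \<and> (f = Child c u v k \<or> (\<exists>g\<in>cells f. Child c u v k \<in> set (fst g)))"
  using assms
proof (induction f rule: tedge.induct)
  case (Child c' u' v' k')
  show ?case
  proof (cases "k' = 0")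
    case True
    have ne: "c' \<noteq> []" using valid_child_nonempty Child.prems by blast
    then have "hd c' \<in> set c'" "src (hd c') = VIn c u v k" using Child.prems True by (auto simp: hd_map)
    moreover have "valid (hd c')" using Child.prems \<open>hd c' \<in> set c'\<close> by (auto simp: valid_child vpath_def)
    ultimately have IH: "(c, u, v) \<in> cells (hd c') \<and> (hd c' = Child c u v k \<or> (\<exists>g\<in>cells (hd c'). Child c u v k \<in> set (fst g)))"
      using Child.IH by blast
    then show ?thesis using \<open>hd c' \<in> set c'\<close>
      by (auto intro!: bexI[of _ "(c', u', v')"]) force+
  next
    case False
    then show ?thesis using Child.prems by simp
  qed
qed simp

text \<open>The mirror image of \<open>src_inner\<close>. The edge created with
  \<open>VIn c u v k\<close> as its target has index \<open>k - 1\<close>, which makes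
  \<open>0 < k\<close> part of the claim.\<close>

lemma tgt_inner:
  assumes "valid f" "tgt f = VIn c u v k"
  shows "0 < k \<and> (c, u, v) \<in> cells f \<and> (f = Child c u v (k - 1) \<or> (\<exists>g\<in>cells f. Child c u v (k - 1) \<in> set (fst g)))"
  using assms
proof (induction f rule: tedge.induct)
  case (Child c' u' v' k')
  show ?case
  proof (cases "Suc k' = length v'")
    case True
    have ne: "c' \<noteq> []" using valid_child_nonempty Child.prems by blast
    then have "last c' \<in> set c'" "tgt (last c') = VIn c u v k" using Child.prems True by (auto simp: last_map)
    moreover have "valid (last c')" using Child.prems \<open>last c' \<in> set c'\<close> by (auto simp: valid_child vpath_def)
    ultimately have IH: "0 < k \<and> (c, u, v) \<in> cells (last c') \<and> (last c' = Child c u v (k - 1) \<or> (\<exists>g\<in>cells (last c'). Child c u v (k - 1) \<in> set (fst g)))"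
      using Child.IH by blast
    then show ?thesis using \<open>last c' \<in> set c'\<close>
      by (auto intro!: bexI[of _ "(c', u', v')"]) force+
  next
    case False
    then show ?thesis using Child.prems by auto
  qed
qed simp

text \<open>At an inner vertex of the block the path arrives by the preceding edge of the block: by
  \<open>tgt_inner\<close>, any other edge ending there has in its history a cell glued on that
  edge, which \<open>max\<close> excludes.\<close>

lemma block_left:
  assumes "vpath s r (src (Child c u v j))" "valid (Child c u v j)"
    and max: "\<And>f g k. \<lbrakk>f \<in> set r; g \<in> cells f\<rbrakk> \<Longrightarrow> Child c u v k \<notin> set (fst g)"
    and s: "\<And>k. 0 < k \<Longrightarrow> s \<noteq> VIn c u v k"
  shows "\<exists>r'. r = r' @ map (Child c u v) [0..<j]"
  using assms(1,2) max
proof (induction j arbitrary: r)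
  case (Suc j)
  have "r \<noteq> []" using Suc.prems s by auto
  then obtain r1 f where r: "r = r1 @ [f]" by (metis append_butlast_last_id)
  have f: "valid f" "tgt f = VIn c u v (Suc j)" "vpath s r1 (src f)"
    using Suc.prems(1) r by (auto simp: vpath_append)
  have "f = Child c u v j" using tgt_inner[OF f(1,2)] Suc.prems(3)[of f] r by auto
  moreover have "valid (Child c u v j)" using Suc.prems(2) unfolding valid_child by simp
  moreover have "Child c u v k \<notin> set (fst g)" if "f \<in> set r1" "g \<in> cells f" for f g k
    using Suc.prems(3)[of f g k] that r by simp
  ultimately obtain r' where "r1 = r' @ map (Child c u v) [0..<j]" using Suc.IH[of r1] f(3) by blast
  then show ?case using r \<open>f = Child c u v j\<close> by simp
qed simp

lemma block_right:
  assumes "vpath (tgt (Child c u v j)) r t" "valid (Child c u v j)"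
    and max: "\<And>f g k. \<lbrakk>f \<in> set r; g \<in> cells f\<rbrakk> \<Longrightarrow> Child c u v k \<notin> set (fst g)"
    and t: "\<And>k. 0 < k \<Longrightarrow> t \<noteq> VIn c u v k"
  shows "\<exists>r'. r = map (Child c u v) [Suc j..<length v] @ r'"
  using assms(1,2) max
proof (induction "length v - Suc j" arbitrary: j r)
  case 0
  then show ?case by simp
next
  case (Suc n)
  then have j: "Suc j < length v" by simp
  then have "r \<noteq> []" using Suc.prems t[of "Suc j"] by auto
  then obtain f r1 where r: "r = f # r1" by (cases r) auto
  have f: "valid f" "src f = VIn c u v (Suc j)" "vpath (tgt f) r1 t"
    using Suc.prems(1) r j by auto
  have "f = Child c u v (Suc j)" using src_inner[OF f(1,2)] Suc.prems(3)[of f] r by auto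
  moreover have "Child c u v k \<notin> set (fst g)" if "f \<in> set r1" "g \<in> cells f" for f g k
    using Suc.prems(3)[of f g k] that r by simp
  moreover have "n = length v - Suc (Suc j)" using Suc.hyps(2) by simp
  ultimately obtain r' where "r1 = map (Child c u v) [Suc (Suc j)..<length v] @ r'"
    using Suc.hyps(1)[of "Suc j" r1] f(1,3) by blast
  then show ?case using r \<open>f = Child c u v (Suc j)\<close> upt_conv_Cons[OF j] by simp
qed

lemma block_subpath:
  assumes r: "vpath s r t" "Child c u v j \<in> set r"
    and max: "\<And>f g k. \<lbrakk>f \<in> set r; g \<in> cells f\<rbrakk> \<Longrightarrow> Child c u v k \<notin> set (fst g)"
    and ends: "\<And>k. 0 < k \<Longrightarrow> s \<noteq> VIn c u v k" "\<And>k. 0 < k \<Longrightarrow> t \<noteq> VIn c u v k"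
  shows "\<exists>r1 r2. r = r1 @ block c u v @ r2"
proof -
  obtain r1 r2 where r12: "r = r1 @ Child c u v j # r2" using r by (meson split_list)
  have v: "valid (Child c u v j)" "vpath s r1 (src (Child c u v j))" "vpath (tgt (Child c u v j)) r2 t"
    using r(1) r12 by (auto simp: vpath_append)
  have m1: "Child c u v k \<notin> set (fst g)" if "f \<in> set r1" "g \<in> cells f" for f g k
    using max[of f g k] that r12 by simp
  obtain r1' where 1: "r1 = r1' @ map (Child c u v) [0..<j]"
    using block_left[of s r1 c u v j, OF v(2,1)] m1 ends(1) by blast
  have m2: "Child c u v k \<notin> set (fst g)" if "f \<in> set r2" "g \<in> cells f" for f g k
    using max[of f g k] that r12 by simp
  obtain r2' where 2: "r2 = map (Child c u v) [Suc j..<length v] @ r2'"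
    using block_right[of c u v j r2 t, OF v(3,1)] m2 ends(2) by blast
  have j: "j < length v" using v(1) unfolding valid_child by blast
  then obtain n where n: "length v = j + n" by (metis less_imp_add_positive)
  have "[0..<length v] = [0..<j] @ [j..<length v]" unfolding n by (rule upt_add_eq_append) simp
  also have "[j..<length v] = j # [Suc j..<length v]" by (rule upt_conv_Cons[OF j])
  finally have "[0..<length v] = [0..<j] @ j # [Suc j..<length v]" .
  then have "block c u v = map (Child c u v) [0..<j] @ Child c u v j # map (Child c u v) [Suc j..<length v]"
    by (simp add: block_def)
  then have "r = r1' @ block c u v @ r2'" unfolding r12 1 2 by simp
  then show ?thesis by blast
qed


section \<open>Moves of paths across a cell\<close>

definition mv_at :: "'a vert \<Rightarrow> 'a tedge list \<Rightarrow> 'a tedge list \<Rightarrow> bool" where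
  "mv_at x r r' \<longleftrightarrow> (\<exists>r1 c r2 u v. (u, v) \<in> RR \<and> map lab c = u \<and> src (hd c) = x \<and>
    r = r1 @ c @ r2 \<and> r' = r1 @ opp c u v @ r2)"

definition mv :: "'a tedge list \<Rightarrow> 'a tedge list \<Rightarrow> bool" where
  "mv r r' \<longleftrightarrow> (\<exists>x. mv_at x r r')"

lemma vpath_append3:
  assumes "vpath s (r1 @ c @ r2) t"
  obtains p q where "vpath s r1 p" "vpath p c q" "vpath q r2 t"
  using assms by (auto simp: vpath_append)

lemma mv_at_vpath:
  assumes "mv_at x r r'" "vpath s r t"
  shows "vpath s r' t"
proof -
  obtain r1 c r2 u v where m: "(u, v) \<in> RR" "map lab c = u" "r = r1 @ c @ r2" "r' = r1 @ opp c u v @ r2"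
    using assms(1) unfolding mv_at_def by blast
  obtain p q where pq: "vpath s r1 p" "vpath p c q" "vpath q r2 t"
    using assms(2) m(3) vpath_append3 by blast
  have "vpath p (opp c u v) q" by (rule opp_vpath[OF pq(2) m(2,1)])
  then show ?thesis unfolding m(4) using pq by (blast intro: vpath_appendI)
qed

lemma opp_cases:
  assumes c: "vpath s c t" "map lab c = u" "(u, v) \<in> RR"
  shows "opp c u v = block c u v \<and> (\<nexists>c0. c = block c0 v u) \<or>
    c = block (opp c u v) v u \<and> (\<nexists>c0. opp c u v = block c0 u v)"
proof (cases "\<exists>c0. c = block c0 v u")
  case True
  then obtain c0 where c0: "c = block c0 v u" by blast
  have ne: "u \<noteq> []" using RR_nonempty[OF c(3)] by simp
  then have "Child c0 v u 0 \<in> set c" using c0 by (auto simp: set_block)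
  then have "valid (Child c0 v u 0)" using vpath_valid[OF c(1)] by simp
  then have "\<nexists>c1. c0 = block c1 u v" unfolding valid_child by blast
  moreover have "opp c u v = c0" using opp_block[OF ne] c0 by simp
  ultimately show ?thesis using c0 by simp
next
  case False
  then show ?thesis using opp_new by blast
qed

lemma opp_nonempty:
  assumes "vpath s c t" "map lab c = u" "(u, v) \<in> RR"
  shows "c \<noteq> []" "opp c u v \<noteq> []"
  using RR_nonempty[OF assms(3)] assms(2) opp_lab[OF assms] by auto

lemma opp_src:
  assumes c: "vpath s c t" "map lab c = u" "(u, v) \<in> RR"
  shows "src (hd (opp c u v)) = s" "src (hd c) = s"
  using vpath_ends(1)[OF opp_vpath[OF c]] vpath_ends(1)[OF c(1)] opp_nonempty[OF c] by auto

lemma mv_at_sym: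
  assumes "mv_at x r r'" "vpath s r t"
  shows "mv_at x r' r"
proof -
  obtain r1 c r2 u v where m: "(u, v) \<in> RR" "map lab c = u" "src (hd c) = x" "r = r1 @ c @ r2" "r' = r1 @ opp c u v @ r2"
    using assms(1) unfolding mv_at_def by blast
  obtain p q where pq: "vpath s r1 p" "vpath p c q" "vpath q r2 t"
    using assms(2) m(4) vpath_append3 by blast
  note c = pq(2) m(2,1)
  have "(v, u) \<in> RR \<and> map lab (opp c u v) = v \<and> src (hd (opp c u v)) = x \<and> r' = r1 @ opp c u v @ r2 \<and>
      r = r1 @ opp (opp c u v) v u @ r2"
    using RR_sym[OF m(1)] opp_lab[OF c] opp_opp[OF c] opp_src[OF c] m(3-5) by simp
  then show ?thesis unfolding mv_at_def by blast
qed

lemma mv_at_append: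
  assumes "mv_at x r r'"
  shows "mv_at x (a @ r @ b) (a @ r' @ b)"
proof -
  obtain r1 c r2 u v where m: "(u, v) \<in> RR" "map lab c = u" "src (hd c) = x" "r = r1 @ c @ r2" "r' = r1 @ opp c u v @ r2"
    using assms(1) unfolding mv_at_def by blast
  have "a @ r @ b = (a @ r1) @ c @ (r2 @ b)" "a @ r' @ b = (a @ r1) @ opp c u v @ (r2 @ b)"
    using m by simp_all
  then show ?thesis unfolding mv_at_def using m(1-3) by blast
qed

lemma mv_rtranclp_append: "mv\<^sup>*\<^sup>* r r' \<Longrightarrow> mv\<^sup>*\<^sup>* (a @ r @ b) (a @ r' @ b)"
proof (induction rule: rtranclp_induct)
  case (step y z)
  then have "mv (a @ y @ b) (a @ z @ b)" unfolding mv_def using mv_at_append by blast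
  then show ?case using step by simp
qed simp

text \<open>The reduction behind the inductions on \<open>total\<close>: undoing a cell whose whole
  new side lies on the path lowers the weight.\<close>

lemma collapse:
  assumes r: "vpath s (q1 @ block c u v @ q2) t" and v: "v \<noteq> []"
  shows "vpath s (q1 @ c @ q2) t" "mv_at (src (hd c)) (q1 @ block c u v @ q2) (q1 @ c @ q2)"
    "total (q1 @ c @ q2) < total (q1 @ block c u v @ q2)"
    "(u, v) \<in> RR" "map lab c = u" "\<nexists>c0. c = block c0 v u" "c \<noteq> []"
proof -
  have "Child c u v 0 \<in> set (q1 @ block c u v @ q2)" using v by (auto simp: set_block)
  then have val: "valid (Child c u v 0)" using vpath_valid[OF r] by blast
  then show *: "(u, v) \<in> RR" "map lab c = u" "\<nexists>c0. c = block c0 v u" unfolding valid_child by blast+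
  show c: "c \<noteq> []" using valid_child_nonempty[OF val] by simp
  have o: "opp (block c u v) v u = c" using opp_block[OF v] .
  have "src (hd (block c u v)) = src (hd c)" using hd_block[OF v] c by (simp add: hd_map)
  then show m: "mv_at (src (hd c)) (q1 @ block c u v @ q2) (q1 @ c @ q2)"
    unfolding mv_at_def using o RR_sym[OF *(1)] map_lab_block[of c u v]
    by (intro exI[of _ q1] exI[of _ "block c u v"] exI[of _ q2] exI[of _ v] exI[of _ u]) simp
  show "vpath s (q1 @ c @ q2) t" using mv_at_vpath[OF m r] .
  show "total (q1 @ c @ q2) < total (q1 @ block c u v @ q2)" using total_block[OF v] by simp
qed

lemma maximal_weight_block:
  assumes r: "vpath s r t" "Child c u v j \<in> set r"
    and max: "\<And>f. f \<in> set r \<Longrightarrow> weight f \<le> weight (Child c u v j)"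
    and ends: "\<And>k. 0 < k \<Longrightarrow> s \<noteq> VIn c u v k" "\<And>k. 0 < k \<Longrightarrow> t \<noteq> VIn c u v k"
  shows "\<exists>r1 r2. r = r1 @ block c u v @ r2"
proof (rule block_subpath[OF r _ ends])
  fix f g k assume f: "f \<in> set r" "g \<in> cells f"
  show "Child c u v k \<notin> set (fst g)"
  proof
    assume "Child c u v k \<in> set (fst g)"
    then have "weight (Child c u v k) < cellw g" by (rule weight_less_cellw)
    then show False using cellw_le[OF f(2)] max[OF f(1)] by simp
  qed
qed

lemma weight_root: "valid e \<Longrightarrow> weight e \<le> 1 \<Longrightarrow> \<exists>i. i < length w \<and> e = Root (w ! i) i"
proof (cases e)
  case (Child c u v k)
  assume "valid e" "weight e \<le> 1"
  moreover have "hd c \<in> set c" using valid_child_nonempty[of c u v k] \<open>valid e\<close> Child by simp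
  then have "weight (hd c) < weight e" using weight_less_cellw[of "hd c" "(c, u, v)"] Child by simp
  ultimately show ?thesis using weight_pos[of "hd c"] by simp
qed (simp add: valid_root)

text \<open>After common first and last edges are removed, take the heaviest edge of both paths. If
  it is a root edge, all edges are root edges and the paths begin alike. Otherwise nothing is glued
  on the new side of its cell, and no end of the paths is an inner vertex of this cell, since the
  first or last edges would then coincide. So the whole new side lies on one of the paths and can be
  collapsed.\<close>

lemma vpath_connected: "vpath s r t \<Longrightarrow> vpath s r' t \<Longrightarrow> mv\<^sup>*\<^sup>* r r'"
proof (induction "total r + total r'" arbitrary: s t r r' rule: less_induct)
  case less
  show ?case
  proof (cases "r = [] \<or> r' = []")
    case True
    then have "s = t" using less.prems by auto
    then have "r = []" "r' = []" using vpath_pos_less less.prems by fastforce+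
    then show ?thesis by simp
  next
    case False
    then have ne: "r \<noteq> []" "r' \<noteq> []" by auto
    show ?thesis
    proof (cases "hd r = hd r'")
      case True
      then obtain e r1 r1' where r: "r = e # r1" "r' = e # r1'" using ne by (metis list.collapse)
      have "mv\<^sup>*\<^sup>* r1 r1'"
        by (rule less.hyps[of _ _ "tgt e" t]) (use r less.prems weight_pos[of e] in auto)
      then show ?thesis using mv_rtranclp_append[of r1 r1' "[e]" "[]"] r by simp
    next
      case hd: False
      show ?thesis
      proof (cases "last r = last r'")
        case True
        then obtain e r1 r1' where r: "r = r1 @ [e]" "r' = r1' @ [e]" using ne by (metis append_butlast_last_id)
        have "mv\<^sup>*\<^sup>* r1 r1'"
          by (rule less.hyps[of _ _ s "src e"]) (use r less.prems weight_pos[of e] in \<open>auto simp: vpath_append\<close>)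
        then show ?thesis using mv_rtranclp_append[of r1 r1' "[]" "[e]"] r by simp
      next
        case last: False
        have in_set: "hd r \<in> set r" "hd r' \<in> set r'" "last r \<in> set r" "last r' \<in> set r'" using ne by auto
        have ends: "valid (hd r)" "valid (hd r')" "valid (last r)" "valid (last r')"
          "src (hd r) = s" "src (hd r') = s" "tgt (last r) = t" "tgt (last r') = t"
          using in_set vpath_valid[OF less.prems(1)] vpath_valid[OF less.prems(2)]
            vpath_ends[OF less.prems(1) ne(1)] vpath_ends[OF less.prems(2) ne(2)] by auto
        let ?S = "set r \<union> set r'"
        have fin: "finite (weight ` ?S)" "weight ` ?S \<noteq> {}" using ne by auto
        from Max_in[OF fin] obtain e where e: "Max (weight ` ?S) = weight e" "e \<in> ?S"
          by (rule imageE)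
        have max: "weight f \<le> weight e" if "f \<in> ?S" for f
          using that e(1) Max_ge[OF fin(1), of "weight f"] by simp
        have val_e: "valid e" using e(2) vpath_valid[OF less.prems(1)] vpath_valid[OF less.prems(2)] by auto
        show ?thesis
        proof (cases e)
          case (Root a i)
          have "weight (hd r) \<le> 1" "weight (hd r') \<le> 1" using max[of "hd r"] max[of "hd r'"] in_set Root by auto
          then obtain i i' where "hd r = Root (w ! i) i" "hd r' = Root (w ! i') i'"
            using weight_root ends(1,2) by metis
          then have "hd r = hd r'" using ends(5,6) by auto
          then show ?thesis using hd by simp
        next
          case (Child c u v j)
          have small: "Child c u v k \<notin> set (fst g)" if "f \<in> ?S" "g \<in> cells f" for f g k
          proof
            assume "Child c u v k \<in> set (fst g)"
            then have "weight (Child c u v k) < cellw g" by (rule weight_less_cellw)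
            then show False using cellw_le[OF that(2)] max[OF that(1)] Child by simp
          qed
          have v: "v \<noteq> []" using valid_child_nonempty val_e Child by blast
          have s: "s \<noteq> VIn c u v k" for k
          proof
            assume "s = VIn c u v k"
            then have "hd r = Child c u v k" "hd r' = Child c u v k"
              using src_inner[OF ends(1), of c u v k] src_inner[OF ends(2), of c u v k] ends(5,6)
                small[of "hd r"] small[of "hd r'"] in_set by auto
            then show False using hd by simp
          qed
          have t: "t \<noteq> VIn c u v k" for k
          proof
            assume "t = VIn c u v k"
            then have "last r = Child c u v (k - 1)" "last r' = Child c u v (k - 1)"
              using tgt_inner[OF ends(3), of c u v k] tgt_inner[OF ends(4), of c u v k] ends(7,8)
                small[of "last r"] small[of "last r'"] in_set by auto
            then show False using last by simp
          qed
          show ?thesis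
          proof (cases "e \<in> set r")
            case True
            then obtain q1 q2 where q: "r = q1 @ block c u v @ q2"
              using maximal_weight_block[OF less.prems(1), of c u v j] max s t Child by blast
            note k = collapse[OF less.prems(1)[unfolded q] v]
            have "mv\<^sup>*\<^sup>* (q1 @ c @ q2) r'"
              by (rule less.hyps[OF _ k(1) less.prems(2)]) (use k(3) q in simp)
            moreover have "mv r (q1 @ c @ q2)" using k(2) q unfolding mv_def by blast
            ultimately show ?thesis by (rule converse_rtranclp_into_rtranclp[rotated])
          next
            case False
            then have "e \<in> set r'" using e by simp
            then obtain q1 q2 where q: "r' = q1 @ block c u v @ q2"
              using maximal_weight_block[OF less.prems(2), of c u v j] max s t Child by blast
            note k = collapse[OF less.prems(2)[unfolded q] v]
            have "mv\<^sup>*\<^sup>* r (q1 @ c @ q2)"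
              by (rule less.hyps[OF _ less.prems(1) k(1)]) (use k(3) q in simp)
            moreover have "mv (q1 @ c @ q2) r'" using mv_at_sym[OF k(2)] less.prems(2) q unfolding mv_def by blast
            ultimately show ?thesis by (rule rtranclp.rtrancl_into_rtrancl)
          qed
        qed
      qed
    qed
  qed
qed

subsection \<open>States\<close>

abbreviation origin :: "'a vert" where "origin \<equiv> VRoot 0"
abbreviation terminus :: "'a vert" where "terminus \<equiv> VRoot (length w)"
abbreviation state :: "'a tedge list \<Rightarrow> bool" where "state r \<equiv> vpath origin r terminus"

definition root_path :: "nat \<Rightarrow> nat \<Rightarrow> 'a tedge list" where
  "root_path i j = map (\<lambda>i. Root (w ! i) i) [i..<j]"

definition root :: "'a tedge list" where
  "root = root_path 0 (length w)"

lemma vpath_root_path: "i \<le> j \<Longrightarrow> j \<le> length w \<Longrightarrow> vpath (VRoot i) (root_path i j) (VRoot j)"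
proof (induction rule: dec_induct)
  case (step n)
  then show ?case by (simp add: root_path_def vpath_append valid_root)
qed (simp add: root_path_def)

lemma state_root: "state root"
  using vpath_root_path by (simp add: root_def)

lemma lab_root: "map lab root = w"
  by (simp add: root_def root_path_def comp_def map_nth)

lemma vpath_all_root:
  "vpath (VRoot i) r (VRoot j) \<Longrightarrow> \<forall>f\<in>set r. weight f \<le> 1 \<Longrightarrow> r = root_path i j"
proof (induction r arbitrary: i)
  case Nil
  then show ?case by (simp add: root_path_def)
next
  case (Cons e r)
  then have e: "e = Root (w ! i) i" using weight_root[of e] by auto
  then have v: "vpath (VRoot (Suc i)) r (VRoot j)" using Cons.prems by simp
  then have r: "r = root_path (Suc i) j" using Cons by simp
  have "i < j" using vpath_pos_le[OF v] by (simp add: pos_def del: of_nat_Suc)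
  then show ?case unfolding e r root_path_def by (simp add: upt_conv_Cons)
qed

lemma valid_extend: "valid e \<Longrightarrow> (\<exists>a. vpath origin a (src e)) \<and> (\<exists>b. vpath (tgt e) b terminus)"
proof (induction rule: valid.induct)
  case (root i)
  then show ?case using vpath_root_path[of 0 i] vpath_root_path[of "Suc i" "length w"] by auto
next
  case (child c s t u v k)
  have vp: "vpath s c t" using child by (auto simp: vpath_def)
  have ne: "c \<noteq> []" using RR_nonempty[OF \<open>(u, v) \<in> RR\<close>] \<open>map lab c = u\<close> by auto
  obtain a where a: "vpath origin a (src (hd c))" using child.IH[of "hd c"] ne by auto
  obtain b where b: "vpath (tgt (last c)) b terminus" using child.IH[of "last c"] ne by auto
  have B: "vpath s (block c u v) t"
    by (rule vpath_block[OF vp \<open>map lab c = u\<close> \<open>(u, v) \<in> RR\<close>]) (use child in blast)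
  have "Child c u v k \<in> set (block c u v)" using \<open>k < length v\<close> by (simp add: set_block)
  then obtain b1 b2 where "block c u v = b1 @ Child c u v k # b2" by (meson split_list)
  then have "vpath s b1 (src (Child c u v k))" "vpath (tgt (Child c u v k)) b2 t"
    using B by (simp_all only: vpath_split)
  then show ?case using a b vpath_ends[OF vp ne] vpath_appendI by metis
qed

section \<open>Building states cell by cell\<close>

definition vts :: "'a tedge list \<Rightarrow> 'a vert set" where
  "vts r = insert terminus (src ` set r)"

lemma cells_valid: "valid f \<Longrightarrow> (a, b, d) \<in> cells f \<Longrightarrow> valid (Child a b d 0)"
proof (induction f rule: tedge.induct)
  case (Child c u v k)
  show ?case
  proof (cases "(a, b, d) = (c, u, v)")
    case True
    then show ?thesis using Child.prems valid_child_nonempty[of c u v k] unfolding valid_child by auto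
  next
    case False
    then obtain f where f: "f \<in> set c" "(a, b, d) \<in> cells f" using Child.prems by auto
    have "valid f" using Child.prems(1) f(1) unfolding valid_child vpath_def by blast
    then show ?thesis using Child.IH f by blast
  qed
qed simp

lemma cellsl_trans: "h \<in> cells f \<Longrightarrow> f \<in> set (fst g) \<Longrightarrow> g \<in> cellsl r \<Longrightarrow> h \<in> cellsl r"
  using cells_trans[of h f "fst g" "fst (snd g)" "snd (snd g)"] by (auto simp: cellsl_def)

text \<open>If no further cell is glued on the new side, its edges are not hidden in the history but
  are edges of \<open>r\<close> itself, where \<open>block_subpath\<close> finds the whole new side.
  As the edges of a state are distinct, they do not occur elsewhere, and collapsing removes the cell
  from the history.\<close>

lemma maximal_cell:
  assumes r: "state r" and h: "(c, u, v) \<in> cellsl r"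
    and max: "\<forall>g\<in>cellsl r. \<forall>k. Child c u v k \<notin> set (fst g)"
  shows "\<exists>q1 q2. r = q1 @ block c u v @ q2 \<and> v \<noteq> [] \<and> (c, u, v) \<notin> cellsl (q1 @ c @ q2)"
proof -
  have child: "\<exists>k. f = Child c u v k" if "f \<in> set r" "(c, u, v) \<in> cells f" for f
    using cells_cases[OF that(2)] max that(1) unfolding cellsl_def by blast
  obtain f where "f \<in> set r" "(c, u, v) \<in> cells f" using h by (auto simp: cellsl_def)
  then obtain j where j: "Child c u v j \<in> set r" using child by blast
  have "Child c u v k \<notin> set (fst g)" if "f \<in> set r" "g \<in> cells f" for f g k
    using max that by (auto simp: cellsl_def)
  then obtain q1 q2 where q: "r = q1 @ block c u v @ q2"
    using block_subpath[OF r j] by auto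
  have "valid (Child c u v j)" using j vpath_valid[OF r] by simp
  then have v: "v \<noteq> []" using valid_child_nonempty by blast
  have dist: "distinct r" using vpath_distinct[OF r] by (simp add: distinct_map)
  have "(c, u, v) \<notin> cells f" if f: "f \<in> set q1 \<union> set q2" for f
  proof
    assume "(c, u, v) \<in> cells f"
    moreover have "f \<in> set r" using f q by auto
    ultimately obtain k where k: "f = Child c u v k" using child by blast
    moreover have "valid f" using \<open>f \<in> set r\<close> vpath_valid[OF r] by simp
    ultimately have "f \<in> set (block c u v)" by (simp add: set_block valid_child)
    then show False using dist q f by auto
  qed
  moreover have "(c, u, v) \<notin> cells f" if "f \<in> set c" for f
    using cellw_le[of "(c, u, v)" f] weight_less_cellw[of f "(c, u, v)"] that by auto
  ultimately have "(c, u, v) \<notin> cellsl (q1 @ c @ q2)" by (auto simp: cellsl_def)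
  then show ?thesis using q v by blast
qed

lemma state_cases:
  assumes r: "state r"
  shows "r = root \<or> (\<exists>q1 c u v q2. r = q1 @ block c u v @ q2 \<and> v \<noteq> [] \<and> (c, u, v) \<notin> cellsl (q1 @ c @ q2))"
proof (cases "cellsl r = {}")
  case True
  have "weight f \<le> 1" if "f \<in> set r" for f
    using True that by (cases f) (auto simp: cellsl_def)
  then show ?thesis using vpath_all_root[OF r] by (simp add: root_def)
next
  case False
  then have fin: "finite (cellw ` cellsl r)" "cellw ` cellsl r \<noteq> {}" by (auto simp: finite_cellsl)
  from Max_in[OF fin] obtain h where h: "Max (cellw ` cellsl r) = cellw h" "h \<in> cellsl r"
    by (rule imageE)
  obtain c u v where huv: "h = (c, u, v)" by (cases h)
  have maxi: "\<forall>g\<in>cellsl r. \<forall>k. Child c u v k \<notin> set (fst g)"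
  proof (intro ballI allI notI)
    fix g k assume that: "g \<in> cellsl r" and "Child c u v k \<in> set (fst g)"
    then have "weight (Child c u v k) < cellw g" using weight_less_cellw[of "Child c u v k" g] by blast
    moreover have "cellw g \<le> cellw h" unfolding h(1)[symmetric] by (rule Max_ge[OF fin(1)]) (use that in blast)
    ultimately show False using huv by simp
  qed
  have "(c, u, v) \<in> cellsl r" using h(2) huv by simp
  from maximal_cell[OF r this maxi]
  obtain q1 q2 where "r = q1 @ block c u v @ q2 \<and> v \<noteq> [] \<and> (c, u, v) \<notin> cellsl (q1 @ c @ q2)"
    by (elim exE)
  then show ?thesis by (intro disjI2 exI)
qed

text \<open>Collapsing a heaviest cell again and again leads to the root path. That the cell is
  absent from the smaller state is what allows histories to be compared as sets.\<close>

lemma state_induct [consumes 1, case_names root expand]: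
  assumes "state r" and "P root"
    and step: "\<And>q1 c u v q2. \<lbrakk>state (q1 @ c @ q2); P (q1 @ c @ q2); state (q1 @ block c u v @ q2);
      (u, v) \<in> RR; map lab c = u; \<nexists>c0. c = block c0 v u; (c, u, v) \<notin> cellsl (q1 @ c @ q2)\<rbrakk>
      \<Longrightarrow> P (q1 @ block c u v @ q2)"
  shows "P r"
  using assms(1)
proof (induction "total r" arbitrary: r rule: less_induct)
  case less
  show ?case
  proof (cases "r = root")
    case False
    then obtain q1 c u v q2 where q: "r = q1 @ block c u v @ q2" "v \<noteq> []" "(c, u, v) \<notin> cellsl (q1 @ c @ q2)"
      using state_cases[OF less.prems] by blast
    note k = collapse[OF less.prems[unfolded q(1)] q(2)]
    have "P (q1 @ c @ q2)" using less.hyps[OF _ k(1)] k(3) q(1) by simp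
    then show ?thesis unfolding q(1)
      by (rule step[OF k(1) _ less.prems[unfolded q(1)] k(4,5,6) q(3)])
  qed (use assms in simp)
qed

text \<open>The cells of a state that start at \<open>x\<close> can be read off from its single edge
  leaving \<open>x\<close>. The critical case is an \<open>x\<close> that is an inner vertex of the
  newest cell: a cell starting there has the newest cell in its history, which is not yet present in
  the smaller state.\<close>

lemma start_cell:
  assumes "state r" "h \<in> cellsl r" "e \<in> set r" "src e = start h"
  shows "h \<in> cells e"
  using assms
proof (induction arbitrary: e rule: state_induct)
  case root
  then show ?case by (auto simp: cellsl_def root_def root_path_def)
next
  case (expand q1 c u v q2)
  have ne: "c \<noteq> []" "v \<noteq> []" using RR_nonempty[OF expand.hyps(3)] expand.hyps(4) by auto
  let ?r = "q1 @ block c u v @ q2"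
  have src0: "src (Child c u v 0) = src (hd c)" using ne by (simp add: hd_map)
  show ?case
  proof (cases "h = (c, u, v)")
    case True
    have "Child c u v 0 \<in> set ?r" using ne by (auto simp: set_block)
    then have "e = Child c u v 0"
      using vpath_src_inj[OF expand.hyps(2) expand.prems(2)] expand.prems(3) True src0 by simp
    then show ?thesis using True by simp
  next
    case False
    then have h: "h \<in> cellsl (q1 @ c @ q2)" using expand.prems(1) cellsl_block[OF ne(2), of c u] by auto
    show ?thesis
    proof (cases "e \<in> set (block c u v)")
      case False
      then have "e \<in> set (q1 @ c @ q2)" using expand.prems(2) by auto
      then show ?thesis using expand.IH[OF h] expand.prems(3) by blast
    next
      case True
      then obtain j where j: "e = Child c u v j" by (auto simp: set_block)
      show ?thesis
      proof (cases "j = 0")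
        case True
        then have "src (hd c) = start h" using j src0 expand.prems(3) by simp
        moreover have "hd c \<in> set (q1 @ c @ q2)" using ne by simp
        ultimately have "h \<in> cells (hd c)" using expand.IH[OF h] by blast
        then show ?thesis using ne j by auto
      next
        case False
        obtain a b d where abd: "h = (a, b, d)" by (cases h)
        obtain f where f: "f \<in> set (q1 @ c @ q2)" "h \<in> cells f" using h unfolding cellsl_def by blast
        have "valid f" using vpath_valid[OF expand.hyps(1) f(1)] .
        then have val: "valid (Child a b d 0)" using cells_valid f abd by blast
        have a: "a \<noteq> []" using valid_child_nonempty[OF val] by simp
        have "valid (hd a)" using val a unfolding valid_child vpath_def by auto
        moreover have "src (hd a) = VIn c u v j" using expand.prems(3) abd j False by simp
        ultimately have "(c, u, v) \<in> cells (hd a)" using src_inner by blast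
        then have "(c, u, v) \<in> cellsl (q1 @ c @ q2)"
          using cellsl_trans[of _ "hd a" h, OF _ _ h] a abd by simp
        then show ?thesis using expand.hyps by blast
      qed
    qed
  qed
qed

subsection \<open>The distance between states\<close>

definition sd :: "'b set \<Rightarrow> 'b set \<Rightarrow> 'b set" where
  "sd A B = (A - B) \<union> (B - A)"

lemma finite_sd: "finite (sd (cellsl r) (cellsl r'))"
  by (simp add: sd_def finite_cellsl)

lemma maximal_cell_collapse:
  assumes r: "state r" and h: "(c, u, v) \<in> cellsl r"
    and max: "\<forall>g\<in>cellsl r. \<forall>k. Child c u v k \<notin> set (fst g)"
  shows "\<exists>q1 q2. r = q1 @ block c u v @ q2 \<and> state (q1 @ c @ q2) \<and>
    mv_at (src (hd c)) r (q1 @ c @ q2) \<and> cellsl (q1 @ c @ q2) = cellsl r - {(c, u, v)} \<and>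
    (\<forall>x\<in>vts r. x \<in> vts (q1 @ c @ q2) \<or> (\<exists>j. x = VIn c u v j))"
proof -
  obtain q1 q2 where q: "r = q1 @ block c u v @ q2" "v \<noteq> []" "(c, u, v) \<notin> cellsl (q1 @ c @ q2)"
    using maximal_cell[OF r h max] by (elim exE conjE)
  note k = collapse[OF r[unfolded q(1)] q(2)]
  have "cellsl (q1 @ c @ q2) = cellsl r - {(c, u, v)}"
    using q cellsl_block[OF q(2), of c u] by auto
  moreover have "\<forall>x\<in>vts r. x \<in> vts (q1 @ c @ q2) \<or> (\<exists>j. x = VIn c u v j)"
  proof -
    have "src (Child c u v j) \<in> vts (q1 @ c @ q2) \<or> (\<exists>i. src (Child c u v j) = VIn c u v i)" for j
      using k(7) by (auto simp: vts_def hd_map)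
    then show ?thesis using q(1) unfolding vts_def by (auto simp: set_block simp del: src.simps)
  qed
  ultimately show ?thesis using k(1,2) unfolding q(1) by - (rule exI[of _ q1], rule exI[of _ q2], intro conjI, rule HOL.refl)
qed

lemma distinct_split_unique:
  assumes "distinct (a @ c @ b)" "a @ c @ b = a' @ c @ b'" "c \<noteq> []"
  shows "a = a'" "b = b'"
proof -
  obtain x c' where c: "c = x # c'" using assms(3) by (cases c) auto
  have "a @ x # (c' @ b) = a' @ x # (c' @ b')" "x \<notin> set a" "x \<notin> set (c' @ b)"
    using assms c by auto
  then have "a = a' \<and> c' @ b = c' @ b'" using append_Cons_eq_iff[of x a "c' @ b" a' "c' @ b'"] by blast
  then show "a = a'" "b = b'" by auto
qed

text \<open>The last cell of the construction of the first state is maximal in the common history,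
  so it can be collapsed in both states; the induction hypothesis applies to what remains.\<close>

lemma state_eqI: "state r \<Longrightarrow> state r' \<Longrightarrow> cellsl r = cellsl r' \<Longrightarrow> r = r'"
proof (induction arbitrary: r' rule: state_induct)
  case root
  have "cellsl root = {}" by (auto simp: cellsl_def root_def root_path_def)
  then have "cellsl r' = {}" using root.prems by simp
  then show ?case using state_cases[OF root.prems(1)] by (auto simp: cellsl_block)
next
  case (expand q1 c u v q2)
  have ne: "c \<noteq> []" "v \<noteq> []" using RR_nonempty[OF expand.hyps(3)] expand.hyps(4) by auto
  have cells: "cellsl r' = insert (c, u, v) (cellsl (q1 @ c @ q2))"
    using expand.prems(2) cellsl_block[OF ne(2), of c u] by auto
  have max: "\<forall>g\<in>cellsl r'. \<forall>k. Child c u v k \<notin> set (fst g)"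
  proof (intro ballI allI notI)
    fix g k assume that: "g \<in> cellsl r'" and k: "Child c u v k \<in> set (fst g)"
    show False
    proof (cases "g = (c, u, v)")
      case True
      then show False using weight_less_cellw[of "Child c u v k" g] k by simp
    next
      case False
      then have "(c, u, v) \<in> cellsl (q1 @ c @ q2)"
        using cellsl_trans[of "(c, u, v)" "Child c u v k" g "q1 @ c @ q2"] k that cells by auto
      then show False using expand.hyps by blast
    qed
  qed
  have "(c, u, v) \<in> cellsl r'" using cells by simp
  from maximal_cell_collapse[OF expand.prems(1) this max]
  obtain p1 p2 where p: "r' = p1 @ block c u v @ p2" "state (p1 @ c @ p2)"
    "cellsl (p1 @ c @ p2) = cellsl r' - {(c, u, v)}" by (elim exE conjE) (rule that)
  have "cellsl (q1 @ c @ q2) = cellsl (p1 @ c @ p2)" using p(3) cells expand.hyps(6) by auto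
  then have eq: "q1 @ c @ q2 = p1 @ c @ p2" using expand.IH[OF p(2)] by simp
  have "distinct (q1 @ c @ q2)" using vpath_distinct[OF expand.hyps(1)] by (simp only: distinct_map)
  then show ?case using distinct_split_unique[OF _ eq ne(1)] p(1) by simp
qed

text \<open>The set \<open>W\<close> confines walks to states through given vertices. In the
  applications these are vertices fixed by the group element under consideration.\<close>

definition adj :: "'a vert set \<Rightarrow> 'a tedge list \<Rightarrow> 'a tedge list \<Rightarrow> bool" where
  "adj W r r' \<longleftrightarrow> state r \<and> state r' \<and> W \<subseteq> vts r \<and> W \<subseteq> vts r' \<and> mv r r'"

lemma adj_sym: "adj W r r' \<Longrightarrow> adj W r' r"
  unfolding adj_def mv_def using mv_at_sym[of _ r r' origin terminus] by metis

lemma inner_vertex_cell: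
  assumes "state r" "VIn c u v j \<in> vts r"
  shows "(c, u, v) \<in> cellsl r"
proof -
  obtain f where f: "f \<in> set r" "src f = VIn c u v j" using assms(2) by (auto simp: vts_def image_iff)
  then have "(c, u, v) \<in> cells f" using src_inner[of f c u v j] vpath_valid[OF assms(1)] by blast
  then show ?thesis using f by (auto simp: cellsl_def)
qed

text \<open>A cell glued on the new side of \<open>h\<close> is heavier than \<open>h\<close>; by
  \<open>mx\<close> it would be common to both states, and then so would \<open>h\<close>. Hence
  \<open>h\<close> is collapsible in \<open>r\<close>. The only vertices lost are inner vertices of
  \<open>h\<close>, and these do not lie on \<open>r'\<close>.\<close>

lemma collapse_towards:
  assumes r: "state r" "W \<subseteq> vts r" and r': "state r'" "W \<subseteq> vts r'"
    and h: "h \<in> cellsl r - cellsl r'"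
    and mx: "\<And>g. g \<in> sd (cellsl r) (cellsl r') \<Longrightarrow> cellw g \<le> cellw h"
  shows "\<exists>r1. adj W r r1 \<and> cellsl r1 = cellsl r - {h}"
proof -
  obtain c u v where huv: "h = (c, u, v)" by (cases h)
  have maxi: "\<forall>g\<in>cellsl r. \<forall>k. Child c u v k \<notin> set (fst g)"
  proof (intro ballI allI notI)
    fix g k assume g: "g \<in> cellsl r" and k: "Child c u v k \<in> set (fst g)"
    then have "cellw h < cellw g" using weight_less_cellw[OF k] huv by simp
    then have "g \<in> cellsl r'" using mx[of g] g by (auto simp: sd_def)
    then have "h \<in> cellsl r'" using cellsl_trans[OF _ k, of h r'] huv by simp
    then show False using h by simp
  qed
  have hr: "(c, u, v) \<in> cellsl r" using h huv by simp
  obtain q1 q2 where q: "state (q1 @ c @ q2)" "mv_at (src (hd c)) r (q1 @ c @ q2)"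
    "cellsl (q1 @ c @ q2) = cellsl r - {(c, u, v)}"
    "\<forall>x\<in>vts r. x \<in> vts (q1 @ c @ q2) \<or> (\<exists>j. x = VIn c u v j)"
    using maximal_cell_collapse[OF r(1) hr maxi] by (elim exE conjE) (rule that)
  have "x \<in> vts (q1 @ c @ q2)" if "x \<in> W" for x
  proof (rule ccontr)
    assume "x \<notin> vts (q1 @ c @ q2)"
    then obtain j where "x = VIn c u v j" using q(4) \<open>x \<in> W\<close> r(2) by auto
    then have "(c, u, v) \<in> cellsl r'" using inner_vertex_cell[OF r'(1)] that r'(2) by blast
    then show False using h huv by simp
  qed
  then have "adj W r (q1 @ c @ q2)" using r q(1,2) unfolding adj_def mv_def by blast
  then show ?thesis using q(3) huv by blast
qed

text \<open>A heaviest cell of the symmetric difference can be collapsed on the side where it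
  occurs. Together with \<open>adj_dst\<close> this shows that walks through \<open>W\<close> are as
  short as walks without this restriction.\<close>

lemma geodesic:
  assumes "state r" "state r'" "W \<subseteq> vts r" "W \<subseteq> vts r'"
  shows "(adj W ^^ card (sd (cellsl r) (cellsl r'))) r r'"
  using assms
proof (induction "card (sd (cellsl r) (cellsl r'))" arbitrary: r r')
  case 0
  then have "sd (cellsl r) (cellsl r') = {}" by (metis card_0_eq finite_sd)
  then have "r = r'" using state_eqI[OF 0(2,3)] by (auto simp: sd_def)
  then show ?case using 0 by (simp add: sd_def)
next
  case (Suc n)
  let ?S = "sd (cellsl r) (cellsl r')"
  have ne: "?S \<noteq> {}" using Suc.hyps(2) by auto
  have fin: "finite (cellw ` ?S)" "cellw ` ?S \<noteq> {}" using finite_sd ne by auto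
  from Max_in[OF fin] obtain h where h: "Max (cellw ` ?S) = cellw h" "h \<in> ?S" by (rule imageE)
  have max: "cellw g \<le> cellw h" if "g \<in> ?S" for g
    unfolding h(1)[symmetric] by (rule Max_ge[OF fin(1)]) (use that in blast)
  have sd_sym: "sd (cellsl r') (cellsl r) = ?S" by (auto simp: sd_def)
  show ?case
  proof (cases "h \<in> cellsl r")
    case True
    then have "h \<in> cellsl r - cellsl r'" using h(2) by (auto simp: sd_def)
    then obtain r1 where r1: "adj W r r1" "cellsl r1 = cellsl r - {h}"
      using collapse_towards[OF Suc.prems(1,3,2,4) _ max] by blast
    have "sd (cellsl r1) (cellsl r') = ?S - {h}"
      using \<open>h \<in> cellsl r - cellsl r'\<close> r1(2) by (auto simp: sd_def)
    then have "n = card (sd (cellsl r1) (cellsl r'))" using Suc.hyps(2) h(2) finite_sd by simp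
    moreover have "state r1" "W \<subseteq> vts r1" using r1(1) by (auto simp: adj_def)
    ultimately have "(adj W ^^ n) r1 r'" using Suc.hyps(1)[of r1 r'] Suc.prems by simp
    then show ?thesis unfolding Suc.hyps(2)[symmetric] by (rule relpowp_Suc_I2[of "adj W", OF r1(1)])
  next
    case False
    then have hr': "h \<in> cellsl r' - cellsl r" using h(2) by (auto simp: sd_def)
    have "\<And>g. g \<in> sd (cellsl r') (cellsl r) \<Longrightarrow> cellw g \<le> cellw h" using max sd_sym by simp
    then obtain r1 where r1: "adj W r' r1" "cellsl r1 = cellsl r' - {h}"
      using collapse_towards[OF Suc.prems(2,4,1,3) hr'] by blast
    have "sd (cellsl r) (cellsl r1) = ?S - {h}" using hr' r1(2) by (auto simp: sd_def)
    then have "n = card (sd (cellsl r) (cellsl r1))" using Suc.hyps(2) h(2) finite_sd by simp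
    moreover have "state r1" "W \<subseteq> vts r1" using r1(1) by (auto simp: adj_def)
    ultimately have "(adj W ^^ n) r r1" using Suc.hyps(1)[of r r1] Suc.prems by simp
    then show ?thesis unfolding Suc.hyps(2)[symmetric] by (rule relpowp_Suc_I[of _ "adj W"]) (rule adj_sym[OF r1(1)])
  qed
qed

lemma opp_cell:
  assumes c: "vpath s c t" "map lab c = u" "(u, v) \<in> RR"
  obtains h where "start h = s" "sd (cellsl c) (cellsl (opp c u v)) \<subseteq> {h}"
proof -
  have ne: "u \<noteq> []" "v \<noteq> []" using RR_nonempty[OF c(3)] by auto
  from opp_cases[OF c] show thesis
  proof
    assume "opp c u v = block c u v \<and> (\<nexists>c0. c = block c0 v u)"
    then have "sd (cellsl c) (cellsl (opp c u v)) \<subseteq> {(c, u, v)}"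
      using cellsl_block[OF ne(2), of c u] by (auto simp: sd_def)
    then show thesis using that[of "(c, u, v)"] opp_src[OF c] by simp
  next
    assume "c = block (opp c u v) v u \<and> (\<nexists>c0. opp c u v = block c0 u v)"
    then have "cellsl c = insert (opp c u v, v, u) (cellsl (opp c u v))"
      using cellsl_block[OF ne(1), of "opp c u v" v] by simp
    then have "sd (cellsl c) (cellsl (opp c u v)) \<subseteq> {(opp c u v, v, u)}" by (auto simp: sd_def)
    then show thesis using that[of "(opp c u v, v, u)"] opp_src[OF c] by simp
  qed
qed

lemma mv_cell:
  assumes "mv_at x r r'" "vpath s r t"
  obtains h where "start h = x" "sd (cellsl r) (cellsl r') \<subseteq> {h}"
proof -
  obtain r1 c r2 u v where m: "(u, v) \<in> RR" "map lab c = u" "src (hd c) = x" "r = r1 @ c @ r2" "r' = r1 @ opp c u v @ r2"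
    using assms(1) unfolding mv_at_def by blast
  obtain p q where pq: "vpath s r1 p" "vpath p c q" "vpath q r2 t"
    using assms(2) m(4) vpath_append3 by blast
  obtain h where "start h = p" "sd (cellsl c) (cellsl (opp c u v)) \<subseteq> {h}"
    using opp_cell[OF pq(2) m(2,1)] by blast
  moreover have "sd (cellsl r) (cellsl r') \<subseteq> sd (cellsl c) (cellsl (opp c u v))"
    unfolding m(4,5) by (auto simp: sd_def)
  moreover have "x = p" using opp_src[OF pq(2) m(2,1)] m(3) by simp
  ultimately show thesis using that[of h] by blast
qed

abbreviation dst :: "'a tedge list \<Rightarrow> 'a tedge list \<Rightarrow> nat" where
  "dst r r' \<equiv> card (sd (cellsl r) (cellsl r'))"

lemma dst_triangle: "dst r r'' \<le> dst r r' + dst r' r''"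
proof -
  have "sd (cellsl r) (cellsl r'') \<subseteq> sd (cellsl r) (cellsl r') \<union> sd (cellsl r') (cellsl r'')"
    by (auto simp: sd_def)
  then have "dst r r'' \<le> card (sd (cellsl r) (cellsl r') \<union> sd (cellsl r') (cellsl r''))"
    by (intro card_mono) (simp_all add: finite_sd)
  also have "\<dots> \<le> dst r r' + dst r' r''" by (rule card_Un_le)
  finally show ?thesis .
qed

text \<open>A cell that is changed and changed back counts on the right but not on the left.\<close>

lemma dst_crossing:
  assumes "h \<in> sd (cellsl r) (cellsl r')" "h \<in> sd (cellsl r') (cellsl r'')"
  shows "dst r r'' < dst r r' + dst r' r''"
proof -
  let ?A = "sd (cellsl r) (cellsl r')" and ?B = "sd (cellsl r') (cellsl r'')"
  have "sd (cellsl r) (cellsl r'') \<subseteq> (?A \<union> ?B) - {h}" using assms by (auto simp: sd_def)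
  then have "dst r r'' \<le> card ((?A \<union> ?B) - {h})" by (intro card_mono) (simp_all add: finite_sd)
  also have "\<dots> < card (?A \<union> ?B)" using assms(1) by (intro card_Diff1_less) (simp_all add: finite_sd)
  also have "\<dots> \<le> dst r r' + dst r' r''" by (rule card_Un_le)
  finally show ?thesis .
qed

lemma adj_dst: "(adj W ^^ n) r r' \<Longrightarrow> dst r r' \<le> n"
proof (induction n arbitrary: r')
  case 0
  then show ?case by (simp add: sd_def)
next
  case (Suc n)
  from Suc.prems obtain r1 where r1: "(adj W ^^ n) r r1" "adj W r1 r'" by (rule relpowp_Suc_E)
  obtain x where x: "mv_at x r1 r'" "state r1" using r1(2) by (auto simp: adj_def mv_def)
  obtain h where h: "sd (cellsl r1) (cellsl r') \<subseteq> {h}" using mv_cell[OF x] by blast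
  have "dst r1 r' \<le> card {h}" by (rule card_mono[OF _ h]) simp
  then have "dst r1 r' \<le> 1" by simp
  then show ?case using Suc.IH[OF r1(1)] dst_triangle[of r r' r1] by linarith
qed

end

text \<open>The extension to the 2-tree of the map that sends the root path to \<open>p\<close>.
  Using \<open>opp\<close> here accounts for cells whose image leads back across a cell in the
  history of \<open>p\<close>.\<close>

primrec act :: "'a tedge list \<Rightarrow> 'a tedge \<Rightarrow> 'a tedge" where
  "act p (Root a i) = p ! i"
| "act p (Child c u v k) = opp (map (act p) c) u v ! k"

context two_tree
begin

text \<open>The translates of the root path; they correspond to the elements of the diagram
  group.\<close>

definition gstate :: "'a tedge list \<Rightarrow> bool" where
  "gstate p \<longleftrightarrow> state p \<and> map lab p = w"

text \<open>A root vertex follows the edge that ends there, so that the terminus is covered and only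
  the origin is treated apart.\<close>

definition actV :: "'a tedge list \<Rightarrow> 'a vert \<Rightarrow> 'a vert" where
  "actV p x = (case x of VRoot i \<Rightarrow> if i = 0 then origin else tgt (p ! (i - 1))
    | VIn c u v k \<Rightarrow> src (act p (Child c u v k)))"

lemma vpath_nth: "vpath s r t \<Longrightarrow> Suc i < length r \<Longrightarrow> tgt (r ! i) = src (r ! Suc i)"
proof (induction r arbitrary: s i)
  case (Cons e r)
  show ?case
  proof (cases i)
    case 0
    then show ?thesis using Cons.prems by (cases r) auto
  next
    case (Suc j)
    then show ?thesis using Cons.IH[of "tgt e" j] Cons.prems by simp
  qed
qed simp

lemma vpath_map:
  assumes "vpath s c t"
    and "\<And>e. e \<in> set c \<Longrightarrow> valid (f e) \<and> src (f e) = g (src e) \<and> tgt (f e) = g (tgt e)"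
  shows "vpath (g s) (map f c) (g t)"
  using assms
proof (induction c arbitrary: s)
  case (Cons e c)
  have "vpath (g (tgt e)) (map f c) (g t)"
    by (rule Cons.IH) (use Cons.prems in auto)
  then show ?case using Cons.prems(1) Cons.prems(2)[of e] by simp
qed simp

lemma act_valid:
  assumes p: "gstate p"
  shows "valid e \<Longrightarrow> valid (act p e) \<and> lab (act p e) = lab e \<and>
    src (act p e) = actV p (src e) \<and> tgt (act p e) = actV p (tgt e)"
proof (induction rule: valid.induct)
  case (root i)
  have sp: "state p" "map lab p = w" using p by (auto simp: gstate_def)
  then have len: "length p = length w" by (metis length_map)
  then have mem: "p ! i \<in> set p" using root by simp
  have "lab (p ! i) = w ! i" using sp(2) len root nth_map[of i p lab] by simp
  moreover have "src (p ! i) = actV p (VRoot i)"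
  proof (cases i)
    case 0
    then show ?thesis using vpath_ends(1)[OF sp(1)] len root hd_conv_nth[of p]
      by (cases p) (auto simp: actV_def)
  next
    case (Suc j)
    then show ?thesis using vpath_nth[OF sp(1), of j] len root by (simp add: actV_def)
  qed
  ultimately show ?case using vpath_valid[OF sp(1) mem] by (simp add: actV_def)
next
  case (child c s t u v k)
  have vp: "vpath s c t" using child by (auto simp: vpath_def)
  have ne: "c \<noteq> []" "v \<noteq> []" using RR_nonempty[OF \<open>(u, v) \<in> RR\<close>] \<open>map lab c = u\<close> by auto
  let ?C = "map (act p) c"
  have C: "vpath (actV p s) ?C (actV p t)" by (rule vpath_map[OF vp]) (use child.IH in blast)
  have labC: "map lab ?C = u" using child.IH \<open>map lab c = u\<close> by auto
  let ?B = "opp ?C u v"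
  have B: "vpath (actV p s) ?B (actV p t)" by (rule opp_vpath[OF C labC \<open>(u, v) \<in> RR\<close>])
  have labB: "map lab ?B = v" by (rule opp_lab[OF C labC \<open>(u, v) \<in> RR\<close>])
  then have lenB: "length ?B = length v" by (metis length_map)
  have k: "k < length ?B" using \<open>k < length v\<close> lenB by simp
  then have Bne: "?B \<noteq> []" by auto
  have 1: "valid (?B ! k)" using vpath_valid[OF B nth_mem[OF k]] .
  have 2: "lab (?B ! k) = v ! k" using nth_map[OF k, of lab] labB by simp
  have 3: "src (?B ! k) = actV p (src (Child c u v k))"
  proof (cases "k = 0")
    case True
    then show ?thesis using vpath_ends(1)[OF B Bne] hd_conv_nth[OF Bne] vpath_ends(1)[OF vp ne(1)] ne
      by (simp add: hd_map)
  next
    case False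
    then show ?thesis by (simp add: actV_def)
  qed
  have 4: "tgt (?B ! k) = actV p (tgt (Child c u v k))"
  proof (cases "Suc k = length v")
    case True
    then have "k = length ?B - 1" using lenB by simp
    then have "tgt (?B ! k) = actV p t" using vpath_ends(2)[OF B Bne] last_conv_nth[OF Bne] by simp
    moreover have "tgt (Child c u v k) = t" using True vpath_ends(2)[OF vp ne(1)] ne by (simp add: last_map)
    ultimately show ?thesis by simp
  next
    case False
    then have "tgt (?B ! k) = src (?B ! Suc k)" using vpath_nth[OF B, of k] k lenB by simp
    then show ?thesis using False by (simp add: actV_def)
  qed
  show ?case using 1 2 3 4 by simp
qed

lemma act_vpath: "gstate p \<Longrightarrow> vpath s c t \<Longrightarrow> vpath (actV p s) (map (act p) c) (actV p t)"
  by (rule vpath_map) (use act_valid vpath_valid in blast)+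

lemma act_lab: "gstate p \<Longrightarrow> vpath s c t \<Longrightarrow> map lab (map (act p) c) = map lab c"
  using act_valid vpath_valid by auto

lemma act_block:
  assumes "gstate p" "vpath s c t" "map lab c = u" "(u, v) \<in> RR"
  shows "map (act p) (block c u v) = opp (map (act p) c) u v"
proof -
  have "map lab (opp (map (act p) c) u v) = v"
    by (rule opp_lab[OF act_vpath[OF assms(1,2)]]) (use act_lab[OF assms(1,2)] assms in auto)
  then have "length (opp (map (act p) c) u v) = length v" by (metis length_map)
  then show ?thesis by (intro nth_equalityI) (simp_all add: block_nth)
qed

lemma act_opp:
  assumes p: "gstate p" and c: "vpath s c t" "map lab c = u" "(u, v) \<in> RR"
  shows "map (act p) (opp c u v) = opp (map (act p) c) u v"
proof -
  from opp_cases[OF c] show ?thesis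
  proof
    assume "opp c u v = block c u v \<and> (\<nexists>c0. c = block c0 v u)"
    then show ?thesis using act_block[OF p c] by simp
  next
    assume *: "c = block (opp c u v) v u \<and> (\<nexists>c0. opp c u v = block c0 u v)"
    let ?o = "opp c u v"
    note o = opp_vpath[OF c] opp_lab[OF c] RR_sym[OF c(3)]
    have "map (act p) c = map (act p) (block ?o v u)" using * by simp
    also have "\<dots> = opp (map (act p) ?o) v u" by (rule act_block[OF p o])
    finally have eq: "map (act p) c = opp (map (act p) ?o) v u" .
    have "map lab (map (act p) ?o) = v" using act_lab[OF p o(1)] o(2) by simp
    then show ?thesis unfolding eq using opp_opp[OF act_vpath[OF p o(1)] _ o(3)] by simp
  qed
qed

lemma act_root: "valid e \<Longrightarrow> act root e = e"
proof (induction rule: valid.induct)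
  case (root i)
  then show ?case by (simp add: two_tree.root_def[OF two_tree_axioms] root_path_def)
next
  case (child c s t u v k)
  have "map (act root) c = c" using child.IH by (simp add: map_idI)
  moreover have "opp c u v = block c u v" by (rule opp_new) (use child in blast)
  ultimately show ?case using block_nth[OF \<open>k < length v\<close>, of c u] by simp
qed

lemma actV_origin: "actV p origin = origin"
  by (simp add: actV_def)

lemma actV_terminus:
  assumes "gstate p"
  shows "actV p terminus = terminus"
proof -
  have sp: "state p" "length p = length w" using assms by (auto simp: gstate_def)
  have "w \<noteq> []" using word by (auto simp: nonempty_words_def)
  then have "p \<noteq> []" using sp by auto
  then show ?thesis using vpath_ends(2)[OF sp(1)] last_conv_nth[of p] sp \<open>w \<noteq> []\<close> by (simp add: actV_def)
qed

lemma act_state: "gstate p \<Longrightarrow> state r \<Longrightarrow> state (map (act p) r)"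
  using act_vpath[of p origin r terminus] by (simp add: actV_origin actV_terminus)

lemma act_comp:
  assumes p: "gstate p" and q: "gstate q"
  shows "valid e \<Longrightarrow> act (map (act p) q) e = act p (act q e)"
proof (induction rule: valid.induct)
  case (root i)
  have "length q = length w" using q by (auto simp: gstate_def)
  then show ?case using root by simp
next
  case (child c s t u v k)
  have vp: "vpath s c t" using child by (auto simp: vpath_def)
  let ?c = "map (act q) c"
  have c: "vpath (actV q s) ?c (actV q t)" "map lab ?c = u"
    using act_vpath[OF q vp] act_lab[OF q vp] \<open>map lab c = u\<close> by auto
  have "map (act (map (act p) q)) c = map (act p) ?c" using child.IH by simp
  then have "act (map (act p) q) (Child c u v k) = opp (map (act p) ?c) u v ! k" by (simp only: act.simps)
  also have "opp (map (act p) ?c) u v = map (act p) (opp ?c u v)"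
    using act_opp[OF p c \<open>(u, v) \<in> RR\<close>] by simp
  also have "map (act p) (opp ?c u v) ! k = act p (opp ?c u v ! k)"
  proof (rule nth_map)
    have "length (opp ?c u v) = length v"
      using opp_lab[OF c \<open>(u, v) \<in> RR\<close>] by (metis length_map)
    then show "k < length (opp ?c u v)" using \<open>k < length v\<close> by simp
  qed
  finally show ?case by simp
qed

lemma act_mv_at:
  assumes p: "gstate p" and r: "vpath s r t" and "mv_at x r r'"
  shows "mv_at (actV p x) (map (act p) r) (map (act p) r')"
proof -
  obtain r1 c r2 u v where m: "(u, v) \<in> RR" "map lab c = u" "src (hd c) = x" "r = r1 @ c @ r2" "r' = r1 @ opp c u v @ r2"
    using assms(3) unfolding mv_at_def by blast
  obtain y z where yz: "vpath s r1 y" "vpath y c z" "vpath z r2 t"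
    using r m(4) vpath_append3 by blast
  have ne: "c \<noteq> []" using opp_nonempty[OF yz(2) m(2,1)] by simp
  have "valid (hd c)" using vpath_valid[OF yz(2)] ne by simp
  then have "src (hd (map (act p) c)) = actV p x" using act_valid[OF p] m(3) ne by (simp add: hd_map)
  moreover have "map lab (map (act p) c) = u" using act_lab[OF p yz(2)] m(2) by simp
  moreover have "map (act p) r = map (act p) r1 @ map (act p) c @ map (act p) r2" using m(4) by simp
  moreover have "map (act p) r' = map (act p) r1 @ opp (map (act p) c) u v @ map (act p) r2"
    using m(5) act_opp[OF p yz(2) m(2,1)] by simp
  ultimately show ?thesis unfolding mv_at_def using m(1) by blast
qed

lemma lab_in: "valid e \<Longrightarrow> lab e \<in> \<Sigma>"
proof (cases e)
  case (Root a i)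
  assume "valid e"
  then have "lab e = w ! i" "i < length w" using Root by (auto simp: valid_root)
  then show ?thesis using word nth_mem[of i w] by (auto simp: nonempty_words_def)
next
  case (Child c u v k)
  assume "valid e"
  then have "(u, v) \<in> RR" "k < length v" using Child by (auto simp: valid_child)
  then show ?thesis using RR_words(2)[of u v] nth_mem[of k v] Child by (auto simp: nonempty_words_def)
qed

lemma vpath_lab_in: "vpath s r t \<Longrightarrow> map lab r \<in> lists \<Sigma>"
  using lab_in vpath_valid by auto

lemma vpath_lab_word: "vpath s r t \<Longrightarrow> r \<noteq> [] \<Longrightarrow> map lab r \<in> nonempty_words \<Sigma>"
  using vpath_lab_in by (auto simp: nonempty_words_def)

subsection \<open>Paths in the Squier complex\<close>

definition arc :: "'a edge \<Rightarrow> bool" where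
  "arc e \<longleftrightarrow> e \<in> arcs (squier_graph \<Sigma> R)"

lemma arc_Edge: "arc (Edge p u v q) \<longleftrightarrow> p \<in> lists \<Sigma> \<and> q \<in> lists \<Sigma> \<and> (u, v) \<in> RR"
  by (simp add: arc_def squier_graph_def RR_def)

lemma arc_inverse: "arc e \<Longrightarrow> arc (edge_inverse e)"
  by (cases e) (simp add: arc_Edge RR_sym)

lemma edge_inverse [simp]: "edge_source (edge_inverse e) = edge_target e"
  "edge_target (edge_inverse e) = edge_source e" "edge_inverse (edge_inverse e) = e"
  by (cases e; simp)+

primrec kpath :: "'a list \<Rightarrow> 'a edge list \<Rightarrow> 'a list \<Rightarrow> bool" where
  "kpath x [] y \<longleftrightarrow> x = y"
| "kpath x (e # es) y \<longleftrightarrow> arc e \<and> edge_source e = x \<and> kpath (edge_target e) es y"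

lemma kpath_append: "kpath x (a @ b) y \<longleftrightarrow> (\<exists>z. kpath x a z \<and> kpath z b y)"
  by (induction a arbitrary: x) auto

lemma awalk_kpath:
  "pre_digraph.awalk (squier_graph \<Sigma> R) x es y \<longleftrightarrow> x \<in> nonempty_words \<Sigma> \<and> kpath x es y"
proof -
  have "set es \<subseteq> arcs (squier_graph \<Sigma> R) \<and> pre_digraph.cas (squier_graph \<Sigma> R) x es y \<longleftrightarrow> kpath x es y"
  proof (induction es arbitrary: x)
    case Nil
    then show ?case by (simp add: pre_digraph.cas.simps)
  next
    case (Cons e es)
    have "tail (squier_graph \<Sigma> R) = edge_source" "head (squier_graph \<Sigma> R) = edge_target"
      by (simp_all add: squier_graph_def)
    then show ?case using Cons.IH[of "edge_target e"] by (auto simp: pre_digraph.cas.simps arc_def)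
  qed
  moreover have "verts (squier_graph \<Sigma> R) = nonempty_words \<Sigma>" by (simp add: squier_graph_def)
  ultimately show ?thesis unfolding pre_digraph.awalk_def by auto
qed

lemma kpath_words: "kpath x es y \<Longrightarrow> x \<in> nonempty_words \<Sigma> \<Longrightarrow> y \<in> nonempty_words \<Sigma>"
proof (induction es arbitrary: x)
  case (Cons e es)
  obtain p u v q where e: "e = Edge p u v q" by (cases e)
  then have "edge_target e \<in> nonempty_words \<Sigma>"
    using Cons.prems RR_words(2)[of u v] by (auto simp: arc_Edge nonempty_words_def)
  then show ?case using Cons by auto
qed simp

lemma kpath_reverse: "kpath x es y \<Longrightarrow> kpath y (rev (map edge_inverse es)) x"
  by (induction es arbitrary: x) (auto simp: kpath_append arc_inverse)

text \<open>The lift of an edge of the Squier complex to a move in the 2-tree. The lengths of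
  \<open>p\<close> and \<open>u\<close> mark the place of the move in a path with the right
  label.\<close>

primrec step :: "'a tedge list \<Rightarrow> 'a edge \<Rightarrow> 'a tedge list" where
  "step r (Edge p u v q) = take (length p) r @ opp (take (length u) (drop (length p) r)) u v
     @ drop (length p + length u) r"

definition run :: "'a tedge list \<Rightarrow> 'a edge list \<Rightarrow> 'a tedge list" where
  "run r es = foldl step r es"

lemma run_simps [simp]: "run r [] = r" "run r (e # es) = run (step r e) es"
  "run r (a @ b) = run (run r a) b"
  by (simp_all add: run_def)

lemma step_eq:
  assumes "map lab r1 = p" "map lab c = u"
  shows "step (r1 @ c @ r2) (Edge p u v q) = r1 @ opp c u v @ r2"
proof -
  have "length p = length r1" "length u = length c" using assms by auto
  then show ?thesis by simp
qed

lemma map_eq_append3: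
  assumes "map f r = p @ u @ q"
  obtains r1 c r2 where "r = r1 @ c @ r2" "map f r1 = p" "map f c = u" "map f r2 = q"
proof -
  obtain r1 r' where 1: "r = r1 @ r'" "map f r1 = p" "map f r' = u @ q"
    using assms by (metis map_eq_append_conv)
  obtain c r2 where 2: "r' = c @ r2" "map f c = u" "map f r2 = q"
    using 1(3) by (metis map_eq_append_conv)
  show thesis using that[of r1 c r2] 1 2 by simp
qed

lemma step:
  assumes r: "vpath s r t" and e: "arc e" "edge_source e = map lab r"
  shows "vpath s (step r e) t" "map lab (step r e) = edge_target e" "step (step r e) (edge_inverse e) = r"
    "mv r (step r e)"
proof -
  obtain p u v q where E: "e = Edge p u v q" by (cases e)
  then have uv: "(u, v) \<in> RR" using e by (simp add: arc_Edge)
  have "map lab r = p @ u @ q" using e E by simp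
  then obtain r1 c r2 where r': "r = r1 @ c @ r2" "map lab r1 = p" "map lab c = u" "map lab r2 = q"
    by (rule map_eq_append3)
  obtain y z where yz: "vpath s r1 y" "vpath y c z" "vpath z r2 t"
    using r r'(1) vpath_append3 by blast
  have st: "step r e = r1 @ opp c u v @ r2" unfolding E r'(1) by (rule step_eq[OF r'(2,3)])
  note o = opp_vpath[OF yz(2) r'(3) uv] opp_lab[OF yz(2) r'(3) uv] opp_opp[OF yz(2) r'(3) uv]
  show "vpath s (step r e) t" unfolding st using yz o(1) by (blast intro: vpath_appendI)
  show "map lab (step r e) = edge_target e" unfolding st using o(2) r' E by simp
  have "step (r1 @ opp c u v @ r2) (Edge p v u q) = r1 @ opp (opp c u v) v u @ r2"
    by (rule step_eq[OF r'(2) o(2)])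
  moreover have "edge_inverse e = Edge p v u q" using E by (simp only: edge_inverse.simps)
  ultimately have "step (step r e) (edge_inverse e) = r1 @ opp (opp c u v) v u @ r2"
    by (simp only: st)
  then show "step (step r e) (edge_inverse e) = r" using o(3) r' by simp
  show "mv r (step r e)" unfolding mv_def mv_at_def st using uv r' by blast
qed

lemma run:
  assumes "kpath (map lab r) es y" "vpath s r t"
  shows run_vpath: "vpath s (run r es) t" and run_lab: "map lab (run r es) = y"
proof -
  have "vpath s (run r es) t \<and> map lab (run r es) = y"
    using assms
  proof (induction es arbitrary: r)
    case (Cons e es)
    have e: "arc e" "edge_source e = map lab r" "kpath (edge_target e) es y" using Cons.prems by auto
    show ?case using Cons.IH[of "step r e"] step[OF Cons.prems(2) e(1,2)] e(3) by simp
  qed simp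
  then show "vpath s (run r es) t" "map lab (run r es) = y" by auto
qed

lemma run_reverse:
  assumes "kpath (map lab r) es y" "vpath s r t"
  shows "run (run r es) (rev (map edge_inverse es)) = r"
  using assms
proof (induction es arbitrary: r)
  case (Cons e es)
  have e: "arc e" "edge_source e = map lab r" "kpath (edge_target e) es y" using Cons.prems by auto
  show ?case using Cons.IH[of "step r e"] step[OF Cons.prems(2) e(1,2)] e(3) by simp
qed simp

lemma act_step:
  assumes p: "gstate p" and r: "vpath s r t" and e: "arc e" "edge_source e = map lab r"
  shows "map (act p) (step r e) = step (map (act p) r) e"
proof -
  obtain p' u v q where E: "e = Edge p' u v q" by (cases e)
  then have uv: "(u, v) \<in> RR" using e by (simp add: arc_Edge)
  have "map lab r = p' @ u @ q" using e E by simp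
  then obtain r1 c r2 where r': "r = r1 @ c @ r2" "map lab r1 = p'" "map lab c = u" "map lab r2 = q"
    by (rule map_eq_append3)
  obtain y z where yz: "vpath s r1 y" "vpath y c z" "vpath z r2 t"
    using r r'(1) vpath_append3 by blast
  have mr: "map (act p) r = map (act p) r1 @ map (act p) c @ map (act p) r2" using r'(1) by simp
  have l: "map lab (map (act p) r1) = p'" "map lab (map (act p) c) = u"
    using act_lab[OF p yz(1)] act_lab[OF p yz(2)] r' by simp_all
  have "step (map (act p) r) e = map (act p) r1 @ opp (map (act p) c) u v @ map (act p) r2"
    unfolding mr E by (rule step_eq[OF l])
  also have "\<dots> = map (act p) (r1 @ opp c u v @ r2)" using act_opp[OF p yz(2) r'(3) uv] by simp
  also have "r1 @ opp c u v @ r2 = step r e" unfolding E r'(1) by (rule step_eq[OF r'(2,3), symmetric])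
  finally show ?thesis by (rule HOL.sym)
qed

lemma act_run:
  assumes p: "gstate p" and "vpath s r t" "kpath (map lab r) es y"
  shows "map (act p) (run r es) = run (map (act p) r) es"
  using assms(2,3)
proof (induction es arbitrary: r)
  case (Cons e es)
  have e: "arc e" "edge_source e = map lab r" "kpath (edge_target e) es y" using Cons.prems by auto
  note st = step[OF Cons.prems(1) e(1,2)]
  have "map (act p) (run (step r e) es) = run (map (act p) (step r e)) es"
    using Cons.IH[OF st(1)] st(2) e(3) by simp
  then show ?case using act_step[OF p Cons.prems(1) e(1,2)] by simp
qed simp

lemma mv_kpath:
  assumes "mv r r'" "vpath s r t"
  shows "\<exists>e. arc e \<and> edge_source e = map lab r \<and> step r e = r'"
proof -
  obtain r1 c r2 u v where m: "(u, v) \<in> RR" "map lab c = u" "r = r1 @ c @ r2" "r' = r1 @ opp c u v @ r2"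
    using assms(1) unfolding mv_def mv_at_def by blast
  let ?e = "Edge (map lab r1) u v (map lab r2)"
  have "map lab r \<in> lists \<Sigma>" using vpath_lab_in[OF assms(2)] .
  then have "arc ?e" using m by (auto simp: arc_Edge)
  moreover have "edge_source ?e = map lab r" using m by simp
  moreover have "step r ?e = r'" unfolding m(3,4) by (rule step_eq[OF HOL.refl m(2)])
  ultimately show ?thesis by blast
qed

lemma mv_rtranclp_kpath:
  assumes "mv\<^sup>*\<^sup>* r r'" "vpath s r t"
  shows "\<exists>es. kpath (map lab r) es (map lab r') \<and> run r es = r'"
  using assms
proof (induction rule: rtranclp_induct)
  case base
  then show ?case by (intro exI[of _ "[]"]) simp
next
  case (step y z)
  then obtain es where es: "kpath (map lab r) es (map lab y)" "run r es = y" by blast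
  have y: "vpath s y t" using run_vpath[OF es(1) assms(2)] es(2) by simp
  obtain e where e: "arc e" "edge_source e = map lab y" "step y e = z"
    using mv_kpath[OF step.hyps(2) y] by blast
  have "map lab z = edge_target e" using two_tree.step(2)[OF two_tree_axioms y e(1,2)] e(3) by simp
  then have "kpath (map lab r) (es @ [e]) (map lab z) \<and> run r (es @ [e]) = z"
    using es e by (auto simp: kpath_append)
  then show ?case by blast
qed

lemma equal_modulo_step:
  assumes "arc e" "edge_source e \<in> nonempty_words \<Sigma>"
  shows "equal_modulo \<Sigma> R (edge_source e) (edge_target e)"
proof -
  obtain p u v q where E: "e = Edge p u v q" by (cases e)
  then have a: "(u, v) \<in> RR" "p \<in> lists \<Sigma>" "q \<in> lists \<Sigma>" using assms by (auto simp: arc_Edge)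
  then have uv: "equal_modulo \<Sigma> R u v"
    unfolding RR_def by (auto intro: equal_modulo.rel equal_modulo.sym)
  have uq: "equal_modulo \<Sigma> R (u @ q) (v @ q)"
  proof (cases "q = []")
    case False
    then have "equal_modulo \<Sigma> R q q" using a by (intro equal_modulo.refl) (simp add: nonempty_words_def)
    then show ?thesis by (rule equal_modulo.mult[OF uv])
  qed (use uv in simp)
  have "equal_modulo \<Sigma> R (p @ u @ q) (p @ v @ q)"
  proof (cases "p = []")
    case False
    then have "equal_modulo \<Sigma> R p p" using a by (intro equal_modulo.refl) (simp add: nonempty_words_def)
    then show ?thesis using uq by (rule equal_modulo.mult)
  qed (use uq in simp)
  then show ?thesis using E by simp
qed

lemma kpath_equal_modulo:
  "kpath x es y \<Longrightarrow> x \<in> nonempty_words \<Sigma> \<Longrightarrow> equal_modulo \<Sigma> R x y"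
proof (induction es arbitrary: x)
  case Nil
  then show ?case by (simp add: equal_modulo.refl)
next
  case (Cons e es)
  have e: "arc e" "edge_source e = x" "kpath (edge_target e) es y" using Cons.prems by auto
  have "kpath x [e] (edge_target e)" using e by simp
  then have "edge_target e \<in> nonempty_words \<Sigma>" using kpath_words Cons.prems(2) by blast
  then have "equal_modulo \<Sigma> R (edge_target e) y" using Cons.IH e(3) by blast
  moreover have "equal_modulo \<Sigma> R x (edge_target e)" using equal_modulo_step[OF e(1)] e(2) Cons.prems(2) by simp
  ultimately show ?case by (rule equal_modulo.trans[rotated])
qed

text \<open>Equalities modulo the presentation are read off from the 2-tree: the moves that connect
  the two paths form a derivation.\<close>

lemma vpath_equal_modulo:
  assumes "vpath s r t" "vpath s r' t" "r \<noteq> []"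
  shows "equal_modulo \<Sigma> R (map lab r) (map lab r')"
proof -
  obtain es where "kpath (map lab r) es (map lab r')"
    using mv_rtranclp_kpath[OF vpath_connected[OF assms(1,2)] assms(1)] by blast
  then show ?thesis using kpath_equal_modulo vpath_lab_word[OF assms(1,3)] by blast
qed

definition shift_edge :: "'a list \<Rightarrow> 'a list \<Rightarrow> 'a edge \<Rightarrow> 'a edge" where
  "shift_edge a b e = (case e of Edge p u v q \<Rightarrow> Edge (a @ p) u v (q @ b))"

lemma shift_edge [simp]: "edge_source (shift_edge a b e) = a @ edge_source e @ b"
  "edge_target (shift_edge a b e) = a @ edge_target e @ b"
  "edge_inverse (shift_edge a b e) = shift_edge a b (edge_inverse e)"
  by (cases e; simp add: shift_edge_def)+

lemma shift_arc: "arc e \<Longrightarrow> a \<in> lists \<Sigma> \<Longrightarrow> b \<in> lists \<Sigma> \<Longrightarrow> arc (shift_edge a b e)"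
  by (cases e) (simp add: shift_edge_def arc_Edge)

lemma shift_kpath: "kpath x es y \<Longrightarrow> a \<in> lists \<Sigma> \<Longrightarrow> b \<in> lists \<Sigma> \<Longrightarrow>
    kpath (a @ x @ b) (map (shift_edge a b) es) (a @ y @ b)"
  by (induction es arbitrary: x) (auto simp: shift_arc)

lemma equal_modulo_words: "equal_modulo \<Sigma> R x y \<Longrightarrow> x \<in> nonempty_words \<Sigma> \<and> y \<in> nonempty_words \<Sigma>"
proof (induction rule: equal_modulo.induct)
  case (rel u v)
  then show ?case using pres by (auto simp: semigroup_presentation_def)
qed (auto simp: nonempty_words_def)

lemma equal_modulo_kpath: "equal_modulo \<Sigma> R x y \<Longrightarrow> \<exists>es. kpath x es y"
proof (induction rule: equal_modulo.induct)
  case (rel u v)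
  then have "kpath u [Edge [] u v []] v" by (simp add: arc_Edge RR_def)
  then show ?case by blast
next
  case (refl u)
  have "kpath u [] u" by simp
  then show ?case by blast
next
  case (sym u v)
  then show ?case using kpath_reverse by blast
next
  case (trans u v x)
  then show ?case using kpath_append by blast
next
  case (mult u v u' v')
  obtain es fs where es: "kpath u es v" "kpath u' fs v'" using mult.IH by blast
  have wd: "u' \<in> lists \<Sigma>" "v \<in> lists \<Sigma>"
    using equal_modulo_words mult.hyps by (auto simp: nonempty_words_def)
  have "kpath ([] @ u @ u') (map (shift_edge [] u') es) ([] @ v @ u')"
    by (rule shift_kpath[OF es(1)]) (use wd in auto)
  moreover have "kpath (v @ u' @ []) (map (shift_edge v []) fs) (v @ v' @ [])"
    by (rule shift_kpath[OF es(2)]) (use wd in auto)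
  ultimately have "kpath (u @ u') (map (shift_edge [] u') es @ map (shift_edge v []) fs) (v @ v')"
    by (auto simp: kpath_append)
  then show ?case by blast
qed

end

subsection \<open>Homotopy of paths\<close>

text \<open>An edge records the cell that created it and its place on the new side. Hence, if the
  first edge of the second block lies in the first block, the two blocks coincide.\<close>

lemma block_overlap_left:
  assumes eq: "q1 @ block c u v @ q2 = q1' @ block c' u' v' @ q2'" and ne: "v \<noteq> []" "v' \<noteq> []"
    and le: "length q1 \<le> length q1'"
  shows "(q1 = q1' \<and> c = c' \<and> u = u' \<and> v = v' \<and> q2 = q2') \<or>
    (\<exists>d. q1' = q1 @ block c u v @ d \<and> q2 = d @ block c' u' v' @ q2')"
proof -
  define us where "us = drop (length q1) q1'"
  have "take (length q1) q1' = q1" using arg_cong[OF eq, of "take (length q1)"] le by simp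
  then have us1: "q1' = q1 @ us" unfolding us_def by (metis append_take_drop_id)
  then have us: "q1' = q1 @ us" "us @ block c' u' v' @ q2' = block c u v @ q2" using eq by simp_all
  have hd': "hd (block c' u' v') = Child c' u' v' 0" "block c' u' v' \<noteq> []"
    using hd_block[OF ne(2)] ne(2) by (auto simp: block_eq_Nil)
  show ?thesis
  proof (cases "length us < length (block c u v)")
    case True
    have "(us @ block c' u' v' @ q2') ! length us = Child c' u' v' 0"
      using hd' by (cases "block c' u' v'") auto
    moreover have "(block c u v @ q2) ! length us = Child c u v (length us)"
      using True by (simp add: nth_append block_nth)
    ultimately have "Child c' u' v' 0 = Child c u v (length us)" using us(2) by simp
    then have "c = c'" "u = u'" "v = v'" "us = []" by auto
    then show ?thesis using us by simp
  next
    case False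
    define d where "d = drop (length v) us"
    have "take (length v) us = block c u v" using arg_cong[OF us(2), of "take (length v)"] False by simp
    then have d: "us = block c u v @ d" unfolding d_def by (metis append_take_drop_id)
    then have "d @ block c' u' v' @ q2' = q2" using us(2) by simp
    with d show ?thesis using us(1) by auto
  qed
qed

context two_tree
begin

declare step.simps [simp del]

abbreviation htp :: "'a list \<Rightarrow> 'a list \<Rightarrow> 'a edge list \<Rightarrow> 'a edge list \<Rightarrow> bool" where
  "htp \<equiv> homotopic (squier_graph \<Sigma> R) edge_inverse (squier_cells \<Sigma> R)"

abbreviation WW :: "'a list set" where "WW \<equiv> nonempty_words \<Sigma>"

lemma cell_closed: "c \<in> squier_cells \<Sigma> R \<Longrightarrow> kpath x c y \<Longrightarrow> x = y"
  by (auto simp: squier_cells_def)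

lemma htp_kpath: "htp x y p q \<Longrightarrow> x \<in> WW \<and> kpath x p y \<and> kpath x q y"
proof (induction rule: homotopic.induct)
  case (refl p)
  then show ?case by (simp add: awalk_kpath)
next
  case (backtrack p e q)
  then show ?case by (auto simp: awalk_kpath kpath_append)
next
  case (cell c p q)
  then have "x \<in> WW" "kpath x (p @ c @ q) y" by (simp_all add: awalk_kpath)
  then obtain z z' where z: "kpath x p z" "kpath z c z'" "kpath z' q y" by (auto simp: kpath_append)
  then have "z = z'" using cell_closed cell by blast
  then show ?case using z \<open>x \<in> WW\<close> \<open>kpath x (p @ c @ q) y\<close> by (auto simp: kpath_append)
qed auto

lemma htp_refl: "x \<in> WW \<Longrightarrow> kpath x p y \<Longrightarrow> htp x y p p"
  by (rule homotopic.refl) (simp add: awalk_kpath)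

lemma htp_backtrack: "x \<in> WW \<Longrightarrow> kpath x (p @ [e, edge_inverse e] @ q) y \<Longrightarrow>
    htp x y (p @ [e, edge_inverse e] @ q) (p @ q)"
  by (rule homotopic.backtrack) (simp add: awalk_kpath)

lemma htp_cell: "c \<in> squier_cells \<Sigma> R \<Longrightarrow> x \<in> WW \<Longrightarrow> kpath x (p @ c @ q) y \<Longrightarrow>
    htp x y (p @ c @ q) (p @ q)"
  by (rule homotopic.cell) (simp_all add: awalk_kpath)

lemmas htp_sym = homotopic.sym
lemmas htp_trans = homotopic.trans

lemma htp_congr:
  assumes "htp x y p q" and z: "z \<in> WW" "kpath z a x" "kpath y b t"
  shows "htp z t (a @ p @ b) (a @ q @ b)"
  using assms(1)
proof (induction rule: homotopic.induct)
  case (refl p)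
  then have "kpath z (a @ p @ b) t" using z by (auto simp: awalk_kpath kpath_append)
  then show ?case by (rule htp_refl[OF z(1)])
next
  case (backtrack p e q)
  then have "kpath x (p @ [e, edge_inverse e] @ q) y" by (simp only: awalk_kpath)
  then have "kpath z ((a @ p) @ [e, edge_inverse e] @ (q @ b)) t"
    using z(2,3) unfolding kpath_append by blast
  from htp_backtrack[OF z(1) this] show ?case by simp
next
  case (cell c p q)
  then have "kpath x (p @ c @ q) y" by (simp only: awalk_kpath)
  then have "kpath z ((a @ p) @ c @ (q @ b)) t" using z(2,3) unfolding kpath_append by blast
  from htp_cell[OF cell(1) z(1) this] show ?case by simp
next
  case (sym p q)
  show ?case by (rule htp_sym[OF sym.IH])
next
  case (trans p q r)
  show ?case by (rule htp_trans[OF trans.IH])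
qed

text \<open>The two relations are applied to the disjoint segments \<open>c1\<close> and
  \<open>c2\<close> of the path, so the corresponding moves commute.\<close>

lemma run_cell:
  assumes c: "c \<in> squier_cells \<Sigma> R" and r: "vpath s r t" "kpath (map lab r) c y"
  shows "run r c = r"
proof -
  obtain p z q l1 r1 l2 r2 where C: "c = [Edge p l1 r1 (z @ l2 @ q), Edge (p @ r1 @ z) l2 r2 q,
      Edge p r1 l1 (z @ r2 @ q), Edge (p @ l1 @ z) r2 l2 q]" and R: "(l1, r1) \<in> R" "(l2, r2) \<in> R"
    using c by (auto simp: squier_cells_def)
  have RR: "(l1, r1) \<in> RR" "(l2, r2) \<in> RR" using R by (auto simp: RR_def)
  have "map lab r = p @ l1 @ (z @ l2 @ q)" using r(2) C by simp
  then obtain a c1 r' where 1: "r = a @ c1 @ r'" "map lab a = p" "map lab c1 = l1" "map lab r' = z @ l2 @ q"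
    by (rule map_eq_append3)
  obtain m c2 b where 2: "r' = m @ c2 @ b" "map lab m = z" "map lab c2 = l2" "map lab b = q"
    using 1(4) by (rule map_eq_append3)
  obtain x1 x2 where x: "vpath x1 c1 x2" "vpath x2 r' t" using r(1) 1(1) by (auto simp: vpath_append)
  obtain x3 x4 where x': "vpath x3 c2 x4" using x(2) 2(1) by (auto simp: vpath_append)
  let ?d1 = "opp c1 l1 r1" and ?d2 = "opp c2 l2 r2"
  note o1 = opp_lab[OF x(1) 1(3) RR(1)] opp_opp[OF x(1) 1(3) RR(1)]
  note o2 = opp_lab[OF x' 2(3) RR(2)] opp_opp[OF x' 2(3) RR(2)]
  have "step r (Edge p l1 r1 (z @ l2 @ q)) = a @ ?d1 @ m @ c2 @ b"
    unfolding 1(1) 2(1) by (rule step_eq[OF 1(2,3)])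
  moreover have "step (a @ ?d1 @ m @ c2 @ b) (Edge (p @ r1 @ z) l2 r2 q) = a @ ?d1 @ m @ ?d2 @ b"
    using step_eq[of "a @ ?d1 @ m" "p @ r1 @ z" c2 l2 b r2 q] 1(2) 2(2,3) o1(1) by simp
  moreover have "step (a @ ?d1 @ m @ ?d2 @ b) (Edge p r1 l1 (z @ r2 @ q)) = a @ c1 @ m @ ?d2 @ b"
    using step_eq[OF 1(2) o1(1), of "m @ ?d2 @ b" l1 "z @ r2 @ q"] o1(2) by simp
  moreover have "step (a @ c1 @ m @ ?d2 @ b) (Edge (p @ l1 @ z) r2 l2 q) = a @ c1 @ m @ c2 @ b"
    using step_eq[of "a @ c1 @ m" "p @ l1 @ z" ?d2 r2 b l2 q] 1(2,3) 2(2) o2 by simp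
  ultimately show ?thesis unfolding C by (simp add: 1(1) 2(1))
qed

lemma htp_run:
  assumes "htp x y p q" "map lab r = x" "vpath s r t"
  shows "run r p = run r q"
  using assms(1)
proof (induction rule: homotopic.induct)
  case (backtrack p e q)
  then have "kpath x p (edge_source e)" "arc e" by (auto simp: awalk_kpath kpath_append)
  then have "vpath s (run r p) t" "map lab (run r p) = edge_source e"
    using run[of r p _ s t] assms by auto
  then have "step (step (run r p) e) (edge_inverse e) = run r p" using step(3)[OF _ \<open>arc e\<close>] by simp
  then show ?case by simp
next
  case (cell c p q)
  then obtain z z' where z: "kpath x p z" "kpath z c z'" by (auto simp: awalk_kpath kpath_append)
  then have "vpath s (run r p) t" "map lab (run r p) = z" using run[of r p z s t] assms by auto
  then have "run (run r p) c = run r p" using run_cell[OF cell(1)] z(2) by blast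
  then show ?case by simp
qed auto

section \<open>Commuting squares and normal forms of paths\<close>

abbreviation bar :: "'a edge list \<Rightarrow> 'a edge list" where
  "bar es \<equiv> rev (map edge_inverse es)"

lemma htp_bar: "kpath x es y \<Longrightarrow> x \<in> WW \<Longrightarrow> htp x x (es @ bar es) []"
proof (induction es arbitrary: x)
  case Nil
  have "kpath x [] x" by simp
  from htp_refl[OF Nil(2) this] show ?case by simp
next
  case (Cons e es)
  have e: "arc e" "edge_source e = x" "kpath (edge_target e) es y" using Cons.prems by auto
  have k: "kpath x [e] (edge_target e)" "kpath (edge_target e) [edge_inverse e] x" using e arc_inverse by auto
  have "htp (edge_target e) (edge_target e) (es @ bar es) []"
    using Cons.IH[OF e(3)] kpath_words[OF k(1)] Cons.prems(2) by blast
  from htp_congr[OF this Cons.prems(2) k]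
  have "htp x x ((e # es) @ bar (e # es)) ([] @ [e, edge_inverse e] @ [])" by simp
  moreover have "htp x x ([] @ [e, edge_inverse e] @ []) ([] @ [])"
    by (rule htp_backtrack) (use Cons.prems e k in auto)
  ultimately show ?case using htp_trans by fastforce
qed

lemma bar_bar [simp]: "bar (bar es) = es"
  by (simp add: rev_map comp_def)

text \<open>The same square read from another corner, with \<open>e1\<close> and \<open>f1\<close>
  reversed.\<close>

lemma htp_square_flip:
  assumes h: "htp x y [e1, e2] [f2, f1]"
  shows "htp (edge_target e1) (edge_target f2) [edge_inverse e1, f2] [e2, edge_inverse f1]"
proof -
  have k: "x \<in> WW" "kpath x [e1, e2] y" "kpath x [f2, f1] y" using htp_kpath[OF h] by auto
  have a: "arc e1" "arc e2" "arc f1" "arc f2" "edge_source e1 = x" "edge_source e2 = edge_target e1"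
    "edge_target e2 = y" "edge_source f2 = x" "edge_source f1 = edge_target f2" "edge_target f1 = y"
    using k by auto
  have W: "edge_target e1 \<in> WW" using kpath_words[of x "[e1]" "edge_target e1"] a k(1) by simp
  let ?X = "edge_target e1" and ?Y = "edge_target f2"
  have "htp ?X ?Y ([edge_inverse e1] @ [e1, e2] @ [edge_inverse f1])
      ([edge_inverse e1] @ [f2, f1] @ [edge_inverse f1])"
    by (rule htp_congr[OF h W]) (use a arc_inverse in auto)
  then have 1: "htp ?X ?Y [edge_inverse e1, e1, e2, edge_inverse f1] [edge_inverse e1, f2, f1, edge_inverse f1]"
    by simp
  have "htp ?X ?Y ([] @ [edge_inverse e1, edge_inverse (edge_inverse e1)] @ [e2, edge_inverse f1])
      ([] @ [e2, edge_inverse f1])"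
    by (rule htp_backtrack[OF W]) (use a arc_inverse in auto)
  then have 2: "htp ?X ?Y [edge_inverse e1, e1, e2, edge_inverse f1] [e2, edge_inverse f1]" by simp
  have "htp ?X ?Y ([edge_inverse e1, f2] @ [f1, edge_inverse f1] @ []) ([edge_inverse e1, f2] @ [])"
    by (rule htp_backtrack[OF W]) (use a arc_inverse in auto)
  then have 3: "htp ?X ?Y [edge_inverse e1, f2, f1, edge_inverse f1] [edge_inverse e1, f2]" by simp
  show ?thesis by (rule htp_trans[OF htp_sym[OF 3] htp_trans[OF htp_sym[OF 1] 2]])
qed

text \<open>The 2-cells of the complex are given for relations in the direction in which they belong
  to \<open>R\<close>. The squares for the inverse directions arise from these by
  \<open>htp_square_flip\<close>.\<close>

definition square :: "'a list \<Rightarrow> 'a list \<Rightarrow> 'a list \<Rightarrow> 'a list \<Rightarrow> 'a list \<Rightarrow> 'a list \<Rightarrow> 'a list \<Rightarrow> bool" where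
  "square p l1 r1 z l2 r2 q \<longleftrightarrow> htp (p @ l1 @ z @ l2 @ q) (p @ r1 @ z @ r2 @ q)
     [Edge p l1 r1 (z @ l2 @ q), Edge (p @ r1 @ z) l2 r2 q]
     [Edge (p @ l1 @ z) l2 r2 q, Edge p l1 r1 (z @ r2 @ q)]"

lemma square_flip1: "square p l1 r1 z l2 r2 q \<Longrightarrow> square p r1 l1 z l2 r2 q"
  unfolding square_def by (drule htp_square_flip) simp

lemma square_flip2: "square p l1 r1 z l2 r2 q \<Longrightarrow> square p l1 r1 z r2 l2 q"
  unfolding square_def by (drule htp_sym, drule htp_square_flip, drule htp_sym) simp

lemma square_R:
  assumes W: "p \<in> lists \<Sigma>" "z \<in> lists \<Sigma>" "q \<in> lists \<Sigma>" and R: "(l1, r1) \<in> R" "(l2, r2) \<in> R"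
  shows "square p l1 r1 z l2 r2 q"
proof -
  have RR: "(l1, r1) \<in> RR" "(l2, r2) \<in> RR" using R by (auto simp: RR_def)
  have L: "l1 \<in> lists \<Sigma>" "r1 \<in> lists \<Sigma>" "l2 \<in> lists \<Sigma>" "r2 \<in> lists \<Sigma>" "l1 \<noteq> []"
    using RR_words RR by (auto simp: nonempty_words_def)
  let ?x = "p @ l1 @ z @ l2 @ q" and ?y = "p @ r1 @ z @ r2 @ q"
  let ?e1 = "Edge p l1 r1 (z @ l2 @ q)" and ?e2 = "Edge (p @ r1 @ z) l2 r2 q"
    and ?f2 = "Edge (p @ l1 @ z) l2 r2 q" and ?f1 = "Edge p l1 r1 (z @ r2 @ q)"
  have x: "?x \<in> WW" using W L by (auto simp: nonempty_words_def)
  have ke: "kpath ?x [?e1, ?e2] ?y" and kf: "kpath ?x [?f2, ?f1] ?y"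
    using W L RR by (simp_all add: arc_Edge)
  let ?c = "[?e1, ?e2, edge_inverse ?f1, edge_inverse ?f2]"
  have c: "?c \<in> squier_cells \<Sigma> R" unfolding squier_cells_def using W R by blast
  have kb: "kpath ?y (bar [?f2, ?f1]) ?x" by (rule kpath_reverse[OF kf])
  have "kpath ?x ([?e1, ?e2] @ bar [?f2, ?f1] @ [?f2, ?f1]) ?y"
    using ke kb kf unfolding kpath_append by blast
  then have kc: "kpath ?x ([] @ ?c @ [?f2, ?f1]) ?y" by simp
  have 1: "htp ?x ?y ([] @ ?c @ [?f2, ?f1]) ([] @ [?f2, ?f1])" by (rule htp_cell[OF c x kc])
  have y: "?y \<in> WW" by (rule kpath_words[OF ke x])
  have "htp ?y ?y (bar [?f2, ?f1] @ bar (bar [?f2, ?f1])) []" by (rule htp_bar[OF kb y])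
  then have "htp ?y ?y (bar [?f2, ?f1] @ [?f2, ?f1]) []" by (simp only: bar_bar)
  moreover have "kpath ?y [] ?y" by simp
  ultimately have 2: "htp ?x ?y ([?e1, ?e2] @ (bar [?f2, ?f1] @ [?f2, ?f1]) @ []) ([?e1, ?e2] @ [] @ [])"
    using htp_congr[OF _ x ke] by blast
  have 1: "htp ?x ?y (?c @ [?f2, ?f1]) [?f2, ?f1]" using 1 by simp
  have 2: "htp ?x ?y (?c @ [?f2, ?f1]) [?e1, ?e2]" using 2 by simp
  show ?thesis unfolding square_def by (rule htp_trans[OF htp_sym[OF 2] 1])
qed

lemma square:
  assumes W: "p \<in> lists \<Sigma>" "z \<in> lists \<Sigma>" "q \<in> lists \<Sigma>" and "(l1, r1) \<in> RR" "(l2, r2) \<in> RR"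
  shows "square p l1 r1 z l2 r2 q"
proof -
  have "(l1, r1) \<in> R \<or> (r1, l1) \<in> R" "(l2, r2) \<in> R \<or> (r2, l2) \<in> R" using assms by (auto simp: RR_def)
  then show ?thesis using square_R[OF W] square_flip1 square_flip2 by meson
qed

text \<open>The paths whose lifts from \<open>root\<close> glue a new cell at each step and never go
  back. They serve as normal forms.\<close>

inductive ascent :: "'a edge list \<Rightarrow> 'a tedge list \<Rightarrow> bool" where
  ascent_root: "ascent [] root"
| ascent_step: "ascent es (q1 @ c @ q2) \<Longrightarrow> (u, v) \<in> RR \<Longrightarrow> map lab c = u \<Longrightarrow> \<nexists>c0. c = block c0 v u \<Longrightarrow>
    ascent (es @ [Edge (map lab q1) u v (map lab q2)]) (q1 @ block c u v @ q2)"

lemma ascent_props: "ascent es r \<Longrightarrow> state r \<and> kpath w es (map lab r) \<and> run root es = r"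
proof (induction rule: ascent.induct)
  case ascent_root
  then show ?case using state_root lab_root by simp
next
  case (ascent_step es q1 c q2 u v)
  let ?e = "Edge (map lab q1) u v (map lab q2)"
  have r: "state (q1 @ c @ q2)" using ascent_step.IH by blast
  have "map lab (q1 @ c @ q2) \<in> lists \<Sigma>" using vpath_lab_in[OF r] .
  then have e: "arc ?e" "edge_source ?e = map lab (q1 @ c @ q2)"
    using ascent_step.hyps by (auto simp: arc_Edge)
  have "step (q1 @ c @ q2) ?e = q1 @ opp c u v @ q2" by (rule step_eq) (use ascent_step.hyps in auto)
  then have st: "step (q1 @ c @ q2) ?e = q1 @ block c u v @ q2" using opp_new[OF ascent_step.hyps(4)] by simp
  have "kpath w (es @ [?e]) (edge_target ?e)" using ascent_step.IH e by (simp add: kpath_append)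
  moreover have "run root (es @ [?e]) = q1 @ block c u v @ q2"
    using ascent_step.IH st by simp
  ultimately show ?case using step(1,2)[OF r e] st by (simp add: map_lab_block)
qed

lemma ascent_exists: "state r \<Longrightarrow> \<exists>es. ascent es r"
proof (induction rule: state_induct)
  case root
  then show ?case using ascent_root by blast
next
  case (expand q1 c u v q2)
  then obtain es where "ascent es (q1 @ c @ q2)" by blast
  from ascent_step[OF this expand.hyps(3,4,5)] show ?case by blast
qed

text \<open>Both new sides lie on the final state, so both cells can be collapsed. An ascent
  \<open>gs\<close> to the state below, prolonged along the two halves of a commuting square, is
  compared with \<open>es\<close> and \<open>fs\<close>.\<close>

lemma ascent_diamond:
  assumes r: "ascent es (q1 @ c @ d @ block c' u' v' @ q2)" "(u, v) \<in> RR" "map lab c = u" "\<nexists>c0. c = block c0 v u"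
    and r': "ascent fs (q1 @ block c u v @ d @ c' @ q2)" "(u', v') \<in> RR" "map lab c' = u'" "\<nexists>c0. c' = block c0 v' u'"
    and IH: "\<And>gs. ascent gs (q1 @ c @ d @ block c' u' v' @ q2) \<Longrightarrow> htp w (map lab (q1 @ c @ d @ block c' u' v' @ q2)) es gs"
      "\<And>gs. ascent gs (q1 @ block c u v @ d @ c' @ q2) \<Longrightarrow> htp w (map lab (q1 @ block c u v @ d @ c' @ q2)) fs gs"
  shows "htp w (map lab (q1 @ block c u v @ d @ block c' u' v' @ q2))
    (es @ [Edge (map lab q1) u v (map lab (d @ block c' u' v' @ q2))])
    (fs @ [Edge (map lab (q1 @ block c u v @ d)) u' v' (map lab q2)])"
proof -
  have ne: "v \<noteq> []" "v' \<noteq> []" using RR_nonempty r(2) r'(2) by auto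
  have "state ((q1 @ c @ d) @ block c' u' v' @ q2)" using ascent_props[OF r(1)] by simp
  from collapse(1)[OF this ne(2)] have st: "state (q1 @ c @ d @ c' @ q2)" by simp
  then obtain gs where gs: "ascent gs (q1 @ c @ d @ c' @ q2)" using ascent_exists by blast
  let ?p = "map lab q1" and ?z = "map lab d" and ?q = "map lab q2"
  let ?G = "Edge ?p u v (?z @ u' @ ?q)" and ?F = "Edge (?p @ v @ ?z) u' v' ?q"
    and ?G' = "Edge (?p @ u @ ?z) u' v' ?q" and ?E = "Edge ?p u v (?z @ v' @ ?q)"
  have "ascent gs ((q1 @ c @ d) @ c' @ q2)" using gs by simp
  from ascent_step[OF this r'(2-4)] have "ascent (gs @ [?G']) (q1 @ c @ d @ block c' u' v' @ q2)"
    using r(3) by simp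
  note 1 = IH(1)[OF this]
  from ascent_step[OF gs r(2-4)] have "ascent (gs @ [?G]) (q1 @ block c u v @ d @ c' @ q2)"
    using r'(3) by simp
  note 2 = IH(2)[OF this]
  have lists: "?p \<in> lists \<Sigma>" "?z \<in> lists \<Sigma>" "?q \<in> lists \<Sigma>" using vpath_lab_in[OF st] by auto
  note sq = square[OF lists r(2) r'(2)]
  let ?x = "?p @ u @ ?z @ u' @ ?q" and ?y = "?p @ v @ ?z @ v' @ ?q"
  have h: "htp ?x ?y [?G, ?F] [?G', ?E]" using sq unfolding square_def .
  have k: "kpath ?x [?G, ?F] ?y" "kpath ?x [?G', ?E] ?y" using htp_kpath[OF h] by auto
  have kg: "kpath w gs ?x" using ascent_props[OF gs] r(3) r'(3) by simp
  have l: "map lab (q1 @ c @ d @ block c' u' v' @ q2) = ?p @ u @ ?z @ v' @ ?q"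
    "map lab (q1 @ block c u v @ d @ c' @ q2) = ?p @ v @ ?z @ u' @ ?q"
    "map lab (q1 @ block c u v @ d @ block c' u' v' @ q2) = ?y"
    using r(3) r'(3) by (simp_all add: map_lab_block)
  have w0: "kpath w [] w" by simp
  have "htp w ?y ([] @ es @ [?E]) ([] @ (gs @ [?G']) @ [?E])"
    by (rule htp_congr[OF 1[unfolded l(1)] word w0]) (use k(2) in simp)
  then have a: "htp w ?y (es @ [?E]) (gs @ [?G', ?E])" by simp
  have "htp w ?y ([] @ fs @ [?F]) ([] @ (gs @ [?G]) @ [?F])"
    by (rule htp_congr[OF 2[unfolded l(2)] word w0]) (use k(1) in simp)
  then have b: "htp w ?y (fs @ [?F]) (gs @ [?G, ?F])" by simp
  have "htp w ?y (gs @ [?G, ?F] @ []) (gs @ [?G', ?E] @ [])"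
    by (rule htp_congr[OF h word kg]) simp
  then have "htp w ?y (gs @ [?G, ?F]) (gs @ [?G', ?E])" by simp
  from htp_trans[OF a htp_trans[OF htp_sym[OF this] htp_sym[OF b]]]
  have "htp w ?y (es @ [?E]) (fs @ [?F])" .
  then show ?thesis using l by (simp add: map_lab_block)
qed

lemma root_no_block: "v \<noteq> [] \<Longrightarrow> root \<noteq> q1 @ block c u v @ q2"
proof
  assume v: "v \<noteq> []" and eq: "root = q1 @ block c u v @ q2"
  have "Child c u v 0 \<in> set (q1 @ block c u v @ q2)" using v by (auto simp: set_block)
  then have "Child c u v 0 \<in> set root" using eq by metis
  then show False by (auto simp: root_def root_path_def)
qed

text \<open>The cells glued last by the two ascents are equal or have disjoint new sides, by
  \<open>block_overlap_left\<close>. In the first case the induction hypothesis suffices, in the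
  second it enters through \<open>ascent_diamond\<close>.\<close>

lemma ascent_unique: "ascent es r \<Longrightarrow> ascent fs r \<Longrightarrow> htp w (map lab r) es fs"
proof (induction "total r" arbitrary: r es fs rule: less_induct)
  case less
  from less.prems(1) show ?case
  proof cases
    case ascent_root
    from less.prems(2) show ?thesis
    proof cases
      case ascent_root
      then show ?thesis using \<open>es = []\<close> htp_refl[OF word, of "[]" w] lab_root by simp
    next
      case (ascent_step fs' p1 c p2 u v)
      then show ?thesis using root_no_block[of v p1 c u p2] RR_nonempty[of u v] \<open>r = root\<close> by auto
    qed
  next
    case es: (ascent_step es' q1 c q2 u v)
    have v: "v \<noteq> []" using RR_nonempty[OF es(4)] by simp
    from less.prems(2) show ?thesis
    proof cases
      case ascent_root
      then show ?thesis using root_no_block[OF v] es(2) by metis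
    next
      case fs: (ascent_step fs' q1' c' q2' u' v')
      have v': "v' \<noteq> []" using RR_nonempty[OF fs(4)] by simp
      have eq: "q1 @ block c u v @ q2 = q1' @ block c' u' v' @ q2'" using es(2) fs(2) by simp
      have t: "total (q1 @ c @ q2) < total r" "total (q1' @ c' @ q2') < total r"
        using total_block[OF v, of c u] total_block[OF v', of c' u'] es(2) by simp
          (use total_block[OF v', of c' u'] fs(2) in simp)
      note IH = less.hyps[OF t(1) es(3)] less.hyps[OF t(2) fs(3)]
      consider "q1 = q1' \<and> c = c' \<and> u = u' \<and> v = v' \<and> q2 = q2'"
        | d where "q1' = q1 @ block c u v @ d" "q2 = d @ block c' u' v' @ q2'"
        | d where "q1 = q1' @ block c' u' v' @ d" "q2' = d @ block c u v @ q2"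
        using block_overlap_left[OF eq v v'] block_overlap_left[OF HOL.sym[OF eq] v' v] by fastforce
      then show ?thesis
      proof cases
        case 1
        let ?e = "Edge (map lab q1) u v (map lab q2)"
        have "ascent fs' (q1 @ c @ q2)" using 1 fs(3) by simp
        then have h: "htp w (map lab (q1 @ c @ q2)) es' fs'" by (rule IH(1))
        have k: "kpath w (es' @ [?e]) (map lab r)" using ascent_props[OF less.prems(1)] es(1) by simp
        then have "kpath (map lab (q1 @ c @ q2)) [?e] (map lab r)" using es(5) by (auto simp: kpath_append)
        moreover have "kpath w [] w" by simp
        ultimately have "htp w (map lab r) ([] @ es' @ [?e]) ([] @ fs' @ [?e])"
          using htp_congr[OF h word] by blast
        then show ?thesis using es(1) fs(1) 1 by simp
      next
        case (2 d)
        have a: "ascent es' (q1 @ c @ d @ block c' u' v' @ q2')" using es(3) 2 by simp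
        have b: "ascent fs' (q1 @ block c u v @ d @ c' @ q2')" using fs(3) 2 by simp
        have "htp w (map lab (q1 @ block c u v @ d @ block c' u' v' @ q2'))
          (es' @ [Edge (map lab q1) u v (map lab (d @ block c' u' v' @ q2'))])
          (fs' @ [Edge (map lab (q1 @ block c u v @ d)) u' v' (map lab q2')])"
          by (rule ascent_diamond[OF a es(4-6) b fs(4-6)]) (use IH 2 in simp_all)
        then show ?thesis using es(1,2) fs(1) 2 by simp
      next
        case (3 d)
        have a: "ascent fs' (q1' @ c' @ d @ block c u v @ q2)" using fs(3) 3 by simp
        have b: "ascent es' (q1' @ block c' u' v' @ d @ c @ q2)" using es(3) 3 by simp
        have "htp w (map lab (q1' @ block c' u' v' @ d @ block c u v @ q2))
          (fs' @ [Edge (map lab q1') u' v' (map lab (d @ block c u v @ q2))])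
          (es' @ [Edge (map lab (q1' @ block c' u' v' @ d)) u v (map lab q2)])"
          by (rule ascent_diamond[OF a fs(4-6) b es(4-6)]) (use IH 3 in simp_all)
        from htp_sym[OF this] show ?thesis using es(1) fs(1,2) 3 by simp
      qed
    qed
  qed
qed

text \<open>The case to be treated is a last step that goes back across a cell. By
  \<open>ascent_unique\<close> the ascent obtained so far can be replaced by one that ends with the
  inverse of this step, and the two cancel.\<close>

lemma htp_ascent: "kpath w es y \<Longrightarrow> \<exists>fs. ascent fs (run root es) \<and> htp w y es fs"
proof (induction es arbitrary: y rule: rev_induct)
  case Nil
  then show ?case using ascent_root htp_refl[OF word, of "[]" w] by auto
next
  case (snoc e es)
  have e: "arc e" "kpath w es (edge_source e)" "y = edge_target e" using snoc.prems by (auto simp: kpath_append)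
  then obtain fs where fs: "ascent fs (run root es)" "htp w (edge_source e) es fs" using snoc.IH by blast
  let ?r = "run root es"
  have r: "state ?r" "map lab ?r = edge_source e" using run[of root es "edge_source e"] state_root lab_root e(2) by auto
  obtain p u v q where E: "e = Edge p u v q" by (cases e)
  have uv: "(u, v) \<in> RR" using e E by (simp add: arc_Edge)
  have "map lab ?r = p @ u @ q" using r E by simp
  then obtain r1 c r2 where r': "?r = r1 @ c @ r2" "map lab r1 = p" "map lab c = u" "map lab r2 = q"
    by (rule map_eq_append3)
  obtain x z where xz: "vpath x c z" using r(1) unfolding r'(1) by (auto simp: vpath_append)
  have st: "run root (es @ [e]) = r1 @ opp c u v @ r2"
    using step_eq[OF r'(2,3), of r2 v q] r'(1) E by simp
  have w0: "kpath w [] w" by simp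
  have ke: "kpath (edge_source e) [e] y" using e by simp
  have c1: "htp w y ([] @ es @ [e]) ([] @ fs @ [e])" by (rule htp_congr[OF fs(2) word w0 ke])
  from opp_cases[OF xz r'(3) uv] show ?case
  proof
    assume *: "opp c u v = block c u v \<and> (\<nexists>c0. c = block c0 v u)"
    then have "ascent (fs @ [Edge (map lab r1) u v (map lab r2)]) (r1 @ block c u v @ r2)"
      using ascent_step[of fs r1 c r2 u v] fs(1) r' uv by simp
    then have "ascent (fs @ [e]) (run root (es @ [e]))" using st * r' E by simp
    then show ?thesis using c1 by auto
  next
    assume *: "c = block (opp c u v) v u \<and> (\<nexists>c0. opp c u v = block c0 u v)"
    let ?o = "opp c u v"
    have "state (r1 @ ?o @ r2)" using st step(1)[OF r(1) e(1)] r(2) by simp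
    then obtain gs where gs: "ascent gs (r1 @ ?o @ r2)" using ascent_exists by blast
    have lo: "map lab ?o = v" by (rule opp_lab[OF xz r'(3) uv])
    have "ascent (gs @ [Edge (map lab r1) v u (map lab r2)]) (r1 @ block ?o v u @ r2)"
      by (rule ascent_step[OF gs RR_sym[OF uv] lo]) (use * in blast)
    then have "ascent (gs @ [edge_inverse e]) ?r" using * r' E by simp
    from ascent_unique[OF fs(1) this] have "htp w (edge_source e) fs (gs @ [edge_inverse e])" using r(2) by simp
    from htp_congr[OF this word w0 ke]
    have c2: "htp w y ([] @ fs @ [e]) ([] @ (gs @ [edge_inverse e]) @ [e])" .
    have "kpath w (gs @ [edge_inverse e, edge_inverse (edge_inverse e)] @ []) y" using htp_kpath[OF c2] by simp
    from htp_backtrack[OF word this] have c3: "htp w y (gs @ [edge_inverse e, e] @ []) (gs @ [])" by simp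
    have 1: "htp w y (es @ [e]) (fs @ [e])" using c1 by simp
    have 2: "htp w y (fs @ [e]) (gs @ [edge_inverse e, e])" using c2 by simp
    have 3: "htp w y (gs @ [edge_inverse e, e]) gs" using c3 by simp
    have "htp w y (es @ [e]) gs" by (rule htp_trans[OF 1 htp_trans[OF 2 3]])
    then show ?thesis using gs st by auto
  qed
qed

text \<open>Thus the states are the vertices of the universal cover of the component of
  \<open>w\<close> in the Squier complex.\<close>

lemma htp_iff_run:
  assumes "kpath w p y" "kpath w q y"
  shows "htp w y p q \<longleftrightarrow> run root p = run root q"
proof
  assume "htp w y p q"
  then show "run root p = run root q" using htp_run[OF _ lab_root state_root] by blast
next
  assume eq: "run root p = run root q"
  obtain fs where fs: "ascent fs (run root p)" "htp w y p fs" using htp_ascent[OF assms(1)] by blast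
  obtain gs where gs: "ascent gs (run root q)" "htp w y q gs" using htp_ascent[OF assms(2)] by blast
  have "map lab (run root p) = y" using run[of root p y] state_root lab_root assms by auto
  then have "htp w y fs gs" using ascent_unique[OF fs(1)] gs(1) eq by auto
  then show "htp w y p q" using fs(2) gs(2) htp_sym htp_trans by meson
qed


subsection \<open>The action of the diagram group\<close>

abbreviation DG :: "'a edge list set monoid" where
  "DG \<equiv> diagram_group \<Sigma> R w"

definition cls :: "'a edge list \<Rightarrow> 'a edge list set" where
  "cls p = {q. htp w w p q}"

lemma homotopy_rel_cls: "homotopy_rel (squier_graph \<Sigma> R) edge_inverse (squier_cells \<Sigma> R) w `` {p} = cls p"
  by (auto simp: homotopy_rel_def cls_def)

lemma carrier_DG: "carrier DG = cls ` {p. kpath w p w}"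
  using word by (auto simp: diagram_group_def fundamental_group_def quotient_def homotopy_rel_cls awalk_kpath)

lemma mult_DG_eq: "P \<otimes>\<^bsub>DG\<^esub> Q = (\<Union>p\<in>P. \<Union>q\<in>Q. cls (p @ q))"
  by (simp add: diagram_group_def fundamental_group_def homotopy_rel_cls)

lemma one_DG: "\<one>\<^bsub>DG\<^esub> = cls []"
  by (simp add: diagram_group_def fundamental_group_def homotopy_rel_cls)

lemma kpath_loop_append: "kpath w p w \<Longrightarrow> kpath w q w \<Longrightarrow> kpath w (p @ q) w"
  by (auto simp: kpath_append)

lemma cls_eqI: "htp w w p q \<Longrightarrow> cls p = cls q"
  unfolding cls_def by (rule Collect_cong) (meson htp_sym htp_trans)

lemma cls_eq_iff:
  assumes "kpath w p w" "kpath w q w"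
  shows "cls p = cls q \<longleftrightarrow> run root p = run root q"
proof
  assume eq: "cls p = cls q"
  have "q \<in> cls q" unfolding cls_def using htp_refl[OF word assms(2)] by simp
  then have "q \<in> cls p" unfolding eq .
  then have "htp w w p q" by (simp add: cls_def)
  then show "run root p = run root q" using htp_iff_run[OF assms] by simp
next
  assume "run root p = run root q"
  then show "cls p = cls q" using htp_iff_run[OF assms] cls_eqI by simp
qed

lemma run_loop:
  assumes "kpath w p w"
  shows "state (run root p)" "map lab (run root p) = w"
  using run[of root p w origin terminus] assms state_root lab_root by auto

lemma mult_DG:
  assumes p: "kpath w p w" and q: "kpath w q w"
  shows "cls p \<otimes>\<^bsub>DG\<^esub> cls q = cls (p @ q)"
proof -
  have eq: "cls (p' @ q') = cls (p @ q)" if "p' \<in> cls p" "q' \<in> cls q" for p' q'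
  proof -
    have h: "htp w w p p'" "htp w w q q'" using that by (auto simp: cls_def)
    then have k: "kpath w p' w" "kpath w q' w" using htp_kpath by blast+
    have "run root p' = run root p" using htp_iff_run[OF p k(1)] h(1) by simp
    moreover have "run (run root p) q = run (run root p) q'"
      using htp_run[OF h(2)] run_loop[OF p] by blast
    ultimately have "run root (p' @ q') = run root (p @ q)" by simp
    then show ?thesis using cls_eq_iff kpath_loop_append p q k by blast
  qed
  moreover have "p \<in> cls p" "q \<in> cls q" unfolding cls_def using htp_refl[OF word] p q by auto
  ultimately show ?thesis unfolding mult_DG_eq by blast
qed

lemma group_DG: "group DG"
proof (rule groupI)
  show "x \<otimes>\<^bsub>DG\<^esub> y \<in> carrier DG" if "x \<in> carrier DG" "y \<in> carrier DG" for x y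
    using that kpath_loop_append by (auto simp: carrier_DG mult_DG)
  show "\<one>\<^bsub>DG\<^esub> \<in> carrier DG" by (auto simp: carrier_DG one_DG)
  show "x \<otimes>\<^bsub>DG\<^esub> y \<otimes>\<^bsub>DG\<^esub> z = x \<otimes>\<^bsub>DG\<^esub> (y \<otimes>\<^bsub>DG\<^esub> z)"
    if "x \<in> carrier DG" "y \<in> carrier DG" "z \<in> carrier DG" for x y z
    using that kpath_loop_append by (auto simp: carrier_DG mult_DG)
  show "\<one>\<^bsub>DG\<^esub> \<otimes>\<^bsub>DG\<^esub> x = x" if x: "x \<in> carrier DG" for x
  proof -
    obtain p where "kpath w p w" "x = cls p" using x unfolding carrier_DG by blast
    moreover have "kpath w [] w" by simp
    ultimately show ?thesis using mult_DG[of "[]" p] by (simp add: one_DG)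
  qed
  show "\<exists>y\<in>carrier DG. y \<otimes>\<^bsub>DG\<^esub> x = \<one>\<^bsub>DG\<^esub>" if x: "x \<in> carrier DG" for x
  proof -
    obtain p where p: "kpath w p w" "x = cls p" using x unfolding carrier_DG by blast
    have b: "kpath w (bar p) w" by (rule kpath_reverse[OF p(1)])
    have "htp w w (bar p @ bar (bar p)) []" by (rule htp_bar[OF b word])
    then have "cls (bar p @ p) = cls []" unfolding bar_bar by (rule cls_eqI)
    then have "cls (bar p) \<otimes>\<^bsub>DG\<^esub> x = \<one>\<^bsub>DG\<^esub>" using mult_DG[OF b p(1)] p(2) one_DG by simp
    moreover have "cls (bar p) \<in> carrier DG" using b carrier_DG by auto
    ultimately show ?thesis by blast
  qed
qed

lemma trivial_DG_iff: "trivial_group DG \<longleftrightarrow> (\<forall>p. kpath w p w \<longrightarrow> run root p = root)"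
proof -
  have k: "kpath w [] w" by simp
  have "trivial_group DG \<longleftrightarrow> carrier DG = {\<one>\<^bsub>DG\<^esub>}"
    using group_DG by (simp only: trivial_group_def simp_thms)
  also have "\<dots> \<longleftrightarrow> (\<forall>p. kpath w p w \<longrightarrow> cls p = cls [])"
    unfolding carrier_DG one_DG using k by blast
  also have "\<dots> \<longleftrightarrow> (\<forall>p. kpath w p w \<longrightarrow> run root p = root)"
    using cls_eq_iff[OF _ k] unfolding run_simps by blast
  finally show ?thesis .
qed

text \<open>The end of the lift of any representative; by \<open>htp_run\<close> the choice has no
  influence.\<close>

definition stt :: "'a edge list set \<Rightarrow> 'a tedge list" where
  "stt P = run root (SOME p. p \<in> P)"

lemma stt_cls: "kpath w p w \<Longrightarrow> stt (cls p) = run root p"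
proof -
  assume p: "kpath w p w"
  have "p \<in> cls p" unfolding cls_def using htp_refl[OF word p] by simp
  then have "(SOME q. q \<in> cls p) \<in> cls p" by (rule someI)
  then have h: "htp w w p (SOME q. q \<in> cls p)" by (simp add: cls_def)
  then show ?thesis unfolding stt_def using htp_run[OF h lab_root state_root] by simp
qed

lemma stt_gstate: "P \<in> carrier DG \<Longrightarrow> gstate (stt P)"
  unfolding carrier_DG gstate_def using stt_cls run_loop by auto

lemma stt_inj: "P \<in> carrier DG \<Longrightarrow> Q \<in> carrier DG \<Longrightarrow> stt P = stt Q \<Longrightarrow> P = Q"
proof -
  assume "P \<in> carrier DG" "Q \<in> carrier DG" and eq: "stt P = stt Q"
  then obtain p q where p: "kpath w p w" "P = cls p" and q: "kpath w q w" "Q = cls q"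
    unfolding carrier_DG by blast
  then have "run root p = run root q" using eq stt_cls by simp
  then show ?thesis using cls_eq_iff[OF p(1) q(1)] p(2) q(2) by simp
qed

lemma state_kpath: "state r \<Longrightarrow> \<exists>es. kpath w es (map lab r) \<and> run root es = r"
  using mv_rtranclp_kpath[OF vpath_connected[OF state_root] state_root, of r] lab_root by simp

lemma stt_surj: "gstate r \<Longrightarrow> \<exists>P\<in>carrier DG. stt P = r"
proof -
  assume r: "gstate r"
  then obtain es where "kpath w es w" "run root es = r" using state_kpath[of r] by (auto simp: gstate_def)
  then show ?thesis using stt_cls[of es] carrier_DG by auto
qed

lemma map_act_root: "gstate p \<Longrightarrow> map (act p) root = p"
proof -
  assume "gstate p"
  then have "length p = length w" by (auto simp: gstate_def)
  then show ?thesis by (intro nth_equalityI) (simp_all add: root_def root_path_def)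
qed

text \<open>The action commutes with lifting, so the lift of \<open>q\<close> from
  \<open>stt P\<close> is the translate of its lift from \<open>root\<close>.\<close>

lemma stt_mult:
  assumes P: "P \<in> carrier DG" and Q: "Q \<in> carrier DG"
  shows "stt (P \<otimes>\<^bsub>DG\<^esub> Q) = map (act (stt P)) (stt Q)"
proof -
  obtain p q where p: "kpath w p w" "P = cls p" and q: "kpath w q w" "Q = cls q"
    using P Q unfolding carrier_DG by blast
  have sp: "gstate (run root p)" using stt_gstate[OF P] stt_cls[OF p(1)] p(2) by simp
  have "map (act (run root p)) (run root q) = run (map (act (run root p)) root) q"
    by (rule act_run[OF sp state_root, of q w]) (simp add: lab_root q)
  then show ?thesis unfolding p(2) q(2) mult_DG[OF p(1) q(1)] stt_cls[OF p(1)] stt_cls[OF q(1)]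
    using stt_cls[OF kpath_loop_append[OF p(1) q(1)]] map_act_root[OF sp] by simp
qed

lemma stt_one: "stt \<one>\<^bsub>DG\<^esub> = root"
  unfolding one_DG using stt_cls[of "[]"] by simp

definition ap :: "'a edge list set \<Rightarrow> 'a tedge \<Rightarrow> 'a tedge" where
  "ap P = act (stt P)"

definition apV :: "'a edge list set \<Rightarrow> 'a vert \<Rightarrow> 'a vert" where
  "apV P = actV (stt P)"

lemma ap:
  assumes "P \<in> carrier DG" "valid e"
  shows ap_valid: "valid (ap P e)" and ap_lab: "lab (ap P e) = lab e"
    and ap_src: "src (ap P e) = apV P (src e)" and ap_tgt: "tgt (ap P e) = apV P (tgt e)"
  using act_valid[OF stt_gstate[OF assms(1)] assms(2)] by (auto simp: ap_def apV_def)

lemma ap_mult: "\<lbrakk>P \<in> carrier DG; Q \<in> carrier DG; valid e\<rbrakk> \<Longrightarrow> ap (P \<otimes>\<^bsub>DG\<^esub> Q) e = ap P (ap Q e)"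
  using act_comp[OF stt_gstate stt_gstate] by (simp add: ap_def stt_mult)

lemma ap_one: "valid e \<Longrightarrow> ap \<one>\<^bsub>DG\<^esub> e = e"
  by (simp add: ap_def stt_one act_root)

lemma ap_inv:
  assumes P: "P \<in> carrier DG" and e: "valid e"
  shows "ap (inv\<^bsub>DG\<^esub> P) (ap P e) = e" "ap P (ap (inv\<^bsub>DG\<^esub> P) e) = e"
proof -
  interpret group DG by (rule group_DG)
  show "ap (inv\<^bsub>DG\<^esub> P) (ap P e) = e"
    using ap_mult[OF inv_closed[OF P] P e] l_inv[OF P] ap_one[OF e] by simp
  show "ap P (ap (inv\<^bsub>DG\<^esub> P) e) = e"
    using ap_mult[OF P inv_closed[OF P] e] r_inv[OF P] ap_one[OF e] by simp
qed

lemma ap_vpath: "P \<in> carrier DG \<Longrightarrow> vpath s c t \<Longrightarrow> vpath (apV P s) (map (ap P) c) (apV P t)"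
  unfolding ap_def apV_def by (rule act_vpath[OF stt_gstate])

lemma ap_map_lab: "P \<in> carrier DG \<Longrightarrow> vpath s c t \<Longrightarrow> map lab (map (ap P) c) = map lab c"
  unfolding ap_def by (rule act_lab[OF stt_gstate])

lemma ap_opp: "P \<in> carrier DG \<Longrightarrow> vpath s c t \<Longrightarrow> map lab c = u \<Longrightarrow> (u, v) \<in> RR \<Longrightarrow>
    map (ap P) (opp c u v) = opp (map (ap P) c) u v"
  unfolding ap_def by (rule act_opp[OF stt_gstate])

lemma ap_mv_at: "P \<in> carrier DG \<Longrightarrow> vpath s r t \<Longrightarrow> mv_at x r r' \<Longrightarrow>
    mv_at (apV P x) (map (ap P) r) (map (ap P) r')"
  unfolding ap_def apV_def by (rule act_mv_at[OF stt_gstate])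

lemma apV_ends: "apV P origin = origin" "P \<in> carrier DG \<Longrightarrow> apV P terminus = terminus"
  unfolding apV_def using actV_origin actV_terminus[OF stt_gstate] by auto

lemma ap_state: "P \<in> carrier DG \<Longrightarrow> state r \<Longrightarrow> state (map (ap P) r)"
  unfolding ap_def by (rule act_state[OF stt_gstate])

section \<open>The action on vertices and states\<close>

definition Vt :: "'a vert \<Rightarrow> bool" where
  "Vt x \<longleftrightarrow> x = terminus \<or> (\<exists>e. valid e \<and> src e = x)"

lemma Vt_src: "valid e \<Longrightarrow> Vt (src e)"
  by (auto simp: Vt_def)

lemma state_vertex: "Vt x \<Longrightarrow> \<exists>r1 r2. vpath origin r1 x \<and> vpath x r2 terminus"
proof -
  assume x: "Vt x"
  show ?thesis
  proof (cases "x = terminus")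
    case True
    then show ?thesis using state_root by (intro exI[of _ root] exI[of _ "[]"]) simp
  next
    case False
    then obtain e where e: "valid e" "src e = x" using x by (auto simp: Vt_def)
    obtain a b where "vpath origin a (src e)" "vpath (tgt e) b terminus" using valid_extend[OF e(1)] by blast
    then show ?thesis using e by (intro exI[of _ a] exI[of _ "e # b"]) simp
  qed
qed

lemma vpath_Vt: "vpath s c t \<Longrightarrow> Vt t \<Longrightarrow> Vt s"
  by (cases c) (auto simp: Vt_def)

lemma Vt_tgt: "valid e \<Longrightarrow> Vt (tgt e)"
proof -
  assume "valid e"
  then obtain b where b: "vpath (tgt e) b terminus" using valid_extend by blast
  show ?thesis by (rule vpath_Vt[OF b]) (simp add: Vt_def)
qed

lemma vts_Vt: "state r \<Longrightarrow> x \<in> vts r \<Longrightarrow> Vt x"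
proof -
  assume r: "state r" and "x \<in> vts r"
  then consider "x = terminus" | e where "e \<in> set r" "x = src e" unfolding vts_def by blast
  then show ?thesis
  proof cases
    case 1
    then show ?thesis by (simp add: Vt_def)
  next
    case (2 e)
    then show ?thesis using Vt_src[OF vpath_valid[OF r, of e]] by simp
  qed
qed

lemma apV_mult:
  assumes "P \<in> carrier DG" "Q \<in> carrier DG" "Vt x"
  shows "apV (P \<otimes>\<^bsub>DG\<^esub> Q) x = apV P (apV Q x)"
proof -
  interpret group DG by (rule group_DG)
  show ?thesis
  proof (cases "x = terminus")
    case False
    then obtain e where e: "valid e" "src e = x" using assms(3) by (auto simp: Vt_def)
    show ?thesis
      using ap_src[OF m_closed[OF assms(1,2)] e(1)] ap_src[OF assms(2) e(1)]
        ap_src[OF assms(1) ap_valid[OF assms(2) e(1)]] ap_mult[OF assms(1,2) e(1)] e(2) by simp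
  qed (simp add: apV_ends assms)
qed

lemma apV_one: "Vt x \<Longrightarrow> apV \<one>\<^bsub>DG\<^esub> x = x"
proof -
  assume x: "Vt x"
  have one: "\<one>\<^bsub>DG\<^esub> \<in> carrier DG" using group_DG by (simp add: group.is_monoid monoid.one_closed)
  show ?thesis
  proof (cases "x = terminus")
    case False
    then obtain e where e: "valid e" "src e = x" using x by (auto simp: Vt_def)
    then show ?thesis using ap_src[OF one e(1)] ap_one[OF e(1)] by simp
  qed (simp add: apV_ends one)
qed

lemma apV_Vt: "P \<in> carrier DG \<Longrightarrow> Vt x \<Longrightarrow> Vt (apV P x)"
  unfolding Vt_def using apV_ends ap_src ap_valid by metis

lemma apV_inv:
  assumes P: "P \<in> carrier DG" and x: "Vt x"
  shows "apV (inv\<^bsub>DG\<^esub> P) (apV P x) = x" "apV P (apV (inv\<^bsub>DG\<^esub> P) x) = x"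
proof -
  interpret group DG by (rule group_DG)
  show "apV (inv\<^bsub>DG\<^esub> P) (apV P x) = x"
    using apV_mult[OF inv_closed[OF P] P x] l_inv[OF P] apV_one[OF x] by simp
  show "apV P (apV (inv\<^bsub>DG\<^esub> P) x) = x"
    using apV_mult[OF P inv_closed[OF P] x] r_inv[OF P] apV_one[OF x] by simp
qed

lemma ap_vts: "P \<in> carrier DG \<Longrightarrow> state r \<Longrightarrow> vts (map (ap P) r) = apV P ` vts r"
  unfolding vts_def using ap_src vpath_valid apV_ends by (force simp: image_iff)

lemma ap_run:
  assumes P: "P \<in> carrier DG" and es: "kpath w es y"
  shows "map (ap P) (run root es) = run (stt P) es"
  unfolding ap_def using act_run[OF stt_gstate[OF P] state_root, of es y] es map_act_root[OF stt_gstate[OF P]]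
  by (simp add: lab_root)

text \<open>An element is recovered from a single translate: a path that leads from
  \<open>root\<close> to \<open>r\<close> is run backwards from the image of
  \<open>r\<close>.\<close>

lemma faithful:
  assumes P: "P \<in> carrier DG" and Q: "Q \<in> carrier DG" and r: "state r" "map (ap P) r = map (ap Q) r"
  shows "P = Q"
proof -
  obtain es where es: "kpath w es (map lab r)" "run root es = r" using state_kpath[OF r(1)] by blast
  have "run (stt P) es = map (ap P) r" "run (stt Q) es = map (ap Q) r"
    using ap_run[OF P es(1)] ap_run[OF Q es(1)] unfolding es(2) by simp_all
  then have *: "run (stt P) es = run (stt Q) es" using r(2) by (simp only:)
  have "state (stt P)" "map lab (stt P) = w" "state (stt Q)" "map lab (stt Q) = w"
    using stt_gstate P Q by (auto simp: gstate_def)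
  then have "stt P = stt Q"
    using run_reverse[of "stt P" es] run_reverse[of "stt Q" es] es(1) * by metis
  then show ?thesis using stt_inj P Q by blast
qed

text \<open>Run backwards from \<open>r'\<close>, a path that leads from \<open>root\<close> to
  \<open>r\<close> ends in a state labelled \<open>w\<close>, which is the translate of
  \<open>root\<close> by the required element.\<close>

lemma transitive:
  assumes r: "state r" and r': "state r'" and lab: "map lab r = map lab r'"
  shows "\<exists>P\<in>carrier DG. map (ap P) r = r'"
proof -
  obtain es where es: "kpath w es (map lab r)" "run root es = r" using state_kpath[OF r] by blast
  have b: "kpath (map lab r') (bar es) w" using kpath_reverse[OF es(1)] lab by simp
  have "gstate (run r' (bar es))" using run[OF b r'] by (simp add: gstate_def)
  then obtain P where P: "P \<in> carrier DG" "stt P = run r' (bar es)" using stt_surj by blast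
  have "run (run r' (bar es)) (bar (bar es)) = r'" by (rule run_reverse[OF b r'])
  then have "run (stt P) es = r'" using P(2) bar_bar by metis
  then show ?thesis using P(1) ap_run[OF P(1) es(1)] es(2) by auto
qed

subsection \<open>The tree of edges at a vertex\<close>

definition EV :: "'a vert \<Rightarrow> 'a tedge set" where
  "EV x = {e. valid e \<and> src e = x}"

abbreviation ed :: "'a tedge \<Rightarrow> 'a tedge \<Rightarrow> nat" where
  "ed e f \<equiv> prefix_dist (chain e) (chain f)"

lemma chain_snoc:
  assumes "valid e" "chain e = cs @ [x]"
  shows "\<exists>c u v. e = Child c u v 0 \<and> x = (c, u, v) \<and> chain (hd c) = cs \<and> valid (hd c) \<and> src (hd c) = src e"
proof (cases e)
  case (Child c u v k)
  then have k: "k = 0" using assms by (auto split: if_splits)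
  have c: "c \<noteq> []" using valid_child_nonempty assms(1) Child by blast
  have "valid (Child c u v k)" using assms(1) Child by simp
  then obtain s t where "vpath s c t" unfolding valid_child by blast
  then have "valid (hd c)" using vpath_valid[of s c t "hd c"] c by simp
  then show ?thesis using assms(2) Child k c by (auto simp: hd_map)
qed (use assms in simp)

lemma chain_Nil:
  assumes "valid e" "valid f" "chain e = []" "chain f = []" "src e = src f"
  shows "e = f"
  using assms by (cases e; cases f) (auto simp: valid_root split: if_splits)

text \<open>An edge at \<open>x\<close> is determined by its chain: the last cell of the chain names
  the edge, and the empty chain belongs only to the edge born with \<open>x\<close>.\<close>

lemma tree_EV: "tree_metric (EV x) ed"
proof (rule tree_metric_prefix_dist)
  show "inj_on chain (EV x)"
  proof (rule inj_onI)
    fix e f assume e: "e \<in> EV x" "f \<in> EV x" "chain e = chain f"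
    show "e = f"
    proof (cases "chain e = []")
      case True
      then show ?thesis using chain_Nil e by (auto simp: EV_def)
    next
      case False
      then obtain cs y where cs: "chain e = cs @ [y]" by (metis append_butlast_last_id)
      then show ?thesis using chain_snoc[of e cs y] chain_snoc[of f cs y] e by (auto simp: EV_def)
    qed
  qed
  show "\<exists>f\<in>EV x. chain f = cs" if "e \<in> EV x" "chain e = cs @ [c]" for e c cs
    using chain_snoc[of e cs c] that by (auto simp: EV_def)
qed

text \<open>Neighbours in the tree at \<open>x\<close> are the first edges of the two sides of one
  cell. The action preserves this relation because it commutes with \<open>opp\<close>.\<close>

lemma adjacent_edges:
  assumes e: "e \<in> EV x" "f \<in> EV x" and d: "ed e f = 1"
  shows "\<exists>c t u v. vpath x c t \<and> map lab c = u \<and> (u, v) \<in> RR \<and> hd c = e \<and> hd (opp c u v) = f"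
proof -
  have main: "\<exists>c t u v. vpath x c t \<and> map lab c = u \<and> (u, v) \<in> RR \<and> hd c = e \<and> hd (opp c u v) = f
      \<and> hd (opp (opp c u v) v u) = e \<and> map lab (opp c u v) = v \<and> vpath x (opp c u v) t"
    if e: "e \<in> EV x" "f \<in> EV x" and y: "chain f = chain e @ [y]" for e f y
  proof -
    obtain c u v where f: "f = Child c u v 0" "chain (hd c) = chain e" "valid (hd c)" "src (hd c) = src f"
      using chain_snoc[of f "chain e" y] y e(2) by (auto simp: EV_def)
    have "hd c = e"
      using tree_metric.zero[OF tree_EV, of "hd c" x e] f e
        tree_metric.zero[OF tree_EV, of e x e] by (simp add: EV_def)
    have val: "valid (Child c u v 0)" using e(2) f(1) by (simp add: EV_def)
    then obtain s t where c: "vpath s c t" "map lab c = u" "(u, v) \<in> RR" "\<nexists>c0. c = block c0 v u"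
      unfolding valid_child by blast
    have o: "opp c u v = block c u v" using opp_new[OF c(4)] .
    have "v \<noteq> []" using RR_nonempty[OF c(3)] by simp
    then have "hd (opp c u v) = f" using o hd_block f(1) by metis
    moreover have "s = x" using opp_src(2)[OF c(1-3)] \<open>hd c = e\<close> e(1) by (simp add: EV_def)
    ultimately show ?thesis
      using c \<open>hd c = e\<close> opp_opp[OF c(1-3)] opp_lab[OF c(1-3)] opp_vpath[OF c(1-3)] by metis
  qed
  from prefix_dist_1[OF d] show ?thesis
  proof
    assume "\<exists>y. chain f = chain e @ [y]"
    then show ?thesis using main[OF e] by blast
  next
    assume "\<exists>y. chain e = chain f @ [y]"
    then obtain y where "chain e = chain f @ [y]" by blast
    from main[OF e(2,1) this] show ?thesis using RR_sym by blast
  qed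
qed

lemma opp_adjacent:
  assumes c: "vpath x c t" "map lab c = u" "(u, v) \<in> RR"
  shows "hd c \<in> EV x" "hd (opp c u v) \<in> EV x" "ed (hd c) (hd (opp c u v)) = 1"
proof -
  have ne: "c \<noteq> []" "opp c u v \<noteq> []" "u \<noteq> []" "v \<noteq> []"
    using opp_nonempty[OF c] RR_nonempty[OF c(3)] by auto
  show "hd c \<in> EV x" "hd (opp c u v) \<in> EV x"
    using opp_src[OF c] vpath_valid[OF c(1)] vpath_valid[OF opp_vpath[OF c]] ne by (auto simp: EV_def)
  from opp_cases[OF c] show "ed (hd c) (hd (opp c u v)) = 1"
  proof
    assume "opp c u v = block c u v \<and> (\<nexists>c0. c = block c0 v u)"
    then have "hd (opp c u v) = Child c u v 0" using hd_block[OF ne(4)] by simp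
    then have "chain (hd (opp c u v)) = chain (hd c) @ [(c, u, v)]" using ne by (simp add: hd_map)
    then show ?thesis by (simp add: prefix_dist_snoc)
  next
    let ?o = "opp c u v"
    assume "c = block ?o v u \<and> (\<nexists>c0. ?o = block c0 u v)"
    then have "hd c = Child ?o v u 0" using hd_block[OF ne(3)] by metis
    then have "chain (hd c) = chain (hd ?o) @ [(?o, v, u)]" using ne by (simp add: hd_map)
    then show ?thesis by (simp add: prefix_dist_snoc)
  qed
qed

lemma ap_EV: "P \<in> carrier DG \<Longrightarrow> e \<in> EV x \<Longrightarrow> ap P e \<in> EV (apV P x)"
  by (auto simp: EV_def ap_valid ap_src)

lemma ap_ed_le:
  assumes P: "P \<in> carrier DG" and e: "e \<in> EV x" "f \<in> EV x"
  shows "ed (ap P e) (ap P f) \<le> ed e f"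
  using e
proof (induction "ed e f" arbitrary: f)
  case 0
  interpret tree_metric "EV x" ed by (rule tree_EV)
  interpret T: tree_metric "EV (apV P x)" ed by (rule tree_EV)
  have "e = f" using zero[OF 0(2,3)] 0(1) by simp
  then show ?case using T.self[OF ap_EV[OF P 0(2)]] by simp
next
  case (Suc n)
  interpret tree_metric "EV x" ed by (rule tree_EV)
  interpret T: tree_metric "EV (apV P x)" ed by (rule tree_EV)
  obtain z where z: "z \<in> EV x" "ed e z = n" "ed z f = 1"
    using step[OF Suc.prems, of n] Suc.hyps(2) by auto
  obtain c t u v where c: "vpath x c t" "map lab c = u" "(u, v) \<in> RR" "hd c = z" "hd (opp c u v) = f"
    using adjacent_edges[OF z(1) Suc.prems(2) z(3)] by blast
  have c': "vpath (apV P x) (map (ap P) c) (apV P t)" "map lab (map (ap P) c) = u"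
    using ap_vpath[OF P c(1)] ap_map_lab[OF P c(1)] c(2) by auto
  have "hd (map (ap P) c) = ap P z" "hd (opp (map (ap P) c) u v) = ap P f"
    using ap_opp[OF P c(1-3)] opp_nonempty[OF c(1-3)] c(4,5) by (auto simp: hd_map simp flip: ap_opp[OF P c(1-3)])
  then have "ed (ap P z) (ap P f) = 1" using opp_adjacent(3)[OF c' c(3)] by simp
  moreover have "ed (ap P e) (ap P z) \<le> n" using Suc.hyps(1)[of z] z Suc.prems by simp
  moreover have "ed (ap P e) (ap P f) \<le> ed (ap P e) (ap P z) + ed (ap P z) (ap P f)"
    by (rule T.triangle) (use ap_EV[OF P] Suc.prems z in auto)
  ultimately show ?case using Suc.hyps(2) by linarith
qed

text \<open>Suppose that \<open>P\<close> interchanges the first edges of the two sides of a cell.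
  Of these edges, one is created from the other by the cell, and likewise by its image. If the
  created edges differ, each edge is heavier than the other. If they agree, this edge records both
  \<open>u\<close>, \<open>v\<close> and \<open>v\<close>, \<open>u\<close>, but
  \<open>u \<noteq> v\<close> as the presentation is antisymmetric.\<close>

lemma ap_isometry:
  assumes P: "P \<in> carrier DG" and x: "apV P x = x" "Vt x"
  shows "tree_metric.isometry (EV x) ed (ap P)"
proof -
  interpret group DG by (rule group_DG)
  interpret tree_metric "EV x" ed by (rule tree_EV)
  let ?Q = "inv\<^bsub>DG\<^esub> P"
  have Q: "?Q \<in> carrier DG" using P by simp
  have xQ: "apV ?Q x = x" using apV_inv(1)[OF P x(2)] x(1) by simp
  have PE: "ap P e \<in> EV x" and QE: "ap ?Q e \<in> EV x" if "e \<in> EV x" for e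
    using ap_EV[OF P that] ap_EV[OF Q that] x(1) xQ by auto
  have inv: "ap ?Q (ap P e) = e" "ap P (ap ?Q e) = e" if "e \<in> EV x" for e
    using ap_inv[OF P, of e] that by (auto simp: EV_def)
  have 1: "bij_betw (ap P) (EV x) (EV x)"
    by (rule bij_betw_byWitness[where f' = "ap ?Q"]) (use PE QE inv in auto)
  have 2: "ed (ap P e) (ap P f) = ed e f" if "e \<in> EV x" "f \<in> EV x" for e f
    using ap_ed_le[OF P that] ap_ed_le[OF Q PE[OF that(1)] PE[OF that(2)]] inv that by simp
  have 3: "ap P (ap P e) \<noteq> e" if e: "e \<in> EV x" and d: "ed e (ap P e) = 1" for e
  proof
    assume twice: "ap P (ap P e) = e"
    obtain c t u v where c: "vpath x c t" "map lab c = u" "(u, v) \<in> RR" "hd c = e" "hd (opp c u v) = ap P e"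
      using adjacent_edges[OF e PE[OF e] d] by blast
    let ?c = "map (ap P) c"
    have c': "vpath (apV P x) ?c (apV P t)" "map lab ?c = u"
      using ap_vpath[OF P c(1)] ap_map_lab[OF P c(1)] c(2) by auto
    have ne: "c \<noteq> []" "opp c u v \<noteq> []" "opp ?c u v \<noteq> []" "u \<noteq> []" "v \<noteq> []"
      using opp_nonempty[OF c(1-3)] opp_nonempty[OF c' c(3)] RR_nonempty[OF c(3)] by auto
    have "hd ?c = ap P (hd c)" using ne(1) by (simp add: hd_map)
    then have hc1: "hd ?c = ap P e" by (simp only: c(4))
    have "hd (opp ?c u v) = ap P (hd (opp c u v))"
      by (simp only: ap_opp[OF P c(1-3), symmetric] hd_map[OF ne(2)])
    then have hc2: "hd (opp ?c u v) = e" by (simp only: c(5) twice)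
    have uv: "u \<noteq> v" using RR_neq[OF c(3)] .
    have w: "weight (hd a) < weight (Child a b b' 0)" if "a \<noteq> []" for a b b'
      using weight_less_cellw[of "hd a" "(a, b, b')"] that by simp
    have "?c \<noteq> []" using ne(1) by simp
    then have i: "weight e < weight (Child c u v 0)" "weight (ap P e) < weight (Child ?c u v 0)"
      "weight (ap P e) < weight (Child (opp c u v) v u 0)" "weight e < weight (Child (opp ?c u v) v u 0)"
      using w[OF ne(1), of u v] w[of ?c u v] w[OF ne(2), of v u] w[OF ne(3), of v u]
      unfolding c(4,5) hc1 hc2 by blast+
    have A: "ap P e = Child c u v 0 \<or> e = Child (opp c u v) v u 0"
      using opp_cases[OF c(1-3)] hd_block[OF ne(5), of c u] hd_block[OF ne(4), of "opp c u v" v] c(4,5)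
      by metis
    have B: "e = Child ?c u v 0 \<or> ap P e = Child (opp ?c u v) v u 0"
      using opp_cases[OF c' c(3)] hd_block[OF ne(5), of ?c u] hd_block[OF ne(4), of "opp ?c u v" v] hc1 hc2
      by metis
    from A B show False
    proof (elim disjE)
      assume "ap P e = Child c u v 0" "e = Child ?c u v 0"
      then show False using i(1,2) less_asym by metis
    next
      assume "ap P e = Child c u v 0" "ap P e = Child (opp ?c u v) v u 0"
      then show False using uv by simp
    next
      assume "e = Child (opp c u v) v u 0" "e = Child ?c u v 0"
      then show False using uv tedge.inject(2) by metis
    next
      assume "e = Child (opp c u v) v u 0" "ap P e = Child (opp ?c u v) v u 0"
      then show False using i(3,4) less_asym by metis
    qed
  qed
  show ?thesis unfolding isometry_def using 1 2 3 by blast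
qed

end

subsection \<open>Hyperbolic vertices\<close>

text \<open>Let \<open>z\<close> be the smallest element that is moved. It cannot go down, where
  everything is fixed. If it goes up, its preimage is larger than \<open>z\<close> and yet mapped
  below \<open>f z\<close>.\<close>

lemma strict_mono_permutation:
  fixes p :: "'b \<Rightarrow> 'c :: linorder"
  assumes fin: "finite H" and f: "\<And>x. x \<in> H \<Longrightarrow> f x \<in> H"
    and mono: "\<And>x y. \<lbrakk>x \<in> H; y \<in> H; p x < p y\<rbrakk> \<Longrightarrow> p (f x) < p (f y)" and inj: "inj_on p H" and x: "x \<in> H"
  shows "f x = x"
proof (rule ccontr)
  assume "f x \<noteq> x"
  define B where "B = {x \<in> H. f x \<noteq> x}"
  have B: "finite (p ` B)" "p ` B \<noteq> {}" using fin x \<open>f x \<noteq> x\<close> by (auto simp: B_def)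
  from Min_in[OF B] obtain z where z: "Min (p ` B) = p z" "z \<in> B" by (rule imageE)
  have zH: "z \<in> H" "f z \<noteq> z" "f z \<in> H" using z(2) f by (auto simp: B_def)
  have min: "f y = y" if "y \<in> H" "p y < p z" for y
  proof (rule ccontr)
    assume "f y \<noteq> y"
    then have "p y \<in> p ` B" using that by (simp add: B_def)
    then show False using Min_le[OF B(1)] z(1) that(2) by fastforce
  qed
  have finj: "inj_on f H"
  proof (rule inj_onI)
    fix a b assume ab: "a \<in> H" "b \<in> H" "f a = f b"
    then have "\<not> p a < p b" "\<not> p b < p a" using mono[of a b] mono[of b a] by auto
    then show "a = b" using inj ab by (auto simp: inj_on_def)
  qed
  have "p (f z) \<noteq> p z" using inj zH by (auto simp: inj_on_def)
  then consider "p (f z) < p z" | "p z < p (f z)" by fastforce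
  then show False
  proof cases
    case 1
    then have "f (f z) = f z" using min zH by blast
    then show False using mono[OF zH(3,1) 1] by simp
  next
    case 2
    have "f ` H \<subseteq> H" using f by auto
    from endo_inj_surj[OF fin this finj] have "z \<in> f ` H" using zH(1) by simp
    then obtain y where y: "y \<in> H" "f y = z" by auto
    then have "y \<noteq> z" using zH(2) by auto
    then have "p y \<noteq> p z" using inj y zH by (auto simp: inj_on_def)
    then consider "p y < p z" | "p z < p y" by fastforce
    then show False
    proof cases
      case 1
      then show False using min[OF y(1)] y(2) \<open>y \<noteq> z\<close> by simp
    next
      case 2
      then show False using mono[OF zH(1) y(1)] y(2) \<open>p z < p (f z)\<close> by simp
    qed
  qed
qed

context two_tree
begin

definition fixp :: "'a edge list set \<Rightarrow> 'a tedge list \<Rightarrow> bool" where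
  "fixp P r \<longleftrightarrow> (\<forall>e\<in>set r. ap P e = e)"

text \<open>The fixed vertices at which \<open>P\<close> acts hyperbolically on the tree of outgoing edges.\<close>

definition hyp :: "'a edge list set \<Rightarrow> 'a vert \<Rightarrow> bool" where
  "hyp P x \<longleftrightarrow> Vt x \<and> x \<noteq> terminus \<and> apV P x = x \<and> (\<forall>e\<in>EV x. ap P e \<noteq> e)"

definition before :: "'a vert \<Rightarrow> 'a vert \<Rightarrow> bool" where
  "before x y \<longleftrightarrow> (\<exists>c. vpath x c y \<and> c \<noteq> [])"

lemma before_pos: "before x y \<Longrightarrow> pos x < pos y"
  unfolding before_def using vpath_pos_less by blast

lemma fixp_map: "fixp P r \<Longrightarrow> map (ap P) r = r"
  by (simp add: fixp_def map_idI)

lemma fixp_append: "fixp P (r @ r') \<longleftrightarrow> fixp P r \<and> fixp P r'"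
  by (auto simp: fixp_def)

lemma out_edge: "x \<in> vts r \<Longrightarrow> x \<noteq> terminus \<Longrightarrow> \<exists>e\<in>set r. src e = x"
  by (auto simp: vts_def)

lemma vts_split:
  assumes r: "state r" and x: "x \<in> vts r"
  shows "\<exists>a b. r = a @ b \<and> vpath origin a x \<and> vpath x b terminus"
proof (cases "x = terminus")
  case True
  then show ?thesis using r by (intro exI[of _ r] exI[of _ "[]"]) simp
next
  case False
  then obtain e where e: "e \<in> set r" "src e = x" using out_edge[OF x] by blast
  then obtain a b where ab: "r = a @ e # b" by (meson split_list)
  then have "vpath origin a x" "vpath x (e # b) terminus" using r e(2) by (auto simp: vpath_split)
  then show ?thesis using ab by blast
qed

lemma comparable:
  assumes r: "state r" and x: "x \<in> vts r" and y: "y \<in> vts r"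
  shows "x = y \<or> before x y \<or> before y x"
proof -
  obtain a b where ab: "r = a @ b" "vpath origin a x" "vpath x b terminus" using vts_split[OF r x] by blast
  show ?thesis
  proof (cases "y = terminus")
    case True
    then show ?thesis using ab(3) unfolding before_def by (cases "b = []") auto
  next
    case False
    then obtain f where f: "f \<in> set r" "src f = y" using out_edge[OF y] by blast
    then consider "f \<in> set a" | "f \<in> set b" using ab(1) by auto
    then show ?thesis
    proof cases
      case 1
      then obtain a1 a2 where "a = a1 @ f # a2" by (meson split_list)
      then have "vpath y (f # a2) x" using ab(2) f(2) by (auto simp: vpath_split)
      then show ?thesis unfolding before_def by blast
    next
      case 2
      then obtain b1 b2 where "b = b1 @ f # b2" by (meson split_list)
      then have "vpath x b1 y" using ab(3) f(2) by (auto simp: vpath_split)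
      then show ?thesis unfolding before_def by (cases "b1 = []") auto
    qed
  qed
qed

lemma before_ap: "P \<in> carrier DG \<Longrightarrow> before x y \<Longrightarrow> before (apV P x) (apV P y)"
  unfolding before_def using ap_vpath by blast

lemma birth_minimal:
  assumes f: "f \<in> EV x" "chain f = []"
  shows "e \<in> EV x \<Longrightarrow> e = f \<or> weight f < weight e"
proof (induction "length (chain e)" arbitrary: e)
  case 0
  then show ?case using chain_Nil[of e f] f by (simp add: EV_def)
next
  case (Suc n)
  then obtain cs y where cs: "chain e = cs @ [y]" by (metis append_butlast_last_id list.size(3) nat.distinct(1))
  then obtain c u v where c: "e = Child c u v 0" "chain (hd c) = cs" "valid (hd c)" "src (hd c) = src e"
    using chain_snoc[of e cs y] Suc.prems by (auto simp: EV_def)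
  have "c \<noteq> []" using valid_child_nonempty[of c u v 0] Suc.prems c(1) by (auto simp: EV_def)
  then have "weight (hd c) < weight e" using weight_less_cellw[of "hd c" "(c, u, v)"] c(1) by simp
  moreover have "hd c = f \<or> weight f < weight (hd c)"
    by (rule Suc.hyps(1)) (use Suc.hyps(2) Suc.prems cs c in \<open>auto simp: EV_def\<close>)
  ultimately show ?case by auto
qed

text \<open>The edge born with \<open>x\<close> is the lightest one there. So the heavier of the two
  edges has a nonempty chain, and the last cell of this chain is not in the history of the other
  edge.\<close>

lemma start_separates:
  assumes e: "e \<in> EV x" "f \<in> EV x" "e \<noteq> f"
  shows "\<exists>h. start h = x \<and> (h \<in> cells e) \<noteq> (h \<in> cells f)"
proof -
  have main: "\<exists>h. start h = x \<and> h \<in> cells f \<and> h \<notin> cells e"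
    if e: "e \<in> EV x" "f \<in> EV x" "e \<noteq> f" "weight e \<le> weight f" for e f
  proof (cases "chain f = []")
    case True
    then show ?thesis using birth_minimal[OF e(2) _ e(1)] e by auto
  next
    case False
    then obtain cs y where cs: "chain f = cs @ [y]" by (metis append_butlast_last_id)
    then obtain c u v where c: "f = Child c u v 0" "valid (hd c)" "src (hd c) = src f"
      using chain_snoc[of f cs y] e(2) by (auto simp: EV_def)
    have ne: "c \<noteq> []" using valid_child_nonempty[of c u v 0] e(2) c(1) by (auto simp: EV_def)
    have x: "src (hd c) = x" "src e = x" using c(3) e by (auto simp: EV_def)
    have "(c, u, v) \<notin> cells e"
    proof
      assume "(c, u, v) \<in> cells e"
      from cells_cases[OF this] show False
      proof
        assume "\<exists>k. e = Child c u v k"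
        then obtain k where k: "e = Child c u v k" by blast
        then have "k \<noteq> 0" using e(3) c(1) by auto
        then have "src (hd c) = VIn c u v k" using x k by simp
        then have "(c, u, v) \<in> cells (hd c)" using src_inner[OF c(2)] by blast
        then have "cellw (c, u, v) \<le> weight (hd c)" by (rule cellw_le)
        then show False using weight_less_cellw[of "hd c" "(c, u, v)"] ne by simp
      next
        assume "\<exists>g\<in>cells e. \<exists>k. Child c u v k \<in> set (fst g)"
        then obtain g k where g: "g \<in> cells e" "Child c u v k \<in> set (fst g)" by blast
        then show False using weight_less_cellw[OF g(2)] cellw_le[OF g(1)] e(4) c(1) by simp
      qed
    qed
    then show ?thesis using c(1) x by (intro exI[of _ "(c, u, v)"]) simp
  qed
  show ?thesis using main[OF e] main[OF e(2,1)] e(3) by (cases "weight e \<le> weight f") force+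
qed

lemma state_separates:
  assumes r: "state r" "e \<in> set r" "src e = x" and r': "state r'" "f \<in> set r'" "src f = x" and "e \<noteq> f"
  shows "\<exists>h. start h = x \<and> h \<in> sd (cellsl r) (cellsl r') \<and> (h \<in> cells e) \<noteq> (h \<in> cells f)"
proof -
  have "e \<in> EV x" "f \<in> EV x" using vpath_valid[OF r(1,2)] vpath_valid[OF r'(1,2)] r(3) r'(3) by (auto simp: EV_def)
  then obtain h where h: "start h = x" "(h \<in> cells e) \<noteq> (h \<in> cells f)"
    using start_separates \<open>e \<noteq> f\<close> by blast
  have "h \<in> cells e \<longleftrightarrow> h \<in> cellsl r" "h \<in> cells f \<longleftrightarrow> h \<in> cellsl r'"
    using start_cell[OF r(1) _ r(2), of h] start_cell[OF r'(1) _ r'(2), of h] r r' h(1)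
    by (auto simp: cellsl_def)
  then have "h \<in> sd (cellsl r) (cellsl r')" using h(2) by (auto simp: sd_def)
  then show ?thesis using h by (intro exI[of _ h]) simp
qed

definition avoid :: "'a vert \<Rightarrow> 'a tedge list \<Rightarrow> 'a tedge list \<Rightarrow> bool" where
  "avoid x r r' \<longleftrightarrow> state r \<and> state r' \<and> (\<exists>y. y \<noteq> x \<and> y \<in> vts r \<and> mv_at y r r')"

lemma mv_at_vts: "mv_at y r r' \<Longrightarrow> y \<in> vts r"
proof -
  assume "mv_at y r r'"
  then obtain r1 c r2 u v where m: "(u, v) \<in> RR" "map lab c = u" "src (hd c) = y" "r = r1 @ c @ r2"
    unfolding mv_at_def by blast
  have "c \<noteq> []" using RR_nonempty[OF m(1)] m(2) by auto
  then show ?thesis using m(3,4) by (auto simp: vts_def)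
qed

lemma avoid_cells: "(avoid x)\<^sup>*\<^sup>* r r' \<Longrightarrow> start h = x \<Longrightarrow> h \<in> cellsl r \<longleftrightarrow> h \<in> cellsl r'"
proof (induction rule: rtranclp_induct)
  case (step r1 r2)
  obtain y where y: "y \<noteq> x" "state r1" "mv_at y r1 r2" using step.hyps(2) by (auto simp: avoid_def)
  obtain h' where h': "start h' = y" "sd (cellsl r1) (cellsl r2) \<subseteq> {h'}" using mv_cell[OF y(3,2)] by blast
  have "h \<noteq> h'" using h'(1) y(1) step.prems by auto
  then have "h \<notin> sd (cellsl r1) (cellsl r2)" using h'(2) by blast
  then show ?case using step by (auto simp: sd_def)
qed simp

text \<open>A move at \<open>x\<close> is possible only when \<open>x\<close> lies on the path, so
  all moves before the first state through \<open>x\<close> take place elsewhere.\<close>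

lemma avoid_reach:
  "mv\<^sup>*\<^sup>* r r' \<Longrightarrow> state r \<Longrightarrow> x \<in> vts r' \<Longrightarrow> \<exists>s. (avoid x)\<^sup>*\<^sup>* r s \<and> x \<in> vts s \<and> state s"
proof (induction rule: converse_rtranclp_induct)
  case base
  then show ?case by blast
next
  case (step r r1)
  show ?case
  proof (cases "x \<in> vts r")
    case True
    then show ?thesis using step.prems(1) by blast
  next
    case False
    obtain y where y: "mv_at y r r1" using step.hyps(1) by (auto simp: mv_def)
    have r1: "state r1" by (rule mv_at_vpath[OF y step.prems(1)])
    have "y \<in> vts r" by (rule mv_at_vts[OF y])
    then have "y \<noteq> x" using False by auto
    then have "avoid x r r1" using \<open>y \<in> vts r\<close> step.prems(1) r1 y unfolding avoid_def by blast
    moreover obtain s where "(avoid x)\<^sup>*\<^sup>* r1 s" "x \<in> vts s" "state s" using step.IH[OF r1 step.prems(2)] by blast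
    ultimately show ?thesis using converse_rtranclp_into_rtranclp[of "avoid x" r r1 s] by blast
  qed
qed

lemma avoid_ap:
  assumes P: "P \<in> carrier DG" and x: "Vt x" "apV P x = x"
  shows "(avoid x)\<^sup>*\<^sup>* r r' \<Longrightarrow> (avoid x)\<^sup>*\<^sup>* (map (ap P) r) (map (ap P) r')"
proof (induction rule: rtranclp_induct)
  case (step r1 r2)
  obtain y where y: "y \<noteq> x" "state r1" "state r2" "mv_at y r1 r2" "y \<in> vts r1" using step.hyps(2) by (auto simp: avoid_def)
  have "Vt y" by (rule vts_Vt[OF y(2,5)])
  then have "apV P y \<noteq> x" using y(1) x apV_inv(1)[OF P] by metis
  moreover have "mv_at (apV P y) (map (ap P) r1) (map (ap P) r2)" by (rule ap_mv_at[OF P y(2,4)])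
  moreover have "apV P y \<in> vts (map (ap P) r1)" using ap_vts[OF P y(2)] y(5) by simp
  ultimately have "avoid x (map (ap P) r1) (map (ap P) r2)"
    unfolding avoid_def using ap_state[OF P] y(2,3) by blast
  then show ?case using step.IH by (rule rtranclp.rtrancl_into_rtrancl[rotated])
qed simp

text \<open>Moves elsewhere do not change the cells that start at \<open>x\<close>. Go from
  \<open>r\<close> to a state \<open>s\<close> through \<open>x\<close> by such moves. Together with
  the assumed walk, \<open>s\<close> and its image have the same cells starting at \<open>x\<close>,
  so they have the same edge there, which \<open>P\<close> then fixes.\<close>

lemma crossing:
  assumes P: "P \<in> carrier DG" and x: "hyp P x" and r: "state r"
  shows "\<not> (avoid x)\<^sup>*\<^sup>* r (map (ap P) r)"
proof
  assume walk: "(avoid x)\<^sup>*\<^sup>* r (map (ap P) r)"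
  have Vt: "Vt x" "x \<noteq> terminus" "apV P x = x" using x by (auto simp: hyp_def)
  obtain r1 r2 where "vpath origin r1 x" "vpath x r2 terminus" using state_vertex[OF Vt(1)] by blast
  then have r12: "state (r1 @ r2)" "x \<in> vts (r1 @ r2)"
    using vpath_ends(1)[of x r2 terminus] Vt(2) by (cases r2; auto simp: vts_def vpath_append)+
  obtain s where s: "(avoid x)\<^sup>*\<^sup>* r s" "x \<in> vts s" "state s"
    using avoid_reach[OF vpath_connected[OF r r12(1)] r r12(2)] by blast
  have s': "(avoid x)\<^sup>*\<^sup>* (map (ap P) r) (map (ap P) s)" by (rule avoid_ap[OF P Vt(1,3) s(1)])
  have same: "h \<in> cellsl s \<longleftrightarrow> h \<in> cellsl (map (ap P) s)" if "start h = x" for h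
    using avoid_cells[OF s(1) that] avoid_cells[OF s' that] avoid_cells[OF walk that] by blast
  obtain e where e: "e \<in> set s" "src e = x" using out_edge[OF s(2) Vt(2)] by blast
  have val: "valid e" by (rule vpath_valid[OF s(3) e(1)])
  then have "ap P e \<noteq> e" using x e(2) by (auto simp: hyp_def EV_def)
  moreover have "ap P e \<in> set (map (ap P) s)" "src (ap P e) = x" using e Vt(3) ap_src[OF P val] by auto
  ultimately obtain h where "start h = x" "h \<in> sd (cellsl s) (cellsl (map (ap P) s))"
    using state_separates[OF s(3) e ap_state[OF P s(3)]] by metis
  then show False using same by (auto simp: sd_def)
qed

text \<open>\<open>S\<close> collects the vertices at which the moves of the walk take
  place.\<close>

lemma walk_starts:
  "(adj W ^^ n) r r' \<Longrightarrow> \<exists>S. finite S \<and> (\<forall>x. x \<notin> S \<longrightarrow> (avoid x)\<^sup>*\<^sup>* r r') \<and>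
    (\<forall>y\<in>S. \<exists>s. state s \<and> W \<subseteq> vts s \<and> y \<in> vts s)"
proof (induction n arbitrary: r')
  case 0
  then show ?case by (intro exI[of _ "{}"]) simp
next
  case (Suc n)
  from Suc.prems obtain r1 where r1: "(adj W ^^ n) r r1" "adj W r1 r'" by (rule relpowp_Suc_E)
  obtain S where S: "finite S" "\<forall>x. x \<notin> S \<longrightarrow> (avoid x)\<^sup>*\<^sup>* r r1"
    "\<forall>y\<in>S. \<exists>s. state s \<and> W \<subseteq> vts s \<and> y \<in> vts s" using Suc.IH[OF r1(1)] by blast
  obtain y where y: "mv_at y r1 r'" "state r1" "state r'" "W \<subseteq> vts r1" using r1(2) by (auto simp: adj_def mv_def)
  have yv: "y \<in> vts r1" by (rule mv_at_vts[OF y(1)])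
  have "(avoid x)\<^sup>*\<^sup>* r r'" if "x \<notin> insert y S" for x
  proof -
    have "(avoid x)\<^sup>*\<^sup>* r r1" using S(2) that by simp
    moreover have "y \<noteq> x" using that by auto
    then have "avoid x r1 r'" using y yv unfolding avoid_def by blast
    ultimately show ?thesis by (rule rtranclp.rtrancl_into_rtrancl)
  qed
  moreover have "\<forall>z\<in>insert y S. \<exists>s. state s \<and> W \<subseteq> vts s \<and> z \<in> vts s" using S(3) y yv by blast
  ultimately show ?case using S(1) by (intro exI[of _ "insert y S"]) simp
qed

text \<open>By \<open>crossing\<close>, all hyperbolic vertices occur as places of moves on a single
  walk from \<open>root\<close> to its image.\<close>

lemma finite_hyp:
  assumes P: "P \<in> carrier DG"
  shows "finite {x. hyp P x}"
proof -
  have walk: "(adj {} ^^ dst root (map (ap P) root)) root (map (ap P) root)"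
    by (rule geodesic) (use state_root ap_state[OF P state_root] in auto)
  obtain S where S: "finite S" "\<forall>x. x \<notin> S \<longrightarrow> (avoid x)\<^sup>*\<^sup>* root (map (ap P) root)"
    using walk_starts[OF walk] by (elim exE conjE)
  have "x \<in> S" if "hyp P x" for x
    using crossing[OF P that state_root] S(2) by metis
  then have "{x. hyp P x} \<subseteq> S" by auto
  then show ?thesis using S(1) by (rule finite_subset)
qed

text \<open>Walk from a state through \<open>y\<close> to its image without ever leaving
  \<open>y\<close>. By \<open>crossing\<close> some move takes place at \<open>x\<close>, and the
  state at that moment contains both vertices.\<close>

lemma hyp_comparable:
  assumes P: "P \<in> carrier DG" and x: "hyp P x" and y: "Vt y" "apV P y = y"
  shows "x = y \<or> before x y \<or> before y x"
proof -
  obtain r1 r2 where "vpath origin r1 y" "vpath y r2 terminus" using state_vertex[OF y(1)] by blast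
  then have r: "state (r1 @ r2)" "y \<in> vts (r1 @ r2)"
    using vpath_ends(1)[of y r2 terminus] by (cases r2; auto simp: vts_def vpath_append)+
  let ?r = "r1 @ r2"
  have y': "y \<in> vts (map (ap P) ?r)" using ap_vts[OF P r(1)] r(2) y(2) by (metis image_eqI)
  have walk: "(adj {y} ^^ dst ?r (map (ap P) ?r)) ?r (map (ap P) ?r)"
    by (rule geodesic[OF r(1) ap_state[OF P r(1)]]) (use r(2) y' in auto)
  obtain S where S: "\<forall>x. x \<notin> S \<longrightarrow> (avoid x)\<^sup>*\<^sup>* ?r (map (ap P) ?r)"
    "\<forall>z\<in>S. \<exists>s. state s \<and> {y} \<subseteq> vts s \<and> z \<in> vts s"
    using walk_starts[OF walk] by (elim exE conjE)
  have "x \<in> S" using S(1) crossing[OF P x r(1)] by metis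
  then obtain s where "state s" "y \<in> vts s" "x \<in> vts s" using S(2) by blast
  then show ?thesis using comparable by blast
qed

lemma hyp_conj:
  assumes P: "P \<in> carrier DG" "Q \<in> carrier DG" "P' \<in> carrier DG"
    and comm: "Q \<otimes>\<^bsub>DG\<^esub> P = P' \<otimes>\<^bsub>DG\<^esub> Q" and x: "hyp P x"
  shows "hyp P' (apV Q x)"
proof -
  interpret group DG by (rule group_DG)
  have Vt: "Vt x" "x \<noteq> terminus" "apV P x = x" using x by (auto simp: hyp_def)
  have "apV P' (apV Q x) = apV Q x"
    using apV_mult[OF P(3,2) Vt(1)] apV_mult[OF P(2,1) Vt(1)] comm Vt(3) by simp
  moreover have "apV Q x \<noteq> terminus"
    using apV_inv(1)[OF P(2) Vt(1)] Vt(2) apV_ends(2)[OF inv_closed[OF P(2)]] by metis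
  moreover have "ap P' f \<noteq> f" if f: "f \<in> EV (apV Q x)" for f
  proof
    assume fix_f: "ap P' f = f"
    define e where "e = ap (inv\<^bsub>DG\<^esub> Q) f"
    have vf: "valid f" using f by (simp add: EV_def)
    have e: "e \<in> EV x" using ap_EV[OF inv_closed[OF P(2)] f] apV_inv(1)[OF P(2) Vt(1)] by (simp add: e_def)
    then have ve: "valid e" by (simp add: EV_def)
    have Qe: "ap Q e = f" unfolding e_def by (rule ap_inv(2)[OF P(2) vf])
    have "ap Q (ap P e) = ap P' (ap Q e)"
      using ap_mult[OF P(2,1) ve] ap_mult[OF P(3,2) ve] comm by simp
    then have "ap Q (ap P e) = ap Q e" using fix_f Qe by simp
    then have "ap P e = e" using ap_inv(1)[OF P(2) ve] ap_inv(1)[OF P(2) ap_valid[OF P(1) ve]] by simp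
    then show False using x e by (auto simp: hyp_def)
  qed
  ultimately show ?thesis using apV_Vt[OF P(2) Vt(1)] by (simp add: hyp_def)
qed

text \<open>\<open>Q\<close> preserves the relation \<open>before\<close>. On the hyperbolic
  vertices of \<open>P\<close> this relation agrees with the order of positions, thanks to
  \<open>hyp_comparable\<close>.\<close>

lemma commuting_fixes_hyp:
  assumes P: "P \<in> carrier DG" and Q: "Q \<in> carrier DG" and comm: "P \<otimes>\<^bsub>DG\<^esub> Q = Q \<otimes>\<^bsub>DG\<^esub> P" and x: "hyp P x"
  shows "apV Q x = x"
proof (rule strict_mono_permutation[where H = "{x. hyp P x}" and p = pos])
  have cmp: "a = b \<or> before a b \<or> before b a" if "hyp P a" "hyp P b" for a b
    using hyp_comparable[OF P that(1), of b] that(2) by (auto simp: hyp_def)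
  show "finite {x. hyp P x}" by (rule finite_hyp[OF P])
  show "apV Q a \<in> {x. hyp P x}" if "a \<in> {x. hyp P x}" for a
    using hyp_conj[OF P Q P] comm that by simp
  show "pos (apV Q a) < pos (apV Q b)" if "a \<in> {x. hyp P x}" "b \<in> {x. hyp P x}" "pos a < pos b" for a b
  proof -
    have "before a b" using cmp[of a b] that before_pos[of b a] by auto
    then show ?thesis using before_pos[OF before_ap[OF Q]] by blast
  qed
  show "inj_on pos {x. hyp P x}"
  proof (rule inj_onI)
    fix a b assume "a \<in> {x. hyp P x}" "b \<in> {x. hyp P x}" "pos a = pos b"
    then show "a = b" using cmp[of a b] before_pos[of a b] before_pos[of b a] by auto
  qed
  show "x \<in> {x. hyp P x}" using x by simp
qed

lemma dst_ap:
  assumes P: "P \<in> carrier DG" and r: "state r" "state r'"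
  shows "dst (map (ap P) r) (map (ap P) r') \<le> dst r r'"
proof -
  have "(adj {} ^^ n) r r' \<Longrightarrow> (adj {} ^^ n) (map (ap P) r) (map (ap P) r')" for n r'
  proof (induction n arbitrary: r')
    case (Suc n)
    from Suc.prems obtain r1 where r1: "(adj {} ^^ n) r r1" "adj {} r1 r'" by (rule relpowp_Suc_E)
    have s: "state r1" "state r'" "mv r1 r'" using r1(2) by (auto simp: adj_def)
    then have "mv (map (ap P) r1) (map (ap P) r')" unfolding mv_def using ap_mv_at[OF P s(1)] by blast
    then have "adj {} (map (ap P) r1) (map (ap P) r')" unfolding adj_def using s ap_state[OF P] by simp
    then show ?case by (rule relpowp_Suc_I[OF Suc.IH[OF r1(1)]])
  qed simp
  then show ?thesis using geodesic[OF r, of "{}"] adj_dst by blast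
qed

text \<open>A move at \<open>x\<close> crosses one cell there. A move at another vertex can change
  the edge leaving \<open>x\<close> only if \<open>x\<close> is an inner vertex of the cell crossed,
  and such a vertex does not lie on both paths.\<close>

lemma mv_out_edge:
  assumes r: "state r" and m: "mv r r'" and e: "e \<in> set r" "src e = x" "f \<in> set r'" "src f = x"
  shows "ed e f \<le> 1"
proof -
  interpret tree_metric "EV x" ed by (rule tree_EV)
  obtain r1 c r2 u v where m: "(u, v) \<in> RR" "map lab c = u" "r = r1 @ c @ r2" "r' = r1 @ opp c u v @ r2"
    using m unfolding mv_def mv_at_def by blast
  obtain p q where pq: "vpath origin r1 p" "vpath p c q" "vpath q r2 terminus"
    using r m(3) vpath_append3 by blast
  have vo: "vpath p (opp c u v) q" by (rule opp_vpath[OF pq(2) m(2,1)])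
  have r': "state r'" unfolding m(4) using pq vo by (blast intro: vpath_appendI)
  have eE: "e \<in> EV x" using vpath_valid[OF r e(1)] e(2) by (simp add: EV_def)
  have ve: "valid e" "valid f" using vpath_valid[OF r e(1)] vpath_valid[OF r' e(3)] by auto
  have ne: "c \<noteq> []" "opp c u v \<noteq> []" using opp_nonempty[OF pq(2) m(2,1)] by auto
  show ?thesis
  proof (cases "e \<in> set r1 \<union> set r2 \<or> f \<in> set r1 \<union> set r2")
    case True
    then have "e = f"
    proof
      assume "e \<in> set r1 \<union> set r2"
      then have "e \<in> set r'" using m(4) by auto
      then show "e = f" using vpath_src_inj[OF r' _ e(3)] e by simp
    next
      assume "f \<in> set r1 \<union> set r2"
      then have "f \<in> set r" using m(3) by auto
      then show "e = f" using vpath_src_inj[OF r e(1)] e by simp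
    qed
    then show ?thesis using self[OF eE] by simp
  next
    case False
    then have ef: "e \<in> set c" "f \<in> set (opp c u v)" using e m by auto
    have srcs: "src (hd (opp c u v)) = p" "src (hd c) = p" by (rule opp_src[OF pq(2) m(2,1)])+
    have hds: "hd c \<in> set c" "hd (opp c u v) \<in> set (opp c u v)"
      using hd_in_set[OF ne(1)] hd_in_set[OF ne(2)] by blast+
    have pe: "p = x \<longleftrightarrow> e = hd c" "p = x \<longleftrightarrow> f = hd (opp c u v)"
      using vpath_src_inj[OF pq(2) ef(1) hds(1)] vpath_src_inj[OF vo ef(2) hds(2)] srcs e(2,4) by metis+
    show ?thesis
    proof (cases "p = x")
      case True
      then show ?thesis using opp_adjacent(3)[OF pq(2) m(2,1)] pe by simp
    next
      case px: False
      have inner: False if t: "a \<in> set c'" "b \<in> set (block c' u' v')" "src a = src b" "valid a" "b \<noteq> hd (block c' u' v')"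
        for a b c' u' v'
      proof -
        obtain k where k: "b = Child c' u' v' k" "k < length v'" using t(2) by (auto simp: set_block)
        then have "v' \<noteq> []" by auto
        then have "k \<noteq> 0" using t(5) k hd_block[of v' c' u'] by auto
        then have "src a = VIn c' u' v' k" using t(3) k by simp
        then have "(c', u', v') \<in> cells a" using src_inner[OF t(4)] by blast
        then have "cellw (c', u', v') \<le> weight a" by (rule cellw_le)
        then show False using weight_less_cellw[of a "(c', u', v')"] t(1) by simp
      qed
      from opp_cases[OF pq(2) m(2,1)] show ?thesis
      proof
        assume "opp c u v = block c u v \<and> (\<nexists>c0. c = block c0 v u)"
        then show ?thesis using inner[of e c f u v] ef e ve px pe by simp
      next
        assume *: "c = block (opp c u v) v u \<and> (\<nexists>c0. opp c u v = block c0 u v)"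
        have "e \<in> set (block (opp c u v) v u)" using ef(1) * by metis
        moreover have "e \<noteq> hd (block (opp c u v) v u)" using px pe(1) * by metis
        ultimately show ?thesis using inner[of f "opp c u v" e v u] ef e ve by simp
      qed
    qed
  qed
qed

text \<open>Suppose that \<open>P\<close> fixes an edge at \<open>x\<close>. On a shortest walk from
  \<open>r\<close> to its image through states containing \<open>x\<close> and \<open>W\<close>, the
  edges leaving \<open>x\<close> form a walk from \<open>e\<close> to \<open>ap P e\<close>, and
  \<open>elliptic_walk\<close> yields a state \<open>s i\<close> whose edge at \<open>x\<close> is
  fixed. Its displacement is smaller than that of \<open>r\<close>: some cell starting at
  \<open>x\<close> changes between \<open>s i\<close> and the image of \<open>r\<close>, and changes
  back between the latter and the image of \<open>s i\<close>.\<close>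

lemma minimal_hyp:
  assumes P: "P \<in> carrier DG" and W: "\<forall>x\<in>W. apV P x = x" and r: "state r" "W \<subseteq> vts r"
    and min: "\<forall>s. state s \<longrightarrow> W \<subseteq> vts s \<longrightarrow> dst r (map (ap P) r) \<le> dst s (map (ap P) s)"
    and e: "e \<in> set r" "apV P (src e) = src e" "ap P e \<noteq> e"
  shows "hyp P (src e)"
proof (rule ccontr)
  assume not_hyp: "\<not> hyp P (src e)"
  define x where "x = src e"
  have ve: "valid e" by (rule vpath_valid[OF r(1) e(1)])
  have Vx: "Vt x" using Vt_src[OF ve] by (simp add: x_def)
  have xP: "apV P x = x" using e(2) by (simp add: x_def)
  have xt: "x \<noteq> terminus"
  proof
    assume "x = terminus"
    then have "pos (tgt e) \<le> pos (src e)" using vpath_src_le(2)[OF r(1) e(1)] by (simp add: x_def)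
    then show False using pos_less[OF ve] by simp
  qed
  obtain f where f: "f \<in> EV x" "ap P f = f" using not_hyp Vx xP xt by (auto simp: hyp_def x_def)
  interpret tree_metric "EV x" ed by (rule tree_EV)
  have iso: "isometry (ap P)" by (rule ap_isometry[OF P xP Vx])
  let ?Pr = "map (ap P) r"
  define n where "n = dst r ?Pr"
  have xr: "x \<in> vts r" using e(1) by (auto simp: vts_def x_def)
  have Pr: "state ?Pr" by (rule ap_state[OF P r(1)])
  have vPr: "insert x W \<subseteq> vts ?Pr"
  proof
    fix y assume "y \<in> insert x W"
    then have "apV P y = y" "y \<in> vts r" using W xP xr r(2) by auto
    then show "y \<in> vts ?Pr" using ap_vts[OF P r(1)] by (metis image_eqI)
  qed
  have "(adj (insert x W) ^^ n) r ?Pr"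
    unfolding n_def by (rule geodesic[OF r(1) Pr _ vPr]) (use xr r(2) in blast)
  then obtain s where s: "s 0 = r" "s n = ?Pr" "\<forall>i<n. adj (insert x W) (s i) (s (Suc i))"
    by (auto simp: relpowp_fun_conv)
  have st: "state (s i) \<and> insert x W \<subseteq> vts (s i)" if "i \<le> n" for i
  proof (cases "i = n")
    case True
    then show ?thesis using Pr vPr s(2) by simp
  next
    case False
    then show ?thesis using s(3) that unfolding adj_def by simp
  qed
  have "\<forall>i. i \<le> n \<longrightarrow> (\<exists>g. g \<in> set (s i) \<and> src g = x)" using st out_edge xt by blast
  then obtain g where g: "\<And>i. i \<le> n \<Longrightarrow> g i \<in> set (s i)" "\<And>i. i \<le> n \<Longrightarrow> src (g i) = x" by metis
  have gE: "g i \<in> EV x" if "i \<le> n" for i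
    using vpath_valid[OF conjunct1[OF st[OF that]] g(1)[OF that]] g(2)[OF that] by (simp add: EV_def)
  have g0: "g 0 = e" using vpath_src_inj[OF r(1), of "g 0" e] g(1)[of 0] g(2)[of 0] s(1) e(1) by (simp add: x_def)
  have aPe: "ap P e \<in> set ?Pr" "src (ap P e) = x" using e(1) ap_src[OF P ve] xP by (auto simp: x_def)
  have gn: "g n = ap P e" using vpath_src_inj[OF Pr, of "g n" "ap P e"] g(1)[of n] g(2)[of n] s(2) aPe by simp
  have "\<exists>i\<le>n. ap P (g i) = g i"
  proof (rule elliptic_walk[OF iso f])
    show "g i \<in> EV x" if "i \<le> n" for i using gE that .
    show "ed (g i) (g (Suc i)) \<le> 1" if "i < n" for i
    proof (rule mv_out_edge)
      show "state (s i)" "mv (s i) (s (Suc i))" using s(3) that by (auto simp: adj_def)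
    qed (use g that in auto)
    show "g n = ap P (g 0)" using gn g0 by simp
  qed
  then obtain i where i: "i \<le> n" "ap P (g i) = g i" by blast
  let ?s = "s i" and ?Ps = "map (ap P) (s i)"
  have si: "state ?s" "W \<subseteq> vts ?s" using st[OF i(1)] by auto
  have Psi: "state ?Ps" by (rule ap_state[OF P si(1)])
  have "g i \<noteq> ap P e"
  proof
    assume "g i = ap P e"
    then have "ap P (ap P e) = ap P e" using i(2) by simp
    then have "ap P e = e" using ap_inv(1)[OF P ve] ap_inv(1)[OF P ap_valid[OF P ve]] by simp
    then show False using e(3) by simp
  qed
  then obtain h where h: "start h = x" "h \<in> sd (cellsl ?s) (cellsl ?Pr)" "(h \<in> cells (g i)) \<noteq> (h \<in> cells (ap P e))"
    using state_separates[OF si(1) g(1)[OF i(1)] g(2)[OF i(1)] Pr aPe] by blast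
  have gPs: "g i \<in> set ?Ps" using g(1)[OF i(1)] i(2) by (metis imageI list.set_map)
  have "h \<in> cellsl ?Ps \<longleftrightarrow> h \<in> cells (g i)"
    using start_cell[OF Psi _ gPs, of h] g(2)[OF i(1)] h(1) gPs by (auto simp: cellsl_def)
  moreover have "h \<in> cellsl ?Pr \<longleftrightarrow> h \<in> cells (ap P e)"
    using start_cell[OF Pr _ aPe(1), of h] aPe h(1) by (auto simp: cellsl_def)
  ultimately have h2: "h \<in> sd (cellsl ?Pr) (cellsl ?Ps)" using h(3) by (auto simp: sd_def)
  have "dst ?s ?Ps < dst ?s ?Pr + dst ?Pr ?Ps" by (rule dst_crossing[OF h(2) h2])
  moreover have "dst ?Pr ?Ps \<le> dst r ?s" by (rule dst_ap[OF P r(1) si(1)])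
  moreover have "dst r ?s \<le> i"
  proof -
    have "(adj (insert x W) ^^ i) r ?s"
      unfolding relpowp_fun_conv using s i(1) by (intro exI[of _ s]) simp
    then show ?thesis by (rule adj_dst)
  qed
  moreover have "dst ?s ?Pr \<le> n - i"
  proof -
    have "(adj (insert x W) ^^ (n - i)) ?s ?Pr"
      unfolding relpowp_fun_conv using s i(1) by (intro exI[of _ "\<lambda>j. s (i + j)"]) simp
    then show ?thesis by (rule adj_dst)
  qed
  ultimately have "dst ?s ?Ps < n" using i(1) by linarith
  moreover have "n \<le> dst ?s ?Ps" using min si unfolding n_def by blast
  ultimately show False by simp
qed


text \<open>An element that fixes one side of a cell edge by edge also fixes the other side, so the
  property survives every move.\<close>

lemma fixp_connected:
  assumes P: "P \<in> carrier DG" and r: "vpath s r t" "vpath s r' t" and fix_r: "fixp P r"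
  shows "fixp P r'"
proof -
  have "fixp P r' \<and> vpath s r' t"
    using vpath_connected[OF r]
  proof (induction rule: rtranclp_induct)
    case base
    then show ?case using fix_r r by simp
  next
    case (step y z)
    obtain x where x: "mv_at x y z" using step.hyps(2) by (auto simp: mv_def)
    obtain r1 c r2 u v where m: "(u, v) \<in> RR" "map lab c = u" "y = r1 @ c @ r2" "z = r1 @ opp c u v @ r2"
      using x unfolding mv_at_def by blast
    have y: "vpath s (r1 @ c @ r2) t" "fixp P (r1 @ c @ r2)" using step.IH m(3) by auto
    obtain p q where pq: "vpath s r1 p" "vpath p c q" "vpath q r2 t"
      using y(1) vpath_append3 by blast
    have "map (ap P) c = c" using y(2) fixp_map by (simp add: fixp_append)
    then have "map (ap P) (opp c u v) = opp c u v" using ap_opp[OF P pq(2) m(2,1)] by simp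
    then have "fixp P (opp c u v)" unfolding fixp_def using map_eq_conv[of "ap P" "opp c u v" "\<lambda>x. x"] by simp
    then have "fixp P z" using y(2) m(4) by (simp add: fixp_append)
    moreover have "vpath s z t" using mv_at_vpath[OF x] step.IH by blast
    ultimately show ?case by blast
  qed
  then show ?thesis by blast
qed

lemma fixp_end:
  assumes P: "P \<in> carrier DG" and r: "vpath x r y" "fixp P r" and x: "apV P x = x"
  shows "apV P y = y"
proof -
  have "vpath x r (apV P y)" using ap_vpath[OF P r(1)] fixp_map[OF r(2)] x by simp
  then show ?thesis using r(1) path_unique[of x r] by (auto simp: vpath_def)
qed

lemma vpath_vts: "vpath origin a x \<Longrightarrow> vpath x b terminus \<Longrightarrow> x \<in> vts (a @ b)"
  using vpath_ends(1)[of x b terminus] by (cases b) (auto simp: vts_def)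

text \<open>Take a state of least displacement among those through \<open>x\<close> and
  \<open>y\<close>. By \<open>fixp_connected\<close> its part between these vertices is not fixed
  either, and \<open>minimal_hyp\<close> applies to the first moved edge there.\<close>

lemma first_hyp:
  assumes P: "P \<in> carrier DG" and x: "apV P x = x" and y: "apV P y = y" "Vt y"
    and r: "vpath x r y" "\<not> fixp P r"
  shows "\<exists>r1 e r2. vpath x (r1 @ e # r2) y \<and> fixp P r1 \<and> hyp P (src e)"
proof -
  let ?W = "{x, y}"
  let ?A = "\<lambda>s. state s \<and> ?W \<subseteq> vts s"
  have Vx: "Vt x" by (rule vpath_Vt[OF r(1) y(2)])
  obtain a where a: "vpath origin a x" using state_vertex[OF Vx] by blast
  obtain b where b: "vpath y b terminus" using state_vertex[OF y(2)] by blast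
  have "?A (a @ r @ b)"
    using vpath_appendI[OF a vpath_appendI[OF r(1) b]] vpath_vts[OF a vpath_appendI[OF r(1) b]]
      vpath_vts[OF vpath_appendI[OF a r(1)] b] by simp
  then have "\<exists>s. ?A s \<and> (\<forall>s'. ?A s' \<longrightarrow> dst s (map (ap P) s) \<le> dst s' (map (ap P) s'))"
    using ex_has_least_nat[of ?A "a @ r @ b" "\<lambda>s. dst s (map (ap P) s)"] by blast
  then obtain s where s: "state s" "?W \<subseteq> vts s"
    and min: "\<forall>s'. state s' \<longrightarrow> ?W \<subseteq> vts s' \<longrightarrow> dst s (map (ap P) s) \<le> dst s' (map (ap P) s')"
    by blast
  have rne: "r \<noteq> []" using r(2) by (auto simp: fixp_def)
  have lt: "pos x < pos y" by (rule vpath_pos_less[OF r(1) rne])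
  obtain a' b' where ab: "s = a' @ b'" "vpath origin a' y" "vpath y b' terminus" using vts_split[OF s(1), of y] s(2) by blast
  have "x \<noteq> terminus" using lt vpath_pos_le[OF b] by auto
  then obtain e where e: "e \<in> set s" "src e = x" using out_edge[of x s] s(2) by blast
  have "e \<in> set a'"
  proof (rule ccontr)
    assume "e \<notin> set a'"
    then have "e \<in> set b'" using e(1) ab(1) by simp
    then have "pos y \<le> pos x" using vpath_src_le(1)[OF ab(3)] e(2) by blast
    then show False using lt by simp
  qed
  then obtain a1 a2 where "a' = a1 @ e # a2" by (meson split_list)
  then have a12: "a' = a1 @ (e # a2)" "vpath x (e # a2) y" using ab(2) e(2) by (auto simp: vpath_split)
  define q where "q = e # a2"
  have q: "vpath x q y" "set q \<subseteq> set s" using a12 ab(1) by (auto simp: q_def)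
  have "\<not> fixp P q" using fixp_connected[OF P q(1) r(1)] r(2) by blast
  then have "\<exists>f\<in>set q. ap P f \<noteq> f" by (auto simp: fixp_def)
  then obtain r1 f r2 where f: "q = r1 @ f # r2" "ap P f \<noteq> f" "\<forall>g\<in>set r1. \<not> ap P g \<noteq> g"
    by (rule split_list_first_propE)
  have fr1: "fixp P r1" using f(3) by (simp add: fixp_def)
  have "vpath x r1 (src f)" using q(1) f(1) by (simp add: vpath_split)
  then have "apV P (src f) = src f" using fixp_end[OF P _ fr1 x] by blast
  then have "hyp P (src f)"
    by (intro minimal_hyp[OF P _ s(1,2) min]) (use x y f(1,2) q(2) in auto)
  then show ?thesis using q(1) f(1) fr1 by blast
qed

text \<open>Prolong \<open>f\<close> by edges fixed by the square of \<open>P\<close> up to a vertex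
  \<open>y\<close> fixed by \<open>P\<close>. Such a vertex is the terminus or the first hyperbolic
  vertex of the square, which \<open>P\<close> fixes because it commutes with its square. If
  \<open>P\<close> did not fix this path from \<open>x\<close> to \<open>y\<close>, it would have a
  hyperbolic vertex on some path between them. But there the square fixes an edge, hence so does
  \<open>P\<close>, by \<open>involution_fixed_point\<close>.\<close>

lemma no_order_two_orbit:
  assumes P: "P \<in> carrier DG" and x: "apV P x = x" and f: "f \<in> EV x" "ap P (ap P f) = f"
  shows "ap P f = f"
proof -
  interpret group DG by (rule group_DG)
  let ?Q = "P \<otimes>\<^bsub>DG\<^esub> P"
  have Q: "?Q \<in> carrier DG" using P by simp
  have vf: "valid f" "src f = x" using f(1) by (auto simp: EV_def)
  have Qf: "ap ?Q f = f" using ap_mult[OF P P vf(1)] f(2) by simp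
  then have Qy: "apV ?Q (tgt f) = tgt f" using ap_tgt[OF Q vf(1)] by simp
  have Vy: "Vt (tgt f)" by (rule Vt_tgt[OF vf(1)])
  obtain r0 where r0: "vpath (tgt f) r0 terminus" using state_vertex[OF Vy] by blast
  have "\<exists>r y. vpath (tgt f) r y \<and> fixp ?Q r \<and> apV P y = y \<and> Vt y"
  proof (cases "fixp ?Q r0")
    case True
    then show ?thesis using r0 apV_ends(2)[OF P] by (auto simp: Vt_def)
  next
    case False
    obtain r1 e r2 where e: "vpath (tgt f) (r1 @ e # r2) terminus" "fixp ?Q r1" "hyp ?Q (src e)"
      using first_hyp[OF Q Qy apV_ends(2)[OF Q] _ r0 False] by (auto simp: Vt_def)
    have "?Q \<otimes>\<^bsub>DG\<^esub> P = P \<otimes>\<^bsub>DG\<^esub> ?Q" using P by (simp add: m_assoc)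
    then have "apV P (src e) = src e" by (rule commuting_fixes_hyp[OF Q P _ e(3)])
    then show ?thesis using e by (auto simp: vpath_split hyp_def)
  qed
  then obtain r y where r: "vpath (tgt f) r y" "fixp ?Q r" "apV P y = y" "Vt y" by blast
  have p: "vpath x (f # r) y" "fixp ?Q (f # r)" using r vf Qf by (auto simp: fixp_def)
  have "fixp P (f # r)"
  proof (rule ccontr)
    assume "\<not> fixp P (f # r)"
    then obtain r1 e r2 where e: "vpath x (r1 @ e # r2) y" "hyp P (src e)"
      using first_hyp[OF P x r(3,4) p(1)] by blast
    have "fixp ?Q (r1 @ e # r2)" by (rule fixp_connected[OF Q p(1) e(1) p(2)])
    then have Qe: "ap ?Q e = e" by (simp add: fixp_def)
    have ve: "valid e" using e(1) by (simp add: vpath_split)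
    have z: "e \<in> EV (src e)" "ap P (ap P e) = e" using ve Qe ap_mult[OF P P ve] by (auto simp: EV_def)
    have "apV P (src e) = src e" "Vt (src e)" using e(2) by (auto simp: hyp_def)
    from tree_metric.involution_fixed_point[OF tree_EV ap_isometry[OF P this] z]
    show False using e(2) by (auto simp: hyp_def)
  qed
  then show ?thesis by (simp add: fixp_def)
qed

lemma hyp_exists:
  assumes P: "P \<in> carrier DG" "P \<noteq> \<one>\<^bsub>DG\<^esub>"
  shows "\<exists>x. hyp P x"
proof -
  interpret group DG by (rule group_DG)
  have "\<not> fixp P root"
  proof
    assume "fixp P root"
    then have "map (ap P) root = root" by (rule fixp_map)
    moreover have "map (ap \<one>\<^bsub>DG\<^esub>) root = root" using ap_one vpath_valid[OF state_root] by (simp add: map_idI)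
    ultimately have "P = \<one>\<^bsub>DG\<^esub>" using faithful[OF P(1) one_closed state_root] by simp
    then show False using P(2) by simp
  qed
  then show ?thesis using first_hyp[OF P(1) apV_ends(1) apV_ends(2)[OF P(1)] _ state_root] by (auto simp: Vt_def)
qed

lemma EV_nonempty: "Vt x \<Longrightarrow> x \<noteq> terminus \<Longrightarrow> EV x \<noteq> {}"
  by (auto simp: Vt_def EV_def)

text \<open>At a hyperbolic vertex some edge is not fixed by any positive power, by
  \<open>fixed_point_free_power\<close>.\<close>

lemma torsion_free:
  assumes P: "P \<in> carrier DG" "P \<noteq> \<one>\<^bsub>DG\<^esub>" and n: "0 < (n::nat)"
  shows "P [^]\<^bsub>DG\<^esub> n \<noteq> \<one>\<^bsub>DG\<^esub>"
proof
  interpret group DG by (rule group_DG)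
  assume one: "P [^]\<^bsub>DG\<^esub> n = \<one>\<^bsub>DG\<^esub>"
  obtain x where x: "hyp P x" using hyp_exists[OF P] by blast
  then have V: "Vt x" "x \<noteq> terminus" "apV P x = x" "\<And>e. e \<in> EV x \<Longrightarrow> ap P e \<noteq> e" by (auto simp: hyp_def)
  obtain e where e: "e \<in> EV x" "\<forall>n>0. (ap P ^^ n) e \<noteq> e"
    using tree_metric.fixed_point_free_power[OF tree_EV ap_isometry[OF P(1) V(3,1)] V(4) EV_nonempty[OF V(1,2)]]
    by blast
  have ve: "valid e" using e(1) by (simp add: EV_def)
  have "ap (P [^]\<^bsub>DG\<^esub> m) e = (ap P ^^ m) e" for m :: nat
  proof (induction m)
    case 0
    then show ?case using ap_one[OF ve] by simp
  next
    case (Suc m)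
    have "P [^]\<^bsub>DG\<^esub> Suc m = P \<otimes>\<^bsub>DG\<^esub> P [^]\<^bsub>DG\<^esub> m" using P(1) nat_pow_Suc2 by blast
    then show ?case using ap_mult[OF P(1) nat_pow_closed[OF P(1)] ve, of m] Suc by simp
  qed
  from this[of n] have "(ap P ^^ n) e = e" unfolding one ap_one[OF ve] by (rule HOL.sym)
  then show False using e(2) n by blast
qed

text \<open>Both translates of \<open>s\<close>, by \<open>b\<close> and by its inverse, are fixed
  by \<open>a\<close>: the first because \<open>d\<close> fixes \<open>s\<close>, the second because
  it is hyperbolic for \<open>d\<close>. If \<open>b\<close> moves \<open>s\<close>, one of the two
  translates lies behind \<open>s\<close>. If \<open>b\<close> fixed \<open>s\<close>,
  \<open>conjugate_commuting_isometries\<close> would produce an edge where \<open>a\<close> and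
  \<open>d\<close> agree or an orbit of length two.\<close>

lemma displaced_vertex:
  assumes car: "a \<in> carrier DG" "b \<in> carrier DG" "d \<in> carrier DG"
    and conj: "b \<otimes>\<^bsub>DG\<^esub> d = a \<otimes>\<^bsub>DG\<^esub> b" and comm: "a \<otimes>\<^bsub>DG\<^esub> d = d \<otimes>\<^bsub>DG\<^esub> a"
    and s: "hyp a s" "apV d s = s" and neq: "\<And>e. e \<in> EV s \<Longrightarrow> ap a e \<noteq> ap d e"
  shows "\<exists>B\<in>carrier DG. before s (apV B s) \<and> apV a (apV B s) = apV B s"
proof -
  interpret group DG by (rule group_DG)
  let ?b = "inv\<^bsub>DG\<^esub> b"
  have V: "Vt s" "s \<noteq> terminus" "apV a s = s" "\<And>e. e \<in> EV s \<Longrightarrow> ap a e \<noteq> e" using s(1) by (auto simp: hyp_def)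
  have ib: "?b \<in> carrier DG" using car by simp
  have bs: "apV a (apV b s) = apV b s"
    using apV_mult[OF car(1,2) V(1)] apV_mult[OF car(2,3) V(1)] conj s(2) by simp
  have conj': "?b \<otimes>\<^bsub>DG\<^esub> a = d \<otimes>\<^bsub>DG\<^esub> ?b"
  proof -
    have "?b \<otimes>\<^bsub>DG\<^esub> (a \<otimes>\<^bsub>DG\<^esub> b) \<otimes>\<^bsub>DG\<^esub> ?b = ?b \<otimes>\<^bsub>DG\<^esub> (b \<otimes>\<^bsub>DG\<^esub> d) \<otimes>\<^bsub>DG\<^esub> ?b" using conj by simp
    moreover have "?b \<otimes>\<^bsub>DG\<^esub> (a \<otimes>\<^bsub>DG\<^esub> b) \<otimes>\<^bsub>DG\<^esub> ?b = ?b \<otimes>\<^bsub>DG\<^esub> a"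
      using car ib by (simp add: m_assoc)
    moreover have "?b \<otimes>\<^bsub>DG\<^esub> (b \<otimes>\<^bsub>DG\<^esub> d) = d" using car ib by (simp add: m_assoc[symmetric])
    ultimately show ?thesis by simp
  qed
  have "hyp d (apV ?b s)" by (rule hyp_conj[OF car(1) ib car(3) conj' s(1)])
  then have ibs: "apV a (apV ?b s) = apV ?b s"
    by (rule commuting_fixes_hyp[OF car(3,1) comm[symmetric]])
  from hyp_comparable[OF car(1) s(1) apV_Vt[OF car(2) V(1)] bs] show ?thesis
  proof (elim disjE)
    assume eq: "s = apV b s"
    have iso: "tree_metric.isometry (EV s) ed (ap a)" "tree_metric.isometry (EV s) ed (ap b)"
      "tree_metric.isometry (EV s) ed (ap d)"
      using ap_isometry[OF car(1) V(3,1)] ap_isometry[OF car(2) eq[symmetric] V(1)] ap_isometry[OF car(3) s(2) V(1)]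
      by auto
    have c1: "ap b (ap d e) = ap a (ap b e)" if "e \<in> EV s" for e
      using ap_mult[OF car(2,3), of e] ap_mult[OF car(1,2), of e] conj that by (simp add: EV_def)
    have c2: "ap a (ap d e) = ap d (ap a e)" if "e \<in> EV s" for e
      using ap_mult[OF car(1,3), of e] ap_mult[OF car(3,1), of e] comm that by (simp add: EV_def)
    have "(\<exists>e\<in>EV s. ap a e = ap d e) \<or> (\<exists>e\<in>EV s. ap b (ap b e) = e \<and> ap b e \<noteq> e)"
      by (rule tree_metric.conjugate_commuting_isometries[OF tree_EV iso V(4) EV_nonempty[OF V(1,2)] c1 c2])
    then obtain e where "e \<in> EV s" "ap b (ap b e) = e" "ap b e \<noteq> e" using neq by blast
    then show ?thesis using no_order_two_orbit[OF car(2) eq[symmetric]] by blast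
  next
    assume "before s (apV b s)"
    then show ?thesis using bs car by blast
  next
    assume "before (apV b s) s"
    then have "before (apV ?b (apV b s)) (apV ?b s)" by (rule before_ap[OF ib])
    then have "before s (apV ?b s)" using apV_inv(1)[OF car(2) V(1)] by simp
    then show ?thesis using ibs ib by blast
  qed
qed

text \<open>Moves from \<open>r\<close> to \<open>r'\<close> project to a closed path in the Squier
  complex. If it were null-homotopic, its lift starting at \<open>r\<close> would end at
  \<open>r\<close>.\<close>

lemma nontrivial_subpath:
  assumes r: "vpath s r t" "vpath s r' t" "map lab r' = map lab r" and "r' \<noteq> r" "r \<noteq> []"
  shows "\<not> trivial_group (diagram_group \<Sigma> R (map lab r))"
proof
  let ?y = "map lab r"
  interpret Y: two_tree \<Sigma> R ?y
    by unfold_locales (use pres vpath_lab_word[OF r(1) \<open>r \<noteq> []\<close>] in auto)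
  assume triv: "trivial_group (diagram_group \<Sigma> R ?y)"
  obtain es where es: "kpath ?y es ?y" "run r es = r'"
    using mv_rtranclp_kpath[OF vpath_connected[OF r(1,2)] r(1)] r(3) by auto
  have k: "kpath ?y [] ?y" by simp
  have "Y.run Y.root es = Y.run Y.root []" using Y.trivial_DG_iff triv es(1) by simp
  then have "htp ?y ?y es []" using Y.htp_iff_run[OF es(1) k] by blast
  then have "run r es = run r []" using htp_run r(1) by blast
  then show False using es(2) \<open>r' \<noteq> r\<close> by simp
qed

text \<open>\<open>x\<close> and \<open>z\<close> label paths from the origin to \<open>s\<close>
  and from \<open>s\<close> to the terminus; \<open>y\<close> labels a path from \<open>s\<close> to
  its translate. The translates of the first two paths keep their labels but end and begin at the
  translate of \<open>s\<close>, so that comparing paths with common ends gives the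
  equalities.\<close>

lemma displaced_words:
  assumes P: "P \<in> carrier DG" and B: "B \<in> carrier DG" and s: "hyp P s"
    and bf: "before s (apV B s)" and fixed: "apV P (apV B s) = apV B s"
  shows "\<exists>x\<in>nonempty_words \<Sigma>. \<exists>y\<in>nonempty_words \<Sigma>. \<exists>z\<in>nonempty_words \<Sigma>.
    equal_modulo \<Sigma> R (x @ y) x \<and> equal_modulo \<Sigma> R (y @ z) z \<and>
    equal_modulo \<Sigma> R (x @ z) w \<and> \<not> trivial_group (diagram_group \<Sigma> R y)"
proof -
  have V: "Vt s" "s \<noteq> terminus" "apV P s = s" "\<And>e. e \<in> EV s \<Longrightarrow> ap P e \<noteq> e" using s by (auto simp: hyp_def)
  obtain r where r: "vpath s r (apV B s)" "r \<noteq> []" using bf by (auto simp: before_def)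
  obtain a b where a: "vpath origin a s" and b: "vpath s b terminus" using state_vertex[OF V(1)] by blast
  have Ba: "vpath origin (map (ap B) a) (apV B s)" using ap_vpath[OF B a] by (simp add: apV_ends)
  have Bb: "vpath (apV B s) (map (ap B) b) terminus" using ap_vpath[OF B b] by (simp add: apV_ends(2)[OF B])
  have ane: "a \<noteq> []"
  proof
    assume "a = []"
    then have "s = origin" using a by simp
    then show False using before_pos[OF bf] by (simp add: apV_ends)
  qed
  have bne: "b \<noteq> []" using b V(2) by auto
  have "equal_modulo \<Sigma> R (map lab (a @ r)) (map lab (map (ap B) a))"
    by (rule vpath_equal_modulo[OF vpath_appendI[OF a r(1)] Ba]) (use ane in simp)
  then have 1: "equal_modulo \<Sigma> R (map lab a @ map lab r) (map lab a)" unfolding ap_map_lab[OF B a] by simp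
  have "equal_modulo \<Sigma> R (map lab (r @ map (ap B) b)) (map lab b)"
    by (rule vpath_equal_modulo[OF vpath_appendI[OF r(1) Bb] b]) (use r(2) in simp)
  then have 2: "equal_modulo \<Sigma> R (map lab r @ map lab b) (map lab b)"
    using ap_map_lab[OF B b] by (simp only: map_append)
  have "equal_modulo \<Sigma> R (map lab (a @ b)) (map lab root)"
    by (rule vpath_equal_modulo[OF vpath_appendI[OF a b] state_root]) (use ane in simp)
  then have 3: "equal_modulo \<Sigma> R (map lab a @ map lab b) w" using lab_root by simp
  have r': "vpath s (map (ap P) r) (apV B s)" using ap_vpath[OF P r(1)] V(3) fixed by simp
  have "hd r \<in> EV s" using vpath_ends(1)[OF r] vpath_valid[OF r(1) hd_in_set[OF r(2)]] by (simp add: EV_def)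
  then have "hd (map (ap P) r) \<noteq> hd r" using V(4) r(2) by (simp add: hd_map)
  then have "map (ap P) r \<noteq> r" by metis
  then have 4: "\<not> trivial_group (diagram_group \<Sigma> R (map lab r))"
    using nontrivial_subpath[OF r(1) r' ap_map_lab[OF P r(1)] _ r(2)] by blast
  show ?thesis
    using 1 2 3 4 vpath_lab_word[OF a ane] vpath_lab_word[OF r] vpath_lab_word[OF b bne] by blast
qed

theorem commuting_conjugates_words:
  assumes a: "a \<in> carrier DG" and b: "b \<in> carrier DG"
    and neq: "commutator DG a b \<noteq> \<one>\<^bsub>DG\<^esub>" and com: "commutator DG a (conjugate DG a b) = \<one>\<^bsub>DG\<^esub>"
  shows "\<exists>x\<in>nonempty_words \<Sigma>. \<exists>y\<in>nonempty_words \<Sigma>. \<exists>z\<in>nonempty_words \<Sigma>.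
    equal_modulo \<Sigma> R (x @ y) x \<and> equal_modulo \<Sigma> R (y @ z) z \<and>
    equal_modulo \<Sigma> R (x @ z) w \<and> \<not> trivial_group (diagram_group \<Sigma> R y)"
proof -
  interpret group DG by (rule group_DG)
  define d where "d = conjugate DG a b"
  have d: "d \<in> carrier DG" using a b by (simp add: d_def conjugate_def)
  have conj: "b \<otimes>\<^bsub>DG\<^esub> d = a \<otimes>\<^bsub>DG\<^esub> b" using a b by (simp add: d_def conjugate_def m_assoc[symmetric])
  have comm: "a \<otimes>\<^bsub>DG\<^esub> d = d \<otimes>\<^bsub>DG\<^esub> a"
  proof -
    have "inv\<^bsub>DG\<^esub> a \<otimes>\<^bsub>DG\<^esub> inv\<^bsub>DG\<^esub> d \<otimes>\<^bsub>DG\<^esub> a \<otimes>\<^bsub>DG\<^esub> d = \<one>\<^bsub>DG\<^esub>" using com by (simp add: d_def commutator_def)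
    then have "inv\<^bsub>DG\<^esub> (d \<otimes>\<^bsub>DG\<^esub> a) \<otimes>\<^bsub>DG\<^esub> (a \<otimes>\<^bsub>DG\<^esub> d) = \<one>\<^bsub>DG\<^esub>" using a d by (simp add: inv_mult_group m_assoc)
    then show ?thesis using a d by (metis inv_equality inv_inv m_closed inv_closed)
  qed
  define c where "c = inv\<^bsub>DG\<^esub> a \<otimes>\<^bsub>DG\<^esub> d"
  have c: "c \<in> carrier DG" using a d by (simp add: c_def)
  have "c = commutator DG a b" using a b by (simp add: c_def d_def conjugate_def commutator_def m_assoc)
  then have "c \<noteq> \<one>\<^bsub>DG\<^esub>" using neq by simp
  then obtain s where s: "hyp c s" using hyp_exists[OF c] by blast
  have ac: "a \<otimes>\<^bsub>DG\<^esub> c = d" using a d by (simp add: c_def m_assoc[symmetric])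
  have ca: "c \<otimes>\<^bsub>DG\<^esub> a = d"
  proof -
    have "c \<otimes>\<^bsub>DG\<^esub> a = inv\<^bsub>DG\<^esub> a \<otimes>\<^bsub>DG\<^esub> (a \<otimes>\<^bsub>DG\<^esub> d)" using a d comm by (simp add: c_def m_assoc)
    then show ?thesis using a d by (simp add: m_assoc[symmetric])
  qed
  have cd: "c \<otimes>\<^bsub>DG\<^esub> d = d \<otimes>\<^bsub>DG\<^esub> c"
  proof -
    have "c \<otimes>\<^bsub>DG\<^esub> d = c \<otimes>\<^bsub>DG\<^esub> (a \<otimes>\<^bsub>DG\<^esub> c)" using ac by simp
    also have "\<dots> = d \<otimes>\<^bsub>DG\<^esub> c" using a c ca by (simp add: m_assoc[symmetric])
    finally show ?thesis .
  qed
  have V: "Vt s" "s \<noteq> terminus" "\<And>e. e \<in> EV s \<Longrightarrow> ap c e \<noteq> e" using s by (auto simp: hyp_def)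
  have "c \<otimes>\<^bsub>DG\<^esub> a = a \<otimes>\<^bsub>DG\<^esub> c" using ac ca by simp
  then have as: "apV a s = s" by (rule commuting_fixes_hyp[OF c a _ s])
  have ds: "apV d s = s" by (rule commuting_fixes_hyp[OF c d cd s])
  have ne: "ap a e \<noteq> ap d e" if e: "e \<in> EV s" for e
  proof
    assume eq: "ap a e = ap d e"
    have ve: "valid e" using e by (simp add: EV_def)
    have "ap a (ap c e) = ap a e" using ap_mult[OF a c ve] ac eq by simp
    then have "ap c e = e" using ap_inv(1)[OF a ve] ap_inv(1)[OF a ap_valid[OF c ve]] by simp
    then show False using V(3)[OF e] by simp
  qed
  have "hyp a s \<or> hyp d s"
  proof (rule ccontr)
    assume "\<not> (hyp a s \<or> hyp d s)"
    then obtain e f where ef: "e \<in> EV s" "ap a e = e" "f \<in> EV s" "ap d f = f"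
      using V(1,2) as ds by (auto simp: hyp_def)
    have c2: "ap a (ap d e) = ap d (ap a e)" if "e \<in> EV s" for e
      using ap_mult[OF a d, of e] ap_mult[OF d a, of e] comm that by (simp add: EV_def)
    obtain z where "z \<in> EV s" "ap a z = z" "ap d z = z"
      using tree_metric.commuting_elliptic[OF tree_EV ap_isometry[OF a as V(1)] ef(1,2)
          ap_isometry[OF d ds V(1)] ef(3,4) c2] by blast
    then show False using ne by metis
  qed
  then show ?thesis
  proof
    assume h: "hyp a s"
    obtain B where "B \<in> carrier DG" "before s (apV B s)" "apV a (apV B s) = apV B s"
      using displaced_vertex[OF a b d conj comm h ds ne] by blast
    then show ?thesis using displaced_words[OF a _ h] by blast
  next
    \<comment> \<open>Here \<open>a\<close> and \<open>d\<close> exchange their roles, with the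
      inverse of \<open>b\<close> as the conjugating element.\<close>
    assume h: "hyp d s"
    have ib: "inv\<^bsub>DG\<^esub> b \<in> carrier DG" using b by simp
    have conj': "inv\<^bsub>DG\<^esub> b \<otimes>\<^bsub>DG\<^esub> a = d \<otimes>\<^bsub>DG\<^esub> inv\<^bsub>DG\<^esub> b"
      using a b by (simp add: d_def conjugate_def m_assoc)
    obtain B where "B \<in> carrier DG" "before s (apV B s)" "apV d (apV B s) = apV B s"
      using displaced_vertex[OF d ib a conj' comm[symmetric] h as] ne by metis
    then show ?thesis using displaced_words[OF d _ h] by blast
  qed
qed

end

section \<open>The wreath product\<close>

abbreviation (input) ZwrZ :: "((int \<Rightarrow> int) \<times> int) monoid" where
  "ZwrZ \<equiv> wreath_product integer_group integer_group"

abbreviation supp :: "(int \<Rightarrow> int) \<Rightarrow> int set" where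
  "supp f \<equiv> {i. f i \<noteq> 0}"

lemma carrier_ZwrZ: "carrier ZwrZ = {f. finite (supp f)} \<times> UNIV"
  by (auto simp: wreath_product_def carrier_sum_group)

lemma mult_ZwrZ: "(f, p) \<otimes>\<^bsub>ZwrZ\<^esub> (g, q) = (\<lambda>i. f i + g (i - p), p + q)"
  by (simp add: wreath_product_def add.commute restrict_def)

lemma finite_supp_shift: "finite (supp f) \<Longrightarrow> finite (supp (\<lambda>i. f (i - m)))"
proof -
  assume "finite (supp f)"
  moreover have "supp (\<lambda>i. f (i - m)) = (\<lambda>i. i + m) ` supp f"
    by (force simp: image_iff intro: exI[of _ "_ - m"])
  ultimately show ?thesis by simp
qed

lemma finite_supp_add: "finite (supp f) \<Longrightarrow> finite (supp g) \<Longrightarrow> finite (supp (\<lambda>i. f i + g i))"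
  by (rule finite_subset[of _ "supp f \<union> supp g"]) auto

section \<open>Commutative subgroups from centralizers\<close>

definition centralizer :: "('g, 'm) monoid_scheme \<Rightarrow> 'g set \<Rightarrow> 'g set" where
  "centralizer G S = {x \<in> carrier G. \<forall>s\<in>S. x \<otimes>\<^bsub>G\<^esub> s = s \<otimes>\<^bsub>G\<^esub> x}"

lemma (in group) subgroup_centralizer:
  assumes S: "S \<subseteq> carrier G"
  shows "subgroup (centralizer G S) G"
proof (rule subgroupI)
  show "centralizer G S \<subseteq> carrier G" by (auto simp: centralizer_def)
  have "\<one> \<in> centralizer G S" using S by (auto simp: centralizer_def)
  then show "centralizer G S \<noteq> {}" by blast
  show "inv a \<in> centralizer G S" if "a \<in> centralizer G S" for a
  proof -
    have a: "a \<in> carrier G" "\<And>s. s \<in> S \<Longrightarrow> a \<otimes> s = s \<otimes> a" using that by (auto simp: centralizer_def)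
    have "inv a \<otimes> s = s \<otimes> inv a" if s: "s \<in> S" for s
    proof -
      have sG: "s \<in> carrier G" using s S by blast
      have "inv a \<otimes> s = inv a \<otimes> (s \<otimes> a) \<otimes> inv a" using a(1) sG by (simp add: m_assoc)
      also have "\<dots> = inv a \<otimes> (a \<otimes> s) \<otimes> inv a" using a(2)[OF s] by simp
      also have "\<dots> = s \<otimes> inv a" using a(1) sG by (simp add: m_assoc[symmetric])
      finally show ?thesis .
    qed
    then show ?thesis using a by (simp add: centralizer_def)
  qed
  show "a \<otimes> b \<in> centralizer G S" if "a \<in> centralizer G S" "b \<in> centralizer G S" for a b
  proof -
    have ab: "a \<in> carrier G" "b \<in> carrier G" "\<And>s. s \<in> S \<Longrightarrow> a \<otimes> s = s \<otimes> a" "\<And>s. s \<in> S \<Longrightarrow> b \<otimes> s = s \<otimes> b"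
      using that by (auto simp: centralizer_def)
    have "a \<otimes> b \<otimes> s = s \<otimes> (a \<otimes> b)" if s: "s \<in> S" for s
    proof -
      have sG: "s \<in> carrier G" using s S by blast
      have "a \<otimes> b \<otimes> s = a \<otimes> (s \<otimes> b)" using ab sG s by (simp add: m_assoc)
      also have "\<dots> = s \<otimes> (a \<otimes> b)" using ab(1,2) ab(3)[OF s] sG by (simp add: m_assoc[symmetric])
      finally show ?thesis .
    qed
    then show ?thesis using ab by (simp add: centralizer_def)
  qed
qed

text \<open>This places commuting elements in a commutative group, where \<open>finprod\<close> is
  at hand. As \<open>S\<close> lies in its own centralizer \<open>?Z\<close>, the double centralizer
  is contained in \<open>?Z\<close>, with which it commutes.\<close>

lemma (in group) bicentralizer:
  assumes S: "S \<subseteq> carrier G" and comm: "\<And>s t. \<lbrakk>s \<in> S; t \<in> S\<rbrakk> \<Longrightarrow> s \<otimes> t = t \<otimes> s"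
  shows "S \<subseteq> centralizer G (centralizer G S)"
    and "comm_group (G\<lparr>carrier := centralizer G (centralizer G S)\<rparr>)"
proof -
  let ?Z = "centralizer G S"
  have Z: "?Z \<subseteq> carrier G" by (auto simp: centralizer_def)
  show "S \<subseteq> centralizer G ?Z" using S by (auto simp: centralizer_def)
  have SZ: "S \<subseteq> ?Z" using S comm by (auto simp: centralizer_def)
  have sub: "subgroup (centralizer G ?Z) G" by (rule subgroup_centralizer[OF Z])
  have "x \<otimes> y = y \<otimes> x" if "x \<in> centralizer G ?Z" "y \<in> centralizer G ?Z" for x y
  proof -
    have "y \<in> ?Z" using that(2) SZ by (auto simp: centralizer_def)
    then show ?thesis using that(1) by (auto simp: centralizer_def)
  qed
  then show "comm_group (G\<lparr>carrier := centralizer G ?Z\<rparr>)"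
    by (intro group.group_comm_groupI[OF subgroup_imp_group[OF sub]]) simp
qed

text \<open>The subgroup \<open>St k\<close> separates the \<open>k\<close>-th conjugate of \<open>a\<close> from all the others, and \<open>V\<close> separates
  the base group from the powers of \<open>b\<close>.\<close>

locale wreath_pair = group G for G (structure) +
  fixes a b and St :: "int \<Rightarrow> 'a set" and V :: "'a set"
  assumes ab: "a \<in> carrier G" "b \<in> carrier G"
    and St: "\<And>k. subgroup (St k) G" and V: "subgroup V G"
    and in_St: "\<And>(i :: int) k (n :: int). i \<noteq> k \<Longrightarrow> b [^] i \<otimes> a [^] n \<otimes> b [^] (- i) \<in> St k"
    and not_St: "\<And>(k :: int) n. b [^] k \<otimes> a [^] n \<otimes> b [^] (- k) \<in> St k \<Longrightarrow> n = (0 :: int)"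
    and in_V: "\<And>(i :: int) (n :: int). b [^] i \<otimes> a [^] n \<otimes> b [^] (- i) \<in> V"
    and not_V: "\<And>m. b [^] m \<in> V \<Longrightarrow> m = (0 :: int)"
    and comm: "\<And>(i :: int) (j :: int) (m :: int) (n :: int). i \<noteq> j \<Longrightarrow> (b [^] i \<otimes> a [^] m \<otimes> b [^] (- i)) \<otimes> (b [^] j \<otimes> a [^] n \<otimes> b [^] (- j)) =
      (b [^] j \<otimes> a [^] n \<otimes> b [^] (- j)) \<otimes> (b [^] i \<otimes> a [^] m \<otimes> b [^] (- i))"
begin

definition E :: "int \<Rightarrow> int \<Rightarrow> 'a" where
  "E i n = b [^] i \<otimes> a [^] n \<otimes> b [^] (- i)"

lemma E_closed [simp]: "E i n \<in> carrier G"
  using ab by (simp add: E_def)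

lemma b_cancel: "x \<in> carrier G \<Longrightarrow> b [^] (- i) \<otimes> (b [^] (i::int) \<otimes> x) = x"
  "x \<in> carrier G \<Longrightarrow> b [^] (i::int) \<otimes> (b [^] (- i) \<otimes> x) = x"
  using ab int_pow_mult[OF ab(2), of "- i" i] int_pow_mult[OF ab(2), of i "- i"]
  by (simp_all add: m_assoc[symmetric])

lemma E_add: "E i (m + n) = E i m \<otimes> E i n"
  using ab b_cancel(1)[of "a [^] n \<otimes> b [^] (- i)" i] by (simp add: E_def m_assoc int_pow_mult)

lemma E_0 [simp]: "E i 0 = \<one>"
  using ab int_pow_mult[OF ab(2), of i "- i"] by (simp add: E_def)

lemma E_conj: "b [^] m \<otimes> E i n \<otimes> b [^] (- m) = E (i + m) n"
proof -
  have "b [^] (i + m) = b [^] m \<otimes> b [^] i" using int_pow_mult[OF ab(2), of m i] by (simp add: add.commute)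
  moreover have "b [^] (- (i + m)) = b [^] (- i) \<otimes> b [^] (- m)" using int_pow_mult[OF ab(2), of "- i" "- m"] by simp
  ultimately show ?thesis using ab by (simp add: E_def m_assoc)
qed

lemma E_comm: "E i m \<otimes> E j n = E j n \<otimes> E i m"
proof (cases "i = j")
  case True
  then show ?thesis using E_add[of i m n] E_add[of i n m] by (simp add: add.commute)
next
  case False
  show ?thesis unfolding E_def by (rule comm[OF False])
qed

definition C :: "'a set" where
  "C = centralizer G (centralizer G {E i n | i n. True})"

definition H where "H = G\<lparr>carrier := C\<rparr>"

lemma C: "E i n \<in> C" "comm_group H" "subgroup C G"
proof -
  let ?S = "{E i n | i n. True}"
  have S: "?S \<subseteq> carrier G" by auto
  have c: "s \<otimes> t = t \<otimes> s" if "s \<in> ?S" "t \<in> ?S" for s t using that E_comm by auto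
  note B = bicentralizer[OF S c]
  show "E i n \<in> C" using B(1) unfolding C_def by blast
  show "comm_group H" using B(2) unfolding C_def H_def .
  show "subgroup C G" unfolding C_def by (rule subgroup_centralizer) (auto simp: centralizer_def)
qed

sublocale H: comm_group H
  by (rule C(2))

lemma H_simps [simp]: "carrier H = C" "x \<otimes>\<^bsub>H\<^esub> y = x \<otimes> y" "\<one>\<^bsub>H\<^esub> = \<one>"
  by (simp_all add: H_def)

text \<open>The image of an element of the base group. For infinite support, \<open>finprod\<close>
  takes its default value \<open>\<one>\<close>, a case that \<open>F_subgroup\<close> treats
  separately.\<close>

definition F :: "(int \<Rightarrow> int) \<Rightarrow> 'a" where
  "F f = finprod H (\<lambda>i. E i (f i)) (supp f)"

lemma E_Pi: "(\<lambda>i. E i (f i)) \<in> A \<rightarrow> carrier H"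
  using C(1) by simp

lemma F_superset:
  assumes "finite B" "supp f \<subseteq> B"
  shows "F f = finprod H (\<lambda>i. E i (f i)) B"
  unfolding F_def
  by (rule H.finprod_mono_neutral_cong_left[OF assms]) (use E_Pi in auto)

lemma F_closed: "F f \<in> carrier G"
proof -
  have "F f \<in> carrier H" unfolding F_def by (rule H.finprod_closed[OF E_Pi])
  then show ?thesis using subgroup.subset[OF C(3)] by auto
qed

lemma F_add:
  assumes "finite (supp f)" "finite (supp g)"
  shows "F (\<lambda>i. f i + g i) = F f \<otimes> F g"
proof -
  let ?B = "supp f \<union> supp g"
  have B: "finite ?B" using assms by simp
  have "F (\<lambda>i. f i + g i) = finprod H (\<lambda>i. E i (f i + g i)) ?B"
    by (rule F_superset[OF B]) auto
  also have "\<dots> = finprod H (\<lambda>i. E i (f i) \<otimes>\<^bsub>H\<^esub> E i (g i)) ?B" by (simp add: E_add)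
  also have "\<dots> = finprod H (\<lambda>i. E i (f i)) ?B \<otimes>\<^bsub>H\<^esub> finprod H (\<lambda>i. E i (g i)) ?B"
    by (rule H.finprod_multf[OF E_Pi E_Pi])
  also have "finprod H (\<lambda>i. E i (f i)) ?B = F f" by (rule F_superset[OF B, symmetric]) auto
  also have "finprod H (\<lambda>i. E i (g i)) ?B = F g" by (rule F_superset[OF B, symmetric]) auto
  finally show ?thesis by simp
qed

lemma finprod_conj:
  "finite B \<Longrightarrow> finprod H (\<lambda>i. E (i + m) (f i)) B = b [^] m \<otimes> finprod H (\<lambda>i. E i (f i)) B \<otimes> b [^] (- m)"
proof (induction B rule: finite_induct)
  case empty
  then show ?case using ab int_pow_mult[OF ab(2), of m "- m"] by simp
next
  case (insert x B)
  have P: "(\<lambda>i. E (i + m) (f i)) \<in> B \<rightarrow> carrier H" using C(1) by simp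
  let ?p = "finprod H (\<lambda>i. E i (f i)) B"
  have p: "?p \<in> carrier G" using H.finprod_closed[OF E_Pi, of f B] subgroup.subset[OF C(3)] by auto
  have "finprod H (\<lambda>i. E (i + m) (f i)) (insert x B) = E (x + m) (f x) \<otimes> (b [^] m \<otimes> ?p \<otimes> b [^] (- m))"
    using H.finprod_insert[OF insert.hyps P] insert.IH C(1) by simp
  also have "\<dots> = b [^] m \<otimes> (E x (f x) \<otimes> ?p) \<otimes> b [^] (- m)"
    using ab p b_cancel(1)[of "?p \<otimes> b [^] (- m)" m] by (simp add: E_conj[symmetric] m_assoc)
  also have "E x (f x) \<otimes> ?p = finprod H (\<lambda>i. E i (f i)) (insert x B)"
    using H.finprod_insert[OF insert.hyps E_Pi] C(1) by simp
  finally show ?case .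
qed

lemma F_shift:
  assumes "finite (supp f)"
  shows "F (\<lambda>i. f (i - m)) = b [^] m \<otimes> F f \<otimes> b [^] (- m)"
proof -
  have "supp (\<lambda>i. f (i - m)) = (\<lambda>i. i + m) ` supp f"
    by (force simp: image_iff intro: exI[of _ "_ - m"])
  then have "F (\<lambda>i. f (i - m)) = finprod H (\<lambda>i. E i (f (i - m))) ((\<lambda>i. i + m) ` supp f)" by (simp add: F_def)
  also have "\<dots> = finprod H (\<lambda>i. E (i + m) (f (i + m - m))) (supp f)"
    by (rule H.finprod_reindex) (use C(1) in \<open>auto simp: inj_on_def\<close>)
  also have "\<dots> = b [^] m \<otimes> finprod H (\<lambda>i. E i (f i)) (supp f) \<otimes> b [^] (- m)"
    using finprod_conj[OF assms, of m f] by simp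
  finally show ?thesis by (simp add: F_def)
qed

lemma F_subgroup:
  assumes S: "subgroup S G" and f: "\<And>i. f i \<noteq> 0 \<Longrightarrow> E i (f i) \<in> S"
  shows "F f \<in> S"
proof -
  have "finite B \<Longrightarrow> B \<subseteq> supp f \<Longrightarrow> finprod H (\<lambda>i. E i (f i)) B \<in> S" for B
  proof (induction B rule: finite_induct)
    case empty
    then show ?case using subgroup.one_closed[OF S] by simp
  next
    case (insert x B)
    then show ?case using H.finprod_insert[OF insert.hyps(1,2) E_Pi, of f] C(1) f[of x]
        subgroup.m_closed[OF S] by simp
  qed
  then show ?thesis unfolding F_def
    by (cases "finite (supp f)") (use subgroup.one_closed[OF S] in auto)
qed

text \<open>Split off the factor with index \<open>k\<close>. All others lie in \<open>St k\<close>,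
  hence this one does too, and \<open>not_St\<close> gives \<open>f k = 0\<close>.\<close>

lemma F_eq_one:
  assumes fin: "finite (supp f)" and one: "F f = \<one>"
  shows "f = (\<lambda>i. 0)"
proof
  fix k
  let ?g = "f(k := 0)" and ?h = "\<lambda>i. if i = k then f k else 0"
  have g: "finite (supp ?g)" "supp ?h \<subseteq> {k}" by (rule finite_subset[OF _ fin]) auto
  have h: "F ?h = E k (f k)"
    using F_superset[OF _ g(2)] H.finprod_insert[of "{}" k "\<lambda>i. E i (?h i)"] C(1) by simp
  have "(\<lambda>i. ?g i + ?h i) = f" by auto
  then have "F f = F ?g \<otimes> E k (f k)"
    using F_add[OF g(1) finite_subset[OF g(2) finite.insertI[OF finite.emptyI]]] h by (simp only:)
  then have "F ?g \<otimes> E k (f k) = \<one>" using one by simp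
  then have "E k (f k) = inv (F ?g)" using inv_equality[of "F ?g" "E k (f k)"] F_closed
    by (metis E_closed inv_inv inv_closed inv_equality)
  moreover have "F ?g \<in> St k"
    by (rule F_subgroup[OF St]) (use in_St in \<open>auto simp: E_def split: if_splits\<close>)
  ultimately have "E k (f k) \<in> St k" using subgroup.m_inv_closed[OF St] by simp
  then show "f k = 0" using not_St by (simp add: E_def)
qed

definition Phi :: "(int \<Rightarrow> int) \<times> int \<Rightarrow> 'a" where
  "Phi = (\<lambda>(f, p). F f \<otimes> b [^] p)"

lemma Phi_mult:
  assumes "finite (supp f)" "finite (supp g)"
  shows "Phi ((f, p) \<otimes>\<^bsub>ZwrZ\<^esub> (g, q)) = Phi (f, p) \<otimes> Phi (g, q)"
proof -
  have "Phi ((f, p) \<otimes>\<^bsub>ZwrZ\<^esub> (g, q)) = F (\<lambda>i. f i + g (i - p)) \<otimes> b [^] (p + q)"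
    unfolding mult_ZwrZ by (simp add: Phi_def)
  also have "F (\<lambda>i. f i + g (i - p)) = F f \<otimes> F (\<lambda>i. g (i - p))"
    by (rule F_add[OF assms(1) finite_supp_shift[OF assms(2)]])
  also have "F (\<lambda>i. g (i - p)) = b [^] p \<otimes> F g \<otimes> b [^] (- p)" by (rule F_shift[OF assms(2)])
  also have "F f \<otimes> (b [^] p \<otimes> F g \<otimes> b [^] (- p)) \<otimes> b [^] (p + q) = F f \<otimes> b [^] p \<otimes> (F g \<otimes> b [^] q)"
    using F_closed ab b_cancel(1)[of "b [^] q" p] by (simp add: m_assoc int_pow_mult)
  finally show ?thesis by (simp add: Phi_def)
qed

text \<open>If two images agree, a power of \<open>b\<close> lies in the image of the base group and
  therefore in \<open>V\<close>, which forces \<open>p = q\<close>. Then \<open>F_eq_one\<close>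
  applies to the difference of \<open>f\<close> and \<open>g\<close>.\<close>

lemma Phi_inj: "inj_on Phi (carrier ZwrZ)"
proof (rule inj_onI)
  fix x y assume xy: "x \<in> carrier ZwrZ" "y \<in> carrier ZwrZ" "Phi x = Phi y"
  obtain f p g q where x: "x = (f, p)" "finite (supp f)" and y: "y = (g, q)" "finite (supp g)"
    using xy(1,2) unfolding carrier_ZwrZ by auto
  let ?n = "\<lambda>i. - g i"
  have n: "finite (supp ?n)" using y(2) by simp
  have "F (\<lambda>i. ?n i + g i) = \<one>" by (simp add: F_def)
  then have gn: "F ?n \<otimes> F g = \<one>" using F_add[OF n y(2)] by simp
  have eq: "F f \<otimes> b [^] p = F g \<otimes> b [^] q" using xy(3) x y by (simp add: Phi_def)
  have "F (\<lambda>i. ?n i + f i) = F ?n \<otimes> F f" by (rule F_add[OF n x(2)])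
  also have "\<dots> = F ?n \<otimes> (F f \<otimes> b [^] p) \<otimes> b [^] (- p)"
    using F_closed ab b_cancel(2)[of \<one> p] by (simp add: m_assoc)
  also have "\<dots> = (F ?n \<otimes> F g) \<otimes> b [^] q \<otimes> b [^] (- p)" using eq F_closed ab by (simp add: m_assoc)
  also have "\<dots> = b [^] (q + - p)" unfolding gn int_pow_mult[OF ab(2)] using ab by simp
  finally have F: "F (\<lambda>i. ?n i + f i) = b [^] (q + - p)" .
  have "F (\<lambda>i. ?n i + f i) \<in> V" by (rule F_subgroup[OF V]) (simp add: E_def in_V)
  then have "q + - p = 0" unfolding F by (rule not_V)
  then have "F (\<lambda>i. ?n i + f i) = \<one>" using F by simp
  from F_eq_one[OF finite_supp_add[OF n x(2)] this] have "?n i + f i = 0" for i by metis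
  then have "f = g" by (auto simp: fun_eq_iff)
  then show "x = y" using x y \<open>q + - p = 0\<close> by simp
qed

lemma contains_ZwrZ: "contains_copy G ZwrZ"
proof -
  let ?S = "Phi ` carrier ZwrZ"
  have closed: "Phi x \<in> carrier G" for x using F_closed ab by (auto simp: Phi_def split: prod.split)
  have hom: "Phi (x \<otimes>\<^bsub>ZwrZ\<^esub> y) = Phi x \<otimes> Phi y" if "x \<in> carrier ZwrZ" "y \<in> carrier ZwrZ" for x y
    using that Phi_mult by (auto simp: carrier_ZwrZ)
  have W: "x \<otimes>\<^bsub>ZwrZ\<^esub> y \<in> carrier ZwrZ" if "x \<in> carrier ZwrZ" "y \<in> carrier ZwrZ" for x y
    using that finite_supp_shift finite_supp_add by (auto simp: carrier_ZwrZ mult_ZwrZ)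
  have Phi_one: "Phi (\<lambda>i. 0, 0) = \<one>" by (simp add: Phi_def F_def)
  have sub: "subgroup ?S G"
  proof (rule subgroupI)
    show "?S \<subseteq> carrier G" using closed by blast
    have "(\<lambda>i. 0, 0) \<in> carrier ZwrZ" by (simp add: carrier_ZwrZ)
    then show "?S \<noteq> {}" by blast
    show "x \<otimes> y \<in> ?S" if xy: "x \<in> ?S" "y \<in> ?S" for x y
    proof -
      obtain x' y' where "x = Phi x'" "x' \<in> carrier ZwrZ" "y = Phi y'" "y' \<in> carrier ZwrZ" using xy by blast
      then have "x \<otimes> y = Phi (x' \<otimes>\<^bsub>ZwrZ\<^esub> y')" "x' \<otimes>\<^bsub>ZwrZ\<^esub> y' \<in> carrier ZwrZ" using hom W by simp_all
      then show ?thesis by blast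
    qed
    show "inv x \<in> ?S" if x: "x \<in> ?S" for x
    proof -
      obtain f p where fp: "x = Phi (f, p)" "finite (supp f)" using x unfolding carrier_ZwrZ by blast
      \<comment> \<open>The inverse in the wreath product; \<open>i - - p\<close> has the form to
        which \<open>finite_supp_shift\<close> applies.\<close>
      let ?y = "(\<lambda>i. - f (i - - p), - p)"
      have y: "?y \<in> carrier ZwrZ" using finite_supp_shift[OF fp(2), of "- p"] by (simp add: carrier_ZwrZ)
      have fpW: "(f, p) \<in> carrier ZwrZ" using fp(2) by (simp add: carrier_ZwrZ)
      have "?y \<otimes>\<^bsub>ZwrZ\<^esub> (f, p) = (\<lambda>i. 0, 0)" by (simp add: mult_ZwrZ)
      then have "Phi ?y \<otimes> x = \<one>" using hom[OF y fpW] Phi_one fp(1) by simp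
      then have "inv x = Phi ?y" using inv_equality closed fp(1) by simp
      then show ?thesis using y by blast
    qed
  qed
  have "Phi \<in> iso ZwrZ (G\<lparr>carrier := ?S\<rparr>)"
    using Phi_inj hom by (auto simp: iso_def hom_def bij_betw_def)
  then show ?thesis unfolding contains_copy_def is_iso_def using sub by blast
qed

end

lemma (in group) ZwrZ_commuting_conjugates:
  assumes "contains_copy G ZwrZ"
  shows "\<exists>a\<in>carrier G. \<exists>b\<in>carrier G. commutator G a b \<noteq> \<one> \<and> commutator G a (conjugate G a b) = \<one>"
proof -
  obtain S h where S: "subgroup S G" and h: "h \<in> iso ZwrZ (G\<lparr>carrier := S\<rparr>)"
    using assms unfolding contains_copy_def is_iso_def by blast
  have bij: "bij_betw h (carrier ZwrZ) S" using h by (simp add: iso_def)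
  have hom: "h (x \<otimes>\<^bsub>ZwrZ\<^esub> y) = h x \<otimes> h y" if "x \<in> carrier ZwrZ" "y \<in> carrier ZwrZ" for x y
    using h that by (auto simp: iso_def hom_def)
  \<comment> \<open>A generator of the base group at \<open>0\<close>, the shift, and the conjugate
    of the first by the second. It sits at \<open>-1\<close> because a conjugate has the inverse of
    the conjugating element on its left.\<close>
  let ?a = "(\<lambda>i. if i = 0 then 1 else 0, 0) :: (int \<Rightarrow> int) \<times> int"
    and ?b = "(\<lambda>i. 0, 1) :: (int \<Rightarrow> int) \<times> int"
    and ?d = "(\<lambda>i. if i = -1 then 1 else 0, 0) :: (int \<Rightarrow> int) \<times> int"
  have W: "?a \<in> carrier ZwrZ" "?b \<in> carrier ZwrZ" "?d \<in> carrier ZwrZ" by (simp_all add: carrier_ZwrZ)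
  have G: "h x \<in> carrier G" if "x \<in> carrier ZwrZ" for x
    using that bij subgroup.subset[OF S] by (auto simp: bij_betw_def)
  let ?A = "h ?a" and ?B = "h ?b" and ?D = "h ?d"
  have ABD: "?A \<in> carrier G" "?B \<in> carrier G" "?D \<in> carrier G" using G W by auto
  have "?b \<otimes>\<^bsub>ZwrZ\<^esub> ?d = ?a \<otimes>\<^bsub>ZwrZ\<^esub> ?b" by (auto simp: mult_ZwrZ)
  then have bd: "?B \<otimes> ?D = ?A \<otimes> ?B" using hom[OF W(2,3)] hom[OF W(1,2)] by simp
  have "?a \<otimes>\<^bsub>ZwrZ\<^esub> ?d = ?d \<otimes>\<^bsub>ZwrZ\<^esub> ?a" by (auto simp: mult_ZwrZ add.commute)
  then have ad: "?A \<otimes> ?D = ?D \<otimes> ?A" using hom[OF W(1,3)] hom[OF W(3,1)] by simp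
  have "?a \<noteq> ?d" by (simp add: fun_eq_iff) (metis zero_neq_one)
  then have neq: "?A \<noteq> ?D" using bij W by (auto simp: bij_betw_def inj_on_def)
  have D: "conjugate G ?A ?B = ?D"
  proof -
    have "conjugate G ?A ?B = inv ?B \<otimes> (?B \<otimes> ?D)" using ABD bd by (simp add: conjugate_def m_assoc)
    then show ?thesis using ABD by (simp add: m_assoc[symmetric])
  qed
  have com: "commutator G ?A ?B = inv ?A \<otimes> ?D"
    using ABD D[symmetric] by (simp add: commutator_def conjugate_def m_assoc)
  have "commutator G ?A ?B \<noteq> \<one>"
  proof
    assume "commutator G ?A ?B = \<one>"
    then have "?A \<otimes> (inv ?A \<otimes> ?D) = ?A" using com ABD by simp
    then show False using ABD neq by (simp add: m_assoc[symmetric])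
  qed
  moreover have "commutator G ?A (conjugate G ?A ?B) = \<one>"
  proof -
    have "commutator G ?A ?D = inv ?A \<otimes> inv ?D \<otimes> (?D \<otimes> ?A)" using ABD ad by (simp add: commutator_def m_assoc)
    also have "\<dots> = inv (?D \<otimes> ?A) \<otimes> (?D \<otimes> ?A)" using ABD by (simp add: inv_mult_group)
    also have "\<dots> = \<one>" using ABD by simp
    finally show ?thesis using D by simp
  qed
  ultimately show ?thesis using ABD by blast
qed

section \<open>Copies of the wreath product in diagram groups\<close>

text \<open>Renumbering the root edges embeds the 2-tree of a factor of a word into the 2-tree of
  the whole word.\<close>

primrec shift :: "nat \<Rightarrow> 'a tedge \<Rightarrow> 'a tedge" where
  "shift n (Root a i) = Root a (i + n)"
| "shift n (Child c u v k) = Child (map (shift n) c) u v k"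

lemma shift_inject: "shift n e = shift n f \<Longrightarrow> e = f"
proof (induction e arbitrary: f rule: tedge.induct)
  case (Root a i)
  then show ?case by (cases f) simp_all
next
  case (Child c u v k)
  then obtain c' where f: "f = Child c' u v k" "map (shift n) c = map (shift n) c'" by (cases f) simp_all
  have "c = c'" by (rule list.inj_map_strong[OF _ f(2)]) (rule Child.IH)
  then show ?case using f(1) by simp
qed

lemma map_shift_inject: "map (shift n) c = map (shift n) c' \<Longrightarrow> c = c'"
  by (rule list.inj_map_strong) (rule shift_inject)

lemma shift_block: "map (shift n) (block c u v) = block (map (shift n) c) u v"
  by (simp add: block_def)

text \<open>The point is that shifting creates no new blocks: if the shift of \<open>c\<close> is a
  block, its first edge shows that the base of this block is a shifted path, and then
  \<open>c\<close> is a block already.\<close>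

lemma shift_opp:
  assumes u: "u \<noteq> []"
  shows "opp (map (shift n) c) u v = map (shift n) (opp c u v)"
proof (cases "\<exists>c0. c = block c0 v u")
  case True
  then obtain c0 where c0: "c = block c0 v u" by blast
  show ?thesis unfolding c0 shift_block opp_block[OF u] ..
next
  case False
  have "\<nexists>d. map (shift n) c = block d v u"
  proof
    assume "\<exists>d. map (shift n) c = block d v u"
    then obtain d where d: "map (shift n) c = block d v u" by blast
    have len: "length c = length u" using arg_cong[OF d, of length] by simp
    then have "shift n (c ! 0) = map (shift n) c ! 0" using u by simp
    also have "\<dots> = Child d v u 0" unfolding d using u block_nth[of 0 u d v] by simp
    finally obtain e where e: "map (shift n) e = d" by (cases "c ! 0") auto
    have "map (shift n) c = map (shift n) (block e v u)" unfolding d shift_block e ..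
    then have "c = block e v u" by (rule map_shift_inject)
    then show False using False by blast
  qed
  then show ?thesis using opp_new[OF False] opp_new[of "map (shift n) c" v u] shift_block by metis
qed

context two_tree
begin

lemma run_shift: "kpath x es y \<Longrightarrow> run (map (shift n) r) es = map (shift n) (run r es)"
proof (induction es arbitrary: x r)
  case (Cons e es)
  obtain p u v q where e: "e = Edge p u v q" by (cases e)
  have "u \<noteq> []" using Cons.prems e RR_nonempty[of u v] by (auto simp: arc_Edge)
  then have "step (map (shift n) r) e = map (shift n) (step r e)"
    unfolding e step.simps by (simp add: take_map drop_map shift_opp)
  then show ?case using Cons.IH[of "edge_target e" "step r e"] Cons.prems by simp
qed simp

lemma step_middle:
  assumes "edge_source e = map lab r"
  shows "step (a @ r @ b) (shift_edge (map lab a) q e) = a @ step r e @ b"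
proof -
  obtain p u v q' where e: "e = Edge p u v q'" by (cases e)
  have "map lab r = p @ u @ q'" using assms e by simp
  then obtain r1 c r2 where r: "r = r1 @ c @ r2" "map lab r1 = p" "map lab c = u"
    by (rule map_eq_append3)
  have 1: "step r e = r1 @ opp c u v @ r2" unfolding e r(1) by (rule step_eq[OF r(2,3)])
  have "step ((a @ r1) @ c @ (r2 @ b)) (Edge (map lab a @ p) u v (q' @ q)) = (a @ r1) @ opp c u v @ (r2 @ b)"
    by (rule step_eq) (use r in simp_all)
  then show ?thesis using 1 unfolding r(1) e shift_edge_def by simp
qed

lemma run_middle:
  "kpath (map lab r) es y \<Longrightarrow> vpath s r t \<Longrightarrow>
    run (a @ r @ b) (map (shift_edge (map lab a) q) es) = a @ run r es @ b"
proof (induction es arbitrary: r)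
  case (Cons e es)
  have e: "arc e" "edge_source e = map lab r" "kpath (edge_target e) es y" using Cons.prems(1) by auto
  note s = step[OF Cons.prems(2) e(1,2)]
  have "kpath (map lab (step r e)) es y" using e(3) s(2) by simp
  from Cons.IH[OF this s(1)] show ?case using step_middle[OF e(2), of a b q] by simp
qed simp

lemma root_path_append: "i \<le> j \<Longrightarrow> j \<le> k \<Longrightarrow> root_path i k = root_path i j @ root_path j k"
  using upt_add_eq_append[of i j "k - j"] by (simp add: root_path_def)

text \<open>A closed path of the Squier complex which fixes a path \<open>r\<close> of the tree is null-homotopic, as the
  tree over \<open>map lab a @ map lab r @ map lab b\<close> contains a translate of the tree over
  \<open>map lab r\<close>.\<close>

lemma subpath_faithful:
  assumes r: "vpath s r t" "r \<noteq> []" and a: "vpath origin a s" and b: "vpath t b terminus"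
    and g: "kpath (map lab r) g (map lab r)" "run r g = r"
  shows "run (two_tree.root (map lab r)) g = two_tree.root (map lab r)"
proof -
  let ?p = "map lab a" and ?y = "map lab r" and ?q = "map lab b"
  define x where "x = ?p @ ?y @ ?q"
  have st: "state (a @ r @ b)" using a r(1) b vpath_appendI by blast
  have labx: "map lab (a @ r @ b) = x" by (simp add: x_def)
  have xW: "x \<in> nonempty_words \<Sigma>" using vpath_lab_word[OF st] r(2) labx by simp
  interpret Y: two_tree \<Sigma> R ?y
    by unfold_locales (use pres vpath_lab_word[OF r] in auto)
  interpret X: two_tree \<Sigma> R x
    by unfold_locales (use pres xW in auto)
  obtain es where es: "kpath w es x" "run root es = a @ r @ b" using state_kpath[OF st] labx by auto
  let ?g = "map (shift_edge ?p ?q) g"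
  have gx: "kpath x ?g x" unfolding x_def
    by (rule shift_kpath[OF g(1)]) (use vpath_lab_in[OF a] vpath_lab_in[OF b] in auto)
  have rung: "run (a @ r @ b) ?g = a @ r @ b" using run_middle[OF g(1) r(1), of a b ?q] g(2) by simp
  \<comment> \<open>The lift of \<open>?g\<close> from \<open>a @ r @ b\<close> is closed, so
    \<open>?g\<close> is null-homotopic at \<open>x\<close>. Hence its lift from
    \<open>X.root\<close> is closed as well.\<close>
  have "kpath w (es @ ?g) x" using es(1) gx kpath_append by blast
  moreover have "run root (es @ ?g) = run root es" unfolding run_simps es(2) by (rule rung)
  ultimately have h: "htp w x (es @ ?g) es" using htp_iff_run[OF _ es(1)] by blast
  have be: "kpath x (bar es) w" by (rule kpath_reverse[OF es(1)])
  have nil: "kpath x [] x" by simp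
  have 1: "htp x x (bar es @ (es @ ?g) @ []) (bar es @ es @ [])" by (rule htp_congr[OF h xW be nil])
  have "htp x x (bar es @ bar (bar es)) []" by (rule htp_bar[OF be xW])
  then have 2: "htp x x (bar es @ es) []" unfolding bar_bar .
  have "htp x x ([] @ (bar es @ es) @ ?g) ([] @ [] @ ?g)" by (rule htp_congr[OF 2 xW nil gx])
  then have 3: "htp x x (bar es @ es @ ?g) ?g" by simp
  have 4: "htp x x (bar es @ es @ ?g) (bar es @ es)" using 1 by simp
  have "htp x x ?g []" by (rule htp_trans[OF htp_sym[OF 3] htp_trans[OF 4 2]])
  then have "run X.root ?g = run X.root []" using X.htp_iff_run[OF gx nil] by blast
  then have fix_root: "run X.root ?g = X.root" by simp
  let ?i = "length ?p" and ?j = "length ?p + length ?y"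
  let ?A = "X.root_path 0 ?i" and ?B = "X.root_path ?j (length x)"
  have len: "?j \<le> length x" "?i \<le> length x" by (simp_all add: x_def)
  \<comment> \<open>The middle part of the root path over \<open>x\<close> is a shifted copy of the
    root path over \<open>?y\<close>, and running \<open>g\<close> commutes with the shift.\<close>
  have mid: "X.root_path ?i ?j = map (shift ?i) Y.root"
    unfolding X.root_path_def Y.root_def Y.root_path_def
    by (rule nth_equalityI) (simp_all add: x_def nth_append add.commute)
  have root_eq: "X.root = ?A @ map (shift ?i) Y.root @ ?B"
    unfolding mid[symmetric] X.root_def using X.root_path_append[of 0 ?i "length x"]
      X.root_path_append[of ?i ?j "length x"] len by simp
  have labA: "map lab ?A = ?p" unfolding X.root_path_def
    by (rule nth_equalityI) (simp_all add: x_def nth_append)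
  have vmid: "X.vpath (VRoot ?i) (map (shift ?i) Y.root) (VRoot ?j)"
    unfolding mid[symmetric] by (rule X.vpath_root_path) (use len in simp_all)
  have labm: "map lab (map (shift ?i) Y.root) = ?y" unfolding mid[symmetric] X.root_path_def
    by (rule nth_equalityI) (simp_all add: x_def nth_append)
  have "run X.root ?g = ?A @ run (map (shift ?i) Y.root) g @ ?B"
    using X.run_middle[OF _ vmid, of g ?y ?A ?B ?q] g(1) unfolding labA labm root_eq by simp
  also have "run (map (shift ?i) Y.root) g = map (shift ?i) (run Y.root g)"
    by (rule run_shift[OF g(1)])
  finally have "?A @ map (shift ?i) (run Y.root g) @ ?B = ?A @ map (shift ?i) Y.root @ ?B"
    using fix_root root_eq by simp
  then have "map (shift ?i) (run Y.root g) = map (shift ?i) Y.root" by simp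
  then show ?thesis by (rule map_shift_inject)
qed

section \<open>Elements fixing given paths and vertices\<close>

lemma fixp_start:
  assumes P: "P \<in> carrier DG" and r: "vpath x r y" "fixp P r" and y: "apV P y = y"
  shows "apV P x = x"
proof (cases r)
  case Nil
  then show ?thesis using r(1) y by simp
next
  case (Cons e r')
  then have "valid e" "src e = x" "ap P e = e" using r by (auto simp: fixp_def)
  then show ?thesis using ap_src[OF P] by metis
qed

lemma subgroup_fixp:
  assumes r: "vpath s r t"
  shows "subgroup {P \<in> carrier DG. fixp P r} DG"
proof -
  interpret group DG by (rule group_DG)
  have v: "valid e" if "e \<in> set r" for e by (rule vpath_valid[OF r that])
  show ?thesis
  proof (rule subgroupI)
    have "\<one>\<^bsub>DG\<^esub> \<in> {P \<in> carrier DG. fixp P r}" using ap_one v by (auto simp: fixp_def)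
    then show "{P \<in> carrier DG. fixp P r} \<noteq> {}" by blast
    show "inv\<^bsub>DG\<^esub> P \<in> {P \<in> carrier DG. fixp P r}" if P: "P \<in> {P \<in> carrier DG. fixp P r}" for P
    proof -
      have "ap (inv\<^bsub>DG\<^esub> P) e = e" if "e \<in> set r" for e
        using ap_inv(1)[of P e] v[OF that] P that by (auto simp: fixp_def)
      then show ?thesis using P by (simp add: fixp_def)
    qed
    show "P \<otimes>\<^bsub>DG\<^esub> Q \<in> {P \<in> carrier DG. fixp P r}"
      if P: "P \<in> {P \<in> carrier DG. fixp P r}" and Q: "Q \<in> {P \<in> carrier DG. fixp P r}" for P Q
    proof -
      have "ap (P \<otimes>\<^bsub>DG\<^esub> Q) e = e" if "e \<in> set r" for e
        using ap_mult[of P Q e] v[OF that] P Q that by (auto simp: fixp_def)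
      then show ?thesis using P Q by (simp add: fixp_def)
    qed
  qed blast
qed

lemma subgroup_apV:
  assumes x: "Vt x"
  shows "subgroup {P \<in> carrier DG. apV P x = x} DG"
proof -
  interpret group DG by (rule group_DG)
  show ?thesis
  proof (rule subgroupI)
    have "\<one>\<^bsub>DG\<^esub> \<in> {P \<in> carrier DG. apV P x = x}" using apV_one[OF x] by simp
    then show "{P \<in> carrier DG. apV P x = x} \<noteq> {}" by blast
    show "inv\<^bsub>DG\<^esub> P \<in> {P \<in> carrier DG. apV P x = x}" if "P \<in> {P \<in> carrier DG. apV P x = x}" for P
      using that apV_inv(1)[of P x] x by auto
    show "P \<otimes>\<^bsub>DG\<^esub> Q \<in> {P \<in> carrier DG. apV P x = x}"
      if "P \<in> {P \<in> carrier DG. apV P x = x}" and "Q \<in> {P \<in> carrier DG. apV P x = x}" for P Q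
      using that apV_mult[of P Q x] x by auto
  qed blast
qed

lemma fixp_conj:
  assumes P: "P \<in> carrier DG" and Q: "Q \<in> carrier DG" and r: "vpath s r t" "fixp P r"
  shows "fixp (Q \<otimes>\<^bsub>DG\<^esub> P \<otimes>\<^bsub>DG\<^esub> inv\<^bsub>DG\<^esub> Q) (map (ap Q) r)"
proof -
  interpret group DG by (rule group_DG)
  have "ap (Q \<otimes>\<^bsub>DG\<^esub> P \<otimes>\<^bsub>DG\<^esub> inv\<^bsub>DG\<^esub> Q) (ap Q e) = ap Q e" if e: "e \<in> set r" for e
  proof -
    have v: "valid e" by (rule vpath_valid[OF r(1) e])
    have "ap (Q \<otimes>\<^bsub>DG\<^esub> P \<otimes>\<^bsub>DG\<^esub> inv\<^bsub>DG\<^esub> Q) (ap Q e) = ap (Q \<otimes>\<^bsub>DG\<^esub> P) (ap (inv\<^bsub>DG\<^esub> Q) (ap Q e))"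
      by (rule ap_mult[OF m_closed[OF Q P] inv_closed[OF Q] ap_valid[OF Q v]])
    also have "\<dots> = ap Q (ap P e)" unfolding ap_inv(1)[OF Q v] by (rule ap_mult[OF Q P v])
    also have "ap P e = e" using r(2) e by (simp add: fixp_def)
    finally show ?thesis .
  qed
  then show ?thesis by (simp add: fixp_def)
qed

lemma apV_conj:
  assumes P: "P \<in> carrier DG" and Q: "Q \<in> carrier DG" and x: "Vt x" "apV P x = x"
  shows "apV (Q \<otimes>\<^bsub>DG\<^esub> P \<otimes>\<^bsub>DG\<^esub> inv\<^bsub>DG\<^esub> Q) (apV Q x) = apV Q x"
proof -
  interpret group DG by (rule group_DG)
  have "apV (Q \<otimes>\<^bsub>DG\<^esub> P \<otimes>\<^bsub>DG\<^esub> inv\<^bsub>DG\<^esub> Q) (apV Q x) = apV (Q \<otimes>\<^bsub>DG\<^esub> P) (apV (inv\<^bsub>DG\<^esub> Q) (apV Q x))"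
    by (rule apV_mult[OF m_closed[OF Q P] inv_closed[OF Q] apV_Vt[OF Q x(1)]])
  also have "\<dots> = apV Q (apV P x)" unfolding apV_inv(1)[OF Q x(1)] by (rule apV_mult[OF Q P x(1)])
  finally show ?thesis unfolding x(2) .
qed

text \<open>The translate of \<open>r\<close> by \<open>Q\<close> is again a path from the origin to
  \<open>x\<close>, so \<open>P\<close> fixes it and both products act on \<open>r\<close> like
  \<open>Q\<close>. In the same way both act on \<open>r'\<close> like \<open>P\<close>. The action
  on one state determines an element.\<close>

lemma disjoint_supports_commute:
  assumes P: "P \<in> carrier DG" and Q: "Q \<in> carrier DG"
    and r: "vpath origin r x" "fixp P r" and r': "vpath x r' terminus" "fixp Q r'"
  shows "P \<otimes>\<^bsub>DG\<^esub> Q = Q \<otimes>\<^bsub>DG\<^esub> P"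
proof -
  interpret group DG by (rule group_DG)
  have Px: "apV P x = x" by (rule fixp_end[OF P r]) (rule apV_ends)
  have Qx: "apV Q x = x" by (rule fixp_start[OF Q r']) (rule apV_ends(2)[OF Q])
  have Qr: "vpath origin (map (ap Q) r) x" using ap_vpath[OF Q r(1)] unfolding apV_ends(1) Qx .
  have Pr: "vpath x (map (ap P) r') terminus" using ap_vpath[OF P r'(1)] unfolding apV_ends(2)[OF P] Px .
  have PQr: "ap P (ap Q e) = ap Q e" if "e \<in> set r" for e
    using fixp_connected[OF P r(1) Qr r(2)] that by (simp add: fixp_def)
  have QPr: "ap Q (ap P e) = ap P e" if "e \<in> set r'" for e
    using fixp_connected[OF Q r'(1) Pr r'(2)] that by (simp add: fixp_def)
  have "ap (P \<otimes>\<^bsub>DG\<^esub> Q) e = ap (Q \<otimes>\<^bsub>DG\<^esub> P) e" if e: "e \<in> set (r @ r')" for e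
  proof -
    have v: "valid e" using e vpath_valid[OF r(1)] vpath_valid[OF r'(1)] by auto
    show ?thesis unfolding ap_mult[OF P Q v] ap_mult[OF Q P v]
      using e PQr[of e] QPr[of e] r(2) r'(2) by (auto simp: fixp_def)
  qed
  then have "map (ap (P \<otimes>\<^bsub>DG\<^esub> Q)) (r @ r') = map (ap (Q \<otimes>\<^bsub>DG\<^esub> P)) (r @ r')" by (rule map_cong[OF HOL.refl])
  from faithful[OF m_closed[OF P Q] m_closed[OF Q P] vpath_appendI[OF r(1) r'(1)] this] show ?thesis .
qed

end

text \<open>The path \<open>Y\<close> runs from \<open>apV b v\<close> to \<open>v\<close>, and \<open>a\<close> acts trivially outside \<open>Y\<close>, so the conjugates
  of \<open>a\<close> by powers of \<open>b\<close> have their supports on the consecutive translates of \<open>Y\<close>.\<close>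

locale translated_support = two_tree \<Sigma> R w for \<Sigma> :: "'a set" and R w +
  fixes a b :: "'a edge list set" and X Y Z v
  assumes a: "a \<in> carrier DG" "a \<noteq> \<one>\<^bsub>DG\<^esub>" and b: "b \<in> carrier DG"
    and X: "vpath origin X (apV b v)" "fixp a X" and Y: "vpath (apV b v) Y v" "Y \<noteq> []"
    and Z: "vpath v Z terminus" "fixp a Z"
begin

sublocale group DG
  by (rule group_DG)

abbreviation bp :: "int \<Rightarrow> 'a edge list set" where
  "bp j \<equiv> b [^]\<^bsub>DG\<^esub> j"

abbreviation ap_pow :: "int \<Rightarrow> 'a edge list set" where
  "ap_pow n \<equiv> a [^]\<^bsub>DG\<^esub> n"

text \<open>Since \<open>Y\<close> leads from \<open>apV b v\<close> to \<open>v\<close>, the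
  vertices \<open>VV j\<close> are passed in decreasing order of \<open>j\<close> on the way from
  the origin to the terminus.\<close>

definition VV :: "int \<Rightarrow> 'a vert" where
  "VV j = apV (bp j) v"

definition YY :: "int \<Rightarrow> 'a tedge list" where
  "YY j = map (ap (bp j)) Y"

lemma bp_closed: "bp j \<in> carrier DG"
  using b by simp

lemma ap_pow_closed: "ap_pow n \<in> carrier DG"
  using a by simp

lemma Vt_v: "Vt v"
  by (rule vpath_Vt[OF Z(1)]) (simp add: Vt_def)

lemma VV_shift: "apV (bp i) (VV j) = VV (i + j)"
  unfolding VV_def int_pow_mult[OF b] by (rule apV_mult[OF bp_closed bp_closed Vt_v, symmetric])

lemma Vt_VV: "Vt (VV j)"
  unfolding VV_def by (rule apV_Vt[OF bp_closed Vt_v])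

lemma VV_0: "VV 0 = v"
  using apV_one[OF Vt_v] by (simp add: VV_def)

lemma VV_1: "VV 1 = apV b v"
  using b by (simp add: VV_def)

lemma YY_shift: "map (ap (bp i)) (YY j) = YY (i + j)"
proof -
  have "ap (bp i) (ap (bp j) e) = ap (bp (i + j)) e" if "e \<in> set Y" for e
    unfolding int_pow_mult[OF b] by (rule ap_mult[OF bp_closed bp_closed vpath_valid[OF Y(1) that], symmetric])
  then show ?thesis by (simp add: YY_def)
qed

lemma YY_0: "YY 0 = Y"
  using ap_one vpath_valid[OF Y(1)] by (simp add: YY_def map_idI)

lemma vpath_YY: "vpath (VV (j + 1)) (YY j) (VV j)"
  using ap_vpath[OF bp_closed Y(1), of j] unfolding VV_1[symmetric] VV_shift YY_def[symmetric] VV_def[symmetric] .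

lemma vpath_VV: "\<exists>c. vpath (VV (i + int n)) c (VV i) \<and> (0 < n \<longrightarrow> c \<noteq> [])"
proof (induction n)
  case 0
  show ?case by (intro exI[of _ "[]"]) simp
next
  case (Suc n)
  then obtain c where "vpath (VV (i + int n)) c (VV i)" by blast
  from vpath_appendI[OF vpath_YY this] have "vpath (VV (i + int (Suc n))) (YY (i + int n) @ c) (VV i)"
    by (simp add: ac_simps)
  then show ?case using Y(2) by (intro exI[of _ "YY (i + int n) @ c"]) (simp add: YY_def)
qed

lemma VV_path: "i \<le> j \<Longrightarrow> \<exists>c. vpath (VV j) c (VV i)"
  using vpath_VV[of i "nat (j - i)"] by auto

lemma VV_pos:
  assumes "i < j"
  shows "pos (VV j) < pos (VV i)"
proof -
  obtain c where "vpath (VV j) c (VV i)" "c \<noteq> []" using vpath_VV[of i "nat (j - i)"] assms by auto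
  then show ?thesis by (rule vpath_pos_less)
qed

lemma pow_fixp: "vpath s r t \<Longrightarrow> fixp a r \<Longrightarrow> fixp (ap_pow n) r"
  using subgroup_int_pow_closed[OF subgroup_fixp, of s r t a n] a by simp

text \<open>For \<open>1 \<le> j\<close> the path \<open>d\<close> can be prolonged to
  \<open>VV 1\<close>, the end of \<open>X\<close>, and \<open>fixp_connected\<close> compares the
  result with \<open>X\<close>.\<close>

lemma fixp_left:
  assumes d: "vpath origin d (VV j)" and j: "1 \<le> j"
  shows "fixp (ap_pow n) d"
proof -
  obtain c where c: "vpath (VV j) c (VV 1)" using VV_path[OF j] by blast
  have "fixp a (d @ c)" by (rule fixp_connected[OF a(1) X(1) _ X(2)]) (use vpath_appendI[OF d c] VV_1 in simp)
  then show ?thesis using pow_fixp[OF d] by (simp add: fixp_append)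
qed

lemma fixp_right:
  assumes d: "vpath (VV j) d terminus" and j: "j \<le> 0"
  shows "fixp (ap_pow n) d"
proof -
  obtain c where c: "vpath (VV 0) c (VV j)" using VV_path[OF j] by blast
  have "fixp a (c @ d)" by (rule fixp_connected[OF a(1) Z(1) _ Z(2)]) (use vpath_appendI[OF c d] VV_0 in simp)
  then show ?thesis using pow_fixp[OF d] by (simp add: fixp_append)
qed

lemma fixp_YY:
  assumes "j \<noteq> 0"
  shows "fixp (ap_pow n) (YY j)"
proof (cases "1 \<le> j")
  case True
  obtain d where "vpath origin d (VV (j + 1))" using state_vertex[OF Vt_VV] by blast
  from fixp_left[OF vpath_appendI[OF this vpath_YY] True] show ?thesis by (simp add: fixp_append)
next
  case False
  obtain d where "vpath (VV j) d terminus" using state_vertex[OF Vt_VV] by blast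
  from fixp_right[OF vpath_appendI[OF vpath_YY this]] show ?thesis using False assms by (simp add: fixp_append)
qed

lemma fixes_VV: "apV (ap_pow n) (VV j) = VV j"
proof -
  obtain d1 d2 where d: "vpath origin d1 (VV j)" "vpath (VV j) d2 terminus" using state_vertex[OF Vt_VV] by blast
  show ?thesis
  proof (cases "1 \<le> j")
    case True
    show ?thesis by (rule fixp_end[OF ap_pow_closed d(1) fixp_left[OF d(1) True]]) (rule apV_ends)
  next
    case False
    then have "j \<le> 0" by simp
    show ?thesis
      by (rule fixp_start[OF ap_pow_closed d(2) fixp_right[OF d(2) \<open>j \<le> 0\<close>]]) (rule apV_ends(2)[OF ap_pow_closed])
  qed
qed

definition cj :: "int \<Rightarrow> int \<Rightarrow> 'a edge list set" where
  "cj i n = bp i \<otimes>\<^bsub>DG\<^esub> ap_pow n \<otimes>\<^bsub>DG\<^esub> bp (- i)"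

lemma cj_inv: "cj i n = bp i \<otimes>\<^bsub>DG\<^esub> ap_pow n \<otimes>\<^bsub>DG\<^esub> inv\<^bsub>DG\<^esub> bp i"
  using int_pow_neg[OF b, of i] by (simp add: cj_def)

lemma cj_closed: "cj i n \<in> carrier DG"
  using bp_closed ap_pow_closed by (simp add: cj_def)

lemma fixp_cj: "vpath s r t \<Longrightarrow> fixp (ap_pow n) r \<Longrightarrow> fixp (cj i n) (map (ap (bp i)) r)"
  unfolding cj_inv by (rule fixp_conj[OF ap_pow_closed bp_closed])

lemma fixp_cj_YY:
  assumes "i \<noteq> k"
  shows "fixp (cj i n) (YY k)"
proof -
  have "fixp (cj i n) (map (ap (bp i)) (YY (k - i)))"
    by (rule fixp_cj[OF vpath_YY fixp_YY]) (use assms in simp)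
  then show ?thesis unfolding YY_shift by simp
qed

lemma cj_fixes_v: "apV (cj i n) v = v"
  using apV_conj[OF ap_pow_closed bp_closed Vt_VV fixes_VV, of i n "- i"] unfolding cj_inv[symmetric] VV_shift
  by (simp add: VV_0)

lemma pow_eq_one:
  assumes "ap_pow n = \<one>\<^bsub>DG\<^esub>"
  shows "n = 0"
proof (rule ccontr)
  assume "n \<noteq> 0"
  then have n: "0 < nat \<bar>n\<bar>" by simp
  have "ap_pow (int (nat \<bar>n\<bar>)) = \<one>\<^bsub>DG\<^esub>"
    using assms int_pow_neg[OF a(1), of n] by (cases "0 \<le> n") simp_all
  then show False using torsion_free[OF a n] unfolding int_pow_int by simp
qed

text \<open>After conjugating back, the power \<open>ap_pow n\<close> fixes \<open>Y\<close> and
  thus the whole state \<open>X @ Y @ Z\<close>. So it is trivial, and there is no torsion.\<close>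

lemma cj_moves_YY:
  assumes "fixp (cj k n) (YY k)"
  shows "n = 0"
proof -
  have "fixp (bp (- k) \<otimes>\<^bsub>DG\<^esub> cj k n \<otimes>\<^bsub>DG\<^esub> inv\<^bsub>DG\<^esub> bp (- k)) (map (ap (bp (- k))) (YY k))"
    by (rule fixp_conj[OF cj_closed bp_closed vpath_YY assms])
  moreover have "bp (- k) \<otimes>\<^bsub>DG\<^esub> cj k n \<otimes>\<^bsub>DG\<^esub> inv\<^bsub>DG\<^esub> bp (- k) = ap_pow n"
    unfolding cj_inv int_pow_neg[OF b] using bp_closed[of k] ap_pow_closed[of n]
    by (simp add: m_assoc) (simp add: m_assoc[symmetric])
  ultimately have fY: "fixp (ap_pow n) Y" unfolding YY_shift by (simp add: YY_0)
  have st: "state (X @ Y @ Z)" by (rule vpath_appendI[OF X(1) vpath_appendI[OF Y(1) Z(1)]])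
  have "fixp (ap_pow n) (X @ Y @ Z)" using fY pow_fixp[OF X] pow_fixp[OF Z] by (simp add: fixp_append)
  then have "map (ap (ap_pow n)) (X @ Y @ Z) = X @ Y @ Z" by (rule fixp_map)
  moreover have "map (ap \<one>\<^bsub>DG\<^esub>) (X @ Y @ Z) = X @ Y @ Z"
    by (rule map_idI) (rule ap_one[OF vpath_valid[OF st]])
  ultimately have "ap_pow n = \<one>\<^bsub>DG\<^esub>" using faithful[OF ap_pow_closed one_closed st] by simp
  then show ?thesis by (rule pow_eq_one)
qed

text \<open>The vertex \<open>VV j\<close> separates the supports: \<open>cj i m\<close> is trivial
  on paths from the origin to \<open>VV j\<close> because \<open>i < j\<close>, and
  \<open>cj j n\<close> is trivial on paths from \<open>VV j\<close> to the terminus.\<close>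

lemma cj_comm_less:
  assumes "i < j"
  shows "cj i m \<otimes>\<^bsub>DG\<^esub> cj j n = cj j n \<otimes>\<^bsub>DG\<^esub> cj i m"
proof -
  obtain d where d: "vpath origin d (VV (j - i))" using state_vertex[OF Vt_VV] by blast
  obtain d' where d': "vpath (VV 0) d' terminus" using state_vertex[OF Vt_VV] by blast
  have 1: "vpath origin (map (ap (bp i)) d) (VV j)"
    using ap_vpath[OF bp_closed d, of i] unfolding apV_ends(1) VV_shift by simp
  have 2: "vpath (VV j) (map (ap (bp j)) d') terminus"
    using ap_vpath[OF bp_closed d', of j] unfolding apV_ends(2)[OF bp_closed] VV_shift by simp
  have 3: "fixp (cj i m) (map (ap (bp i)) d)" by (rule fixp_cj[OF d fixp_left[OF d]]) (use assms in simp)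
  have 4: "fixp (cj j n) (map (ap (bp j)) d')" by (rule fixp_cj[OF d' fixp_right[OF d']]) simp
  show ?thesis by (rule disjoint_supports_commute[OF cj_closed cj_closed 1 3 2 4])
qed

text \<open>On the translate \<open>YY k\<close> only the \<open>k\<close>-th conjugate of a
  nontrivial power of \<open>a\<close> acts nontrivially. All conjugates fix \<open>v\<close>,
  whereas a nontrivial power of \<open>b\<close> moves \<open>v\<close> to a vertex at another
  position.\<close>

lemma wreath_pair_DG:
  "wreath_pair DG a b (\<lambda>k. {P \<in> carrier DG. fixp P (YY k)}) {P \<in> carrier DG. apV P v = v}"
proof (intro wreath_pair.intro wreath_pair_axioms.intro, unfold cj_def[symmetric])
  show "group DG" by (rule group_DG)
  show "a \<in> carrier DG" "b \<in> carrier DG" using a b by auto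
  show "subgroup {P \<in> carrier DG. fixp P (YY k)} DG" for k by (rule subgroup_fixp[OF vpath_YY])
  show "subgroup {P \<in> carrier DG. apV P v = v} DG" by (rule subgroup_apV[OF Vt_v])
  show "cj i n \<in> {P \<in> carrier DG. fixp P (YY k)}" if "i \<noteq> k" for i k n
    using fixp_cj_YY[OF that] cj_closed by simp
  show "n = 0" if "cj k n \<in> {P \<in> carrier DG. fixp P (YY k)}" for k n
    using cj_moves_YY[of k n] that by simp
  show "cj i n \<in> {P \<in> carrier DG. apV P v = v}" for i n
    using cj_fixes_v cj_closed by simp
  show "m = 0" if "bp m \<in> {P \<in> carrier DG. apV P v = v}" for m
  proof (rule ccontr)
    have "VV m = VV 0" using that unfolding VV_0 by (simp add: VV_def)
    moreover assume "m \<noteq> 0"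
    then have "m < 0 \<or> 0 < m" by linarith
    ultimately show False using VV_pos[of m 0] VV_pos[of 0 m] by auto
  qed
  show "cj i m \<otimes>\<^bsub>DG\<^esub> cj j n = cj j n \<otimes>\<^bsub>DG\<^esub> cj i m" if "i \<noteq> j" for i j m n
  proof (cases "i < j")
    case True
    then show ?thesis by (rule cj_comm_less)
  next
    case False
    then have "j < i" using that by simp
    then show ?thesis by (rule cj_comm_less[symmetric])
  qed
qed

lemma DG_contains_ZwrZ: "contains_copy DG ZwrZ"
  by (rule wreath_pair.contains_ZwrZ[OF wreath_pair_DG])

end

context two_tree
begin

theorem words_contain_ZwrZ:
  assumes xyz: "x \<in> nonempty_words \<Sigma>" "y \<in> nonempty_words \<Sigma>"
    and eq: "equal_modulo \<Sigma> R (x @ y) x" "equal_modulo \<Sigma> R (y @ z) z" "equal_modulo \<Sigma> R (x @ z) w"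
    and nontriv: "\<not> trivial_group (diagram_group \<Sigma> R y)"
  shows "contains_copy DG ZwrZ"
proof -
  interpret Y: two_tree \<Sigma> R y by unfold_locales (use pres xyz in auto)
  obtain \<gamma> where \<gamma>: "kpath y \<gamma> y" "run Y.root \<gamma> \<noteq> Y.root" using nontriv Y.trivial_DG_iff by blast
  obtain \<sigma> where \<sigma>: "kpath w \<sigma> (x @ z)" using equal_modulo_kpath[OF equal_modulo.sym[OF eq(3)]] by blast
  have "kpath (map lab root) \<sigma> (x @ z)" using \<sigma> lab_root by simp
  note s = run[OF this state_root]
  obtain X Z where XZ: "run root \<sigma> = X @ Z" "map lab X = x" "map lab Z = z"
    using s(2) by (metis map_eq_append_conv)
  obtain v where X: "vpath origin X v" and Z: "vpath v Z terminus" using s(1) XZ(1) vpath_append by metis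
  \<comment> \<open>The derivations of \<open>x @ y\<close> from \<open>x\<close> and of
    \<open>z\<close> from \<open>y @ z\<close> are lifted: \<open>X\<close> becomes
    \<open>X1 @ Y1\<close>, and \<open>Y1 @ Z\<close> becomes \<open>?Z1\<close>. Then
    \<open>X @ Z\<close> and \<open>X1 @ ?Z1\<close> have equal labels, and the element
    \<open>b\<close> that relates them moves \<open>v\<close> back to \<open>u\<close>.\<close>
  obtain \<pi> where \<pi>: "kpath x \<pi> (x @ y)" using equal_modulo_kpath[OF equal_modulo.sym[OF eq(1)]] by blast
  have "kpath (map lab X) \<pi> (x @ y)" using \<pi> XZ(2) by simp
  note p = run[OF this X]
  obtain X1 Y1 where XY1: "run X \<pi> = X1 @ Y1" "map lab X1 = x" "map lab Y1 = y"
    using p(2) by (metis map_eq_append_conv)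
  obtain u where X1: "vpath origin X1 u" and Y1: "vpath u Y1 v" using p(1) XY1(1) vpath_append by metis
  have Y1ne: "Y1 \<noteq> []" using XY1(3) xyz(2) by (auto simp: nonempty_words_def)
  obtain \<rho> where \<rho>: "kpath (y @ z) \<rho> z" using equal_modulo_kpath[OF eq(2)] by blast
  have "kpath (map lab (Y1 @ Z)) \<rho> z" using \<rho> XZ(3) XY1(3) by simp
  note q = run[OF this vpath_appendI[OF Y1 Z]]
  let ?Z1 = "run (Y1 @ Z) \<rho>"
  have "map lab (X @ Z) = map lab (X1 @ ?Z1)" using XZ XY1 q(2) by simp
  then obtain b where b: "b \<in> carrier DG" "map (ap b) (X @ Z) = X1 @ ?Z1"
    using transitive[OF vpath_appendI[OF X Z] vpath_appendI[OF X1 q(1)]] by blast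
  have "length X = length X1" using XZ(2) XY1(2) by (metis length_map)
  then have bX: "map (ap b) X = X1" using b(2) by simp
  have "vpath origin X1 (apV b v)" using ap_vpath[OF b(1) X] unfolding bX apV_ends(1) .
  then have u: "apV b v = u" using X1 path_unique unfolding vpath_def by blast
  \<comment> \<open>The nontrivial loop at \<open>y\<close> moves \<open>Y1\<close> to a different
    path with the same ends and label, by \<open>subpath_faithful\<close>. The element
    \<open>a\<close> replaces \<open>Y1\<close> by this path and fixes \<open>X1\<close> and
    \<open>Z\<close>.\<close>
  let ?Y2 = "run Y1 \<gamma>"
  have "kpath (map lab Y1) \<gamma> y" using \<gamma>(1) XY1(3) by simp
  note g = run[OF this Y1]
  have Y2: "?Y2 \<noteq> Y1"
    using subpath_faithful[OF Y1 Y1ne X1 Z, of \<gamma>] \<gamma> unfolding XY1(3) by blast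
  have st: "state (X1 @ Y1 @ Z)" "state (X1 @ ?Y2 @ Z)"
    using vpath_appendI[OF X1 vpath_appendI[OF Y1 Z]] vpath_appendI[OF X1 vpath_appendI[OF g(1) Z]] by auto
  have "map lab (X1 @ Y1 @ Z) = map lab (X1 @ ?Y2 @ Z)" using XY1(3) g(2) by simp
  then obtain a where a: "a \<in> carrier DG" "map (ap a) (X1 @ Y1 @ Z) = X1 @ ?Y2 @ Z"
    using transitive[OF st] by blast
  have "length ?Y2 = length Y1" using XY1(3) g(2) by (metis length_map)
  then have aXYZ: "map (ap a) X1 = X1" "map (ap a) Y1 = ?Y2" "map (ap a) Z = Z" using a(2) by simp_all
  have fX: "fixp a X1" "fixp a Z" unfolding fixp_def using aXYZ(1,3) by (metis map_idI list.map_id map_eq_conv list.map_ident)+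
  have "a \<noteq> \<one>\<^bsub>DG\<^esub>"
  proof
    assume "a = \<one>\<^bsub>DG\<^esub>"
    then have "map (ap a) Y1 = Y1" using ap_one vpath_valid[OF Y1] by (simp add: map_idI)
    then show False using aXYZ(2) Y2 by simp
  qed
  then have "translated_support \<Sigma> R w a b X1 Y1 Z v"
    by unfold_locales (use a b X1 Y1 Y1ne Z fX u in simp_all)
  then show ?thesis by (rule translated_support.DG_contains_ZwrZ)
qed

end

theorem theorem24:
  fixes \<Sigma> :: "'a set" and R :: "('a list \<times> 'a list) set" and w :: "'a list"
  assumes "semigroup_presentation \<Sigma> R" and "w \<in> nonempty_words \<Sigma>"
    and "G = diagram_group \<Sigma> R w"
  shows "(contains_copy G (wreath_product integer_group integer_group) \<longleftrightarrow>
           (\<exists>a\<in>carrier G. \<exists>b\<in>carrier G.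
              commutator G a b \<noteq> \<one>\<^bsub>G\<^esub> \<and> commutator G a (conjugate G a b) = \<one>\<^bsub>G\<^esub>)) \<and>
         (contains_copy G (wreath_product integer_group integer_group) \<longleftrightarrow>
           (\<exists>x\<in>nonempty_words \<Sigma>. \<exists>y\<in>nonempty_words \<Sigma>. \<exists>z\<in>nonempty_words \<Sigma>.
              equal_modulo \<Sigma> R (x @ y) x \<and> equal_modulo \<Sigma> R (y @ z) z \<and>
              equal_modulo \<Sigma> R (x @ z) w \<and> \<not> trivial_group (diagram_group \<Sigma> R y)))"
proof -
  let ?copy = "contains_copy G ZwrZ"
  let ?commute = "\<exists>a\<in>carrier G. \<exists>b\<in>carrier G.
    commutator G a b \<noteq> \<one>\<^bsub>G\<^esub> \<and> commutator G a (conjugate G a b) = \<one>\<^bsub>G\<^esub>"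
  let ?words = "\<exists>x\<in>nonempty_words \<Sigma>. \<exists>y\<in>nonempty_words \<Sigma>. \<exists>z\<in>nonempty_words \<Sigma>.
    equal_modulo \<Sigma> R (x @ y) x \<and> equal_modulo \<Sigma> R (y @ z) z \<and>
    equal_modulo \<Sigma> R (x @ z) w \<and> \<not> trivial_group (diagram_group \<Sigma> R y)"
  interpret two_tree \<Sigma> R w by unfold_locales (rule assms)+
  have "?copy \<Longrightarrow> ?commute" unfolding assms(3) by (rule group.ZwrZ_commuting_conjugates[OF group_DG])
  moreover have "?commute \<Longrightarrow> ?words" unfolding assms(3)
    by (elim bexE conjE) (rule commuting_conjugates_words)
  moreover have "?words \<Longrightarrow> ?copy" unfolding assms(3)
    by (elim bexE conjE) (rule words_contain_ZwrZ)
  ultimately show ?thesis by blast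
qed

end
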